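(* Let $H$ be a real Hilbert space, and let $A$ be a linear nonnegative self-adjoint operator on $H$. Let $T_0\in(0,1)$ be a real number, and let $\omega:(0,T_0]\to(0,+\infty)$ and $\psi:(0,T_0]\to(0,+\infty)$ be two nonincreasing functions such that $$\omega(t)(1+\psi(t))\leq K_0|\log t|\qquad\forall t\in(0,T_0]$$ for a suitable constant $K_0$. Let $c:(0,T_0]\to\mathbb{R}$ be a function of class $C^2$ satisfying the strict hyperbolicity condition $$0<\mu_1\leq c(t)\leq\mu_2\qquad\forall t\in(0,T_0)$$ for suitable positive real numbers $\mu_1$ and $\mu_2$, and the two estimates $$|c'(t)|\leq\frac{\omega(t)}{t}\qquad\forall t\in(0,T_0]$$ and $$|c''(t)|\leq\frac{\omega(t)^2}{t^2}\exp(\psi(t))\qquad\forall t\in(0,T_0].$$ Then the problem $$u''(t)+c(t)Au(t)=0,\qquad u(0)=u_0,\quad u'(0)=u_1,$$ considered in the time interval $[0,T_0]$, exhibits a finite derivative loss, that is, it is well-posed with finite derivative loss.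
   Context: Powers of $A$. For a real number $\beta$, $A^\beta$ denotes the power of the operator $A$ in the sense of the spectral theorem, and $D(A^\beta)$ denotes the corresponding space in the usual scale of spaces associated with $A$: for $\beta\geq 0$ it is the domain of $A^\beta$, and for $\beta<0$ it is a space of distributions. $\|\cdot\|$ denotes the norm of $H$. Solutions. The problem admits a unique solution for large classes of initial data, even if $c$ is just in $L^1((0,T_0))$; this solution is in general very weak (it lives in a space of hyperdistributions). By the spectral theorem the equation reduces to the family of ordinary differential equations $u_\lambda''(t)+\lambda^2c(t)u_\lambda(t)=0$ for the components of $u$, where $\lambda^2$ corresponds to the spectral parameter of $A$. Finite derivative loss. The problem is said to be well-posed with finite derivative loss if there exist positive real numbers $\delta$ and $M$ such that, for every real number $\beta$, and for every pair of initial data $(u_0,u_1)\in D(A^{\beta+1/2})\times D(A^\beta)$, the unique solution satisfies $$u\in C^0\left([0,T_0],D(A^{\beta-\delta+1/2})\right)\cap C^1\left([0,T_0],D(A^{\beta-\delta})\right)$$ and $$\|A^{\beta-\delta}u'(t)\|^2+\|A^{\beta-\delta+1/2}u(t)\|^2\leq M\left(\|A^{\beta}u_1\|^2+\|A^{\beta+1/2}u_0\|^2\right)\qquad\forall t\in[0,T_0].$$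
   Formalization: When 0 is in the spectrum of A, the norms ‖A^β·‖ in the definition of finite derivative loss are replaced by ‖(I+A)^β·‖, since the literal inequality then fails (e.g. A=0, β=δ, t=0); for coercive A the literal powers of A are kept. *)

theory Defs
  imports "HOL-Analysis.Analysis"
begin

text \<open>An unbounded operator on a real Hilbert space is a pair \<open>D\<close>, \<open>A\<close> of a domain and a total
  function whose values outside \<open>D\<close> are irrelevant.\<close>

definition densely_defined_operator :: "'h::real_inner set \<Rightarrow> ('h \<Rightarrow> 'h) \<Rightarrow> bool" where
  "densely_defined_operator D A \<longleftrightarrow>
     subspace D \<and> closure D = UNIV \<and>
     (\<forall>x\<in>D. \<forall>y\<in>D. A (x + y) = A x + A y) \<and>
     (\<forall>r. \<forall>x\<in>D. A (r *\<^sub>R x) = r *\<^sub>R A x)"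

text \<open>The right-hand side of the last equivalence says that \<open>(y, z)\<close> is in the graph of the adjoint.\<close>

definition self_adjoint :: "'h::real_inner set \<Rightarrow> ('h \<Rightarrow> 'h) \<Rightarrow> bool" where
  "self_adjoint D A \<longleftrightarrow>
     densely_defined_operator D A \<and>
     (\<forall>y z. (y \<in> D \<and> A y = z) \<longleftrightarrow> (\<forall>x\<in>D. inner (A x) y = inner x z))"

definition nonnegative_operator :: "'h::real_inner set \<Rightarrow> ('h \<Rightarrow> 'h) \<Rightarrow> bool" where
  "nonnegative_operator D A \<longleftrightarrow> (\<forall>x\<in>D. inner (A x) x \<ge> 0)"

definition coercive_operator :: "'h::real_inner set \<Rightarrow> ('h \<Rightarrow> 'h) \<Rightarrow> bool" where
  "coercive_operator D A \<longleftrightarrow> (\<exists>\<nu>>0. \<forall>x\<in>D. inner (A x) x \<ge> \<nu> * (norm x)\<^sup>2)"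

definition orthogonal_projection :: "('h::real_inner \<Rightarrow> 'h) \<Rightarrow> bool" where
  "orthogonal_projection P \<longleftrightarrow>
     bounded_linear P \<and> (\<forall>x. P (P x) = P x) \<and> (\<forall>x y. inner (P x) y = inner x (P y))"

text \<open>Right-continuous resolution of the identity on \<open>[0, \<infinity>)\<close>; \<open>E s\<close> is the spectral projection of
  the half-line \<open>(-\<infinity>, s]\<close>.\<close>

definition resolution_of_identity :: "(real \<Rightarrow> 'h::real_inner \<Rightarrow> 'h) \<Rightarrow> bool" where
  "resolution_of_identity E \<longleftrightarrow>
     (\<forall>s. orthogonal_projection (E s)) \<and>
     (\<forall>s t x. E s (E t x) = E (min s t) x) \<and>
     (\<forall>s<0. \<forall>x. E s x = 0) \<and>
     (\<forall>s x. ((\<lambda>t. E t x) \<longlongrightarrow> E s x) (at_right s)) \<and>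
     (\<forall>x. ((\<lambda>t. E t x) \<longlongrightarrow> x) at_top)"

text \<open>The scalar spectral measure \<open>d\<langle>E x, x\<rangle>\<close>.\<close>

definition spectral_measure :: "(real \<Rightarrow> 'h::real_inner \<Rightarrow> 'h) \<Rightarrow> 'h \<Rightarrow> real measure" where
  "spectral_measure E x = interval_measure (\<lambda>s. inner (E s x) x)"

text \<open>\<open>A = \<integral> \<lambda> dE(\<lambda>)\<close>. Given the domain, the quadratic form determines the symmetric operator by
  polarisation. For a nonnegative self-adjoint operator such an \<open>E\<close> exists and is unique (this is
  the spectral theorem).\<close>

definition spectral_resolution ::
    "'h::real_inner set \<Rightarrow> ('h \<Rightarrow> 'h) \<Rightarrow> (real \<Rightarrow> 'h \<Rightarrow> 'h) \<Rightarrow> bool" where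
  "spectral_resolution D A E \<longleftrightarrow>
     resolution_of_identity E \<and>
     D = {x. (\<integral>\<^sup>+ l. ennreal (l\<^sup>2) \<partial>spectral_measure E x) < \<infinity>} \<and>
     (\<forall>x\<in>D. inner (A x) x = (\<integral> l. l \<partial>spectral_measure E x))"

text \<open>A hyperdistribution is a formal vector all of whose truncations to bounded parts of the
  spectrum are in the Hilbert space: \<open>v n\<close> stands for \<open>E n v\<close>. A vector \<open>x\<close> of the Hilbert space is
  identified with \<open>\<lambda>n. E n x\<close>.\<close>

definition hyperdistributions :: "(real \<Rightarrow> 'h::real_inner \<Rightarrow> 'h) \<Rightarrow> (nat \<Rightarrow> 'h) set" where
  "hyperdistributions E = {v. \<forall>m n. m \<le> n \<longrightarrow> E (real m) (v n) = v m}"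

text \<open>The scale \<open>D(A\<^sup>\<beta>)\<close>, \<open>\<beta>\<close> an arbitrary real number. If \<open>A\<close> is coercive, the norm is the norm of
  \<open>A\<^sup>\<beta> v\<close>. If \<open>0\<close> is in the spectrum, the negative powers of \<open>A\<close> do not give a scale of spaces that
  decreases in \<open>\<beta>\<close> (and are undefined on the kernel), and the usual convention is to replace \<open>A\<close> by
  \<open>I + A\<close> in the norms; for \<open>\<beta> \<ge> 0\<close> this gives the domain of \<open>A\<^sup>\<beta>\<close> with its graph norm, up to
  equivalence.\<close>

definition scale_weight :: "'h::real_inner set \<Rightarrow> ('h \<Rightarrow> 'h) \<Rightarrow> real \<Rightarrow> real" where
  "scale_weight D A l = (if coercive_operator D A then l else 1 + l)"

text \<open>The square of the norm, as \<open>\<integral> \<lambda>\<^bsup>2\<beta>\<^esup> d\<langle>E v, v\<rangle>\<close>; the supremum over the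
  truncations is a monotone limit.\<close>

definition scale_norm_sq ::
    "'h::real_inner set \<Rightarrow> ('h \<Rightarrow> 'h) \<Rightarrow> (real \<Rightarrow> 'h \<Rightarrow> 'h) \<Rightarrow> real \<Rightarrow> (nat \<Rightarrow> 'h) \<Rightarrow> ennreal" where
  "scale_norm_sq D A E \<beta> v =
     (SUP n. \<integral>\<^sup>+ l. ennreal (scale_weight D A l powr (2 * \<beta>)) \<partial>spectral_measure E (v n))"

definition scale_space ::
    "'h::real_inner set \<Rightarrow> ('h \<Rightarrow> 'h) \<Rightarrow> (real \<Rightarrow> 'h \<Rightarrow> 'h) \<Rightarrow> real \<Rightarrow> (nat \<Rightarrow> 'h) set" where
  "scale_space D A E \<beta> = {v \<in> hyperdistributions E. scale_norm_sq D A E \<beta> v < \<infinity>}"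

definition scale_continuous_on ::
    "'h::real_inner set \<Rightarrow> ('h \<Rightarrow> 'h) \<Rightarrow> (real \<Rightarrow> 'h \<Rightarrow> 'h) \<Rightarrow> real \<Rightarrow> real set
      \<Rightarrow> (real \<Rightarrow> nat \<Rightarrow> 'h) \<Rightarrow> bool" where
  "scale_continuous_on D A E \<beta> S u \<longleftrightarrow>
     (\<forall>t\<in>S. u t \<in> scale_space D A E \<beta> \<and>
        ((\<lambda>s. scale_norm_sq D A E \<beta> (\<lambda>n. u s n - u t n)) \<longlongrightarrow> 0) (at t within S))"

text \<open>\<open>u\<close> is of class \<open>C\<^sup>1\<close> on \<open>S\<close> with values in \<open>D(A\<^sup>\<beta>)\<close>, with derivative \<open>u'\<close>.\<close>

definition scale_C1_on ::
    "'h::real_inner set \<Rightarrow> ('h \<Rightarrow> 'h) \<Rightarrow> (real \<Rightarrow> 'h \<Rightarrow> 'h) \<Rightarrow> real \<Rightarrow> real set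
      \<Rightarrow> (real \<Rightarrow> nat \<Rightarrow> 'h) \<Rightarrow> (real \<Rightarrow> nat \<Rightarrow> 'h) \<Rightarrow> bool" where
  "scale_C1_on D A E \<beta> S u u' \<longleftrightarrow>
     scale_continuous_on D A E \<beta> S u \<and> scale_continuous_on D A E \<beta> S u' \<and>
     (\<forall>t\<in>S. ((\<lambda>s. scale_norm_sq D A E \<beta>
                    (\<lambda>n. (1 / (s - t)) *\<^sub>R (u s n - u t n) - u' t n)) \<longlongrightarrow> 0) (at t within S))"

text \<open>Very weak solution of \<open>u'' + c(t) A u = 0\<close> in \<open>[0, T0]\<close> with values in the hyperdistributions
  (\<open>u'\<close> is its time derivative): every spectral truncation solves the equation. The truncations
  \<open>u t n = E n (u t)\<close> lie in \<open>D\<close>. As \<open>c\<close> is continuous in \<open>(0, T0]\<close> but possibly not at \<open>0\<close>, the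
  equation is required for \<open>t > 0\<close>, while \<open>u\<close> is of class \<open>C\<^sup>1\<close> up to \<open>t = 0\<close>.\<close>

definition very_weak_solution ::
    "('h::real_inner \<Rightarrow> 'h) \<Rightarrow> (real \<Rightarrow> 'h \<Rightarrow> 'h) \<Rightarrow> (real \<Rightarrow> real) \<Rightarrow> real \<Rightarrow> (nat \<Rightarrow> 'h) \<Rightarrow> (nat \<Rightarrow> 'h)
      \<Rightarrow> (real \<Rightarrow> nat \<Rightarrow> 'h) \<Rightarrow> (real \<Rightarrow> nat \<Rightarrow> 'h) \<Rightarrow> bool" where
  "very_weak_solution A E c T0 u0 u1 u u' \<longleftrightarrow>
     (\<forall>t\<in>{0..T0}. u t \<in> hyperdistributions E \<and> u' t \<in> hyperdistributions E) \<and>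
     (\<forall>n. \<forall>t\<in>{0..T0}. ((\<lambda>s. u s n) has_vector_derivative u' t n) (at t within {0..T0})) \<and>
     (\<forall>n. continuous_on {0..T0} (\<lambda>t. u' t n)) \<and>
     (\<forall>n. \<forall>t\<in>{0<..T0}.
        ((\<lambda>s. u' s n) has_vector_derivative - (c t *\<^sub>R A (u t n))) (at t within {0..T0})) \<and>
     u 0 = u0 \<and> u' 0 = u1"

definition well_posed_with_finite_derivative_loss ::
    "'h::real_inner set \<Rightarrow> ('h \<Rightarrow> 'h) \<Rightarrow> (real \<Rightarrow> real) \<Rightarrow> real \<Rightarrow> bool" where
  "well_posed_with_finite_derivative_loss D A c T0 \<longleftrightarrow>
     (\<exists>E. spectral_resolution D A E \<and>
       (\<exists>\<delta>>0. \<exists>M>0. \<forall>\<beta>::real.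
         \<forall>u0 \<in> scale_space D A E (\<beta> + 1/2). \<forall>u1 \<in> scale_space D A E \<beta>.
         \<exists>u u'. very_weak_solution A E c T0 u0 u1 u u' \<and>
           (\<forall>v v'. very_weak_solution A E c T0 u0 u1 v v' \<longrightarrow>
              (\<forall>t\<in>{0..T0}. v t = u t \<and> v' t = u' t)) \<and>
           scale_continuous_on D A E (\<beta> - \<delta> + 1/2) {0..T0} u \<and>
           scale_C1_on D A E (\<beta> - \<delta>) {0..T0} u u' \<and>
           (\<forall>t\<in>{0..T0}.
              scale_norm_sq D A E (\<beta> - \<delta>) (u' t) + scale_norm_sq D A E (\<beta> - \<delta> + 1/2) (u t)
              \<le> ennreal M * (scale_norm_sq D A E \<beta> u1 + scale_norm_sq D A E (\<beta> + 1/2) u0))))"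

end

(* By the spectral theorem the problem reduces to the scalar equations u'' + l c(t) u = 0, whose
   solutions are shown to grow at most polynomially in l, uniformly in t; polynomial growth of the
   multipliers u(t), u'(t) in l is exactly a finite loss of derivatives. Losing one more power of l
   makes u and u' Lipschitz continuous in time with values in the scale, which gives the required
   continuity and differentiability without any density argument.

   Three energies are used in three successive time intervals: the elementary one, the hyperbolic
   one with weight c, and the energy of the Liouville transform c^(1/4) u; in each interval the energy
   grows at most by a power of l.

   The spectral theorem is obtained from the resolvent B = (1 + A)^(-1), which satisfies 0 <= B <= 1:
   the Bernstein polynomials of a continuous function f, with B in place of the variable, are
   positive in f and converge strongly; the limit is the continuous functional calculus, and
   the spectral projections are strong limits of ramp functions of A. *)

theory Submission
  imports Defs
begin

section \<open>Continuous functional calculus of a positive contraction\<close>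

text \<open>Let \<xi> be the square root of l. The growth exponent of the Liouville energy from time
  t on is of order \<omega>^2 exp \<psi> / (\<xi> t), so the factor exp \<psi> allowed in the bound
  of c'' makes this energy too costly near t = 1 / \<xi>. Running the hyperbolic energy while t
  grows by a factor exp (1 + \<psi>) pays for that factor and costs the exponent \<omega> (1 +
  \<psi>), which is exactly what the hypothesis bounds by a multiple of |log t|. The loss is finite
  because of this trade, not because \<omega> or \<psi> is small. On the abstract side only
  continuous functions of A with bounded support are formed, and they act on spectrally truncated
  vectors. Multipliers must therefore be continuous in l; building the scalar solutions as power
  series in l gives this at once. The constant M must not depend on \<beta>. For this reason the
  estimates between two spaces of the scale involve only the difference of their indices, which is
  bounded from both sides.\<close>

lemma hilbert_closed_subspace_eq_UNIV:
  fixes S :: "'h::{real_inner, complete_space} set"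
  assumes S: "subspace S" "closed S" and orth: "\<And>y. (\<And>x. x \<in> S \<Longrightarrow> inner x y = 0) \<Longrightarrow> y = 0"
  shows "x \<in> S"
proof -
  define d where "d = (INF s\<in>S. (norm (x - s))\<^sup>2)"
  have ne: "S \<noteq> {}" using subspace_0[OF S(1)] by auto
  have bdd: "bdd_below ((\<lambda>s. (norm (x - s))\<^sup>2) ` S)"
    by (rule bdd_belowI[where m = 0]) auto
  have low: "d \<le> (norm (x - s))\<^sup>2" if "s \<in> S" for s
    unfolding d_def by (rule cINF_lower[OF bdd that])
  have "\<exists>s\<in>S. (norm (x - s))\<^sup>2 < d + 1 / real (Suc n)" for n
  proof -
    have "(INF s\<in>S. (norm (x - s))\<^sup>2) < d + 1 / real (Suc n)" unfolding d_def[symmetric] by simp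
    then show ?thesis using cINF_less_iff[OF ne bdd] by auto
  qed
  then obtain s where sS: "\<And>n. s n \<in> S" and s: "\<And>n. (norm (x - s n))\<^sup>2 < d + 1 / real (Suc n)"
    by metis
  \<comment> \<open>The midpoint of two elements of \<open>S\<close> is again in \<open>S\<close>,
    so the parallelogram law forces nearly minimising elements to be close to each other.\<close>
  have para: "(norm (s n - s m))\<^sup>2 \<le> 2 / real (Suc n) + 2 / real (Suc m)" for n m
  proof -
    have "(1/2) *\<^sub>R (s n + s m) \<in> S"
      using S(1) sS by (simp add: subspace_add subspace_scale)
    from low[OF this] have "4 * d \<le> (norm (2 *\<^sub>R (x - (1/2) *\<^sub>R (s n + s m))))\<^sup>2"
      by (simp add: power_mult_distrib)
    also have "2 *\<^sub>R (x - (1/2) *\<^sub>R (s n + s m)) = (x - s n) + (x - s m)"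
      by (simp add: algebra_simps scaleR_2)
    finally have 1: "4 * d \<le> (norm ((x - s n) + (x - s m)))\<^sup>2" .
    have "(norm ((x - s n) + (x - s m)))\<^sup>2 + (norm ((x - s m) - (x - s n)))\<^sup>2
        = 2 * (norm (x - s n))\<^sup>2 + 2 * (norm (x - s m))\<^sup>2"
      by (simp add: power2_norm_eq_inner inner_simps inner_commute)
    then have "(norm ((x - s m) - (x - s n)))\<^sup>2 \<le> 2 / real (Suc n) + 2 / real (Suc m)"
      using 1 s[of n] s[of m] by (simp add: algebra_simps)
    then show ?thesis by simp
  qed
  have "Cauchy s"
  proof (rule metric_CauchyI)
    fix e :: real assume e: "0 < e"
    obtain N where N: "4 / e\<^sup>2 < real N" using reals_Archimedean2 by blast
    have "dist (s m) (s n) < e" if "m \<ge> N" "n \<ge> N" for m n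
    proof -
      have N0: "0 < real N" using N e by (smt (verit) divide_pos_pos zero_less_power)
      have "2 / real (Suc m) \<le> 2 / real N" "2 / real (Suc n) \<le> 2 / real N"
        using that N0 by (intro divide_left_mono; simp)+
      then have "(norm (s m - s n))\<^sup>2 \<le> 4 / real N" using para[of m n] by linarith
      also have "\<dots> < e\<^sup>2" using N N0 e by (simp add: field_simps)
      finally show ?thesis using e by (simp add: dist_norm power2_less_imp_less)
    qed
    then show "\<exists>M. \<forall>m\<ge>M. \<forall>n\<ge>M. dist (s m) (s n) < e" by blast
  qed
  then obtain p where p: "s \<longlonglongrightarrow> p" using Cauchy_convergent convergent_def by blast
  have pS: "p \<in> S" using S(2) sS p closed_sequentially by blast
  have "(\<lambda>n. d + 1 / real (Suc n)) \<longlonglongrightarrow> d + 0"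
    by (intro tendsto_intros LIMSEQ_Suc lim_1_over_n)
  moreover have "(\<lambda>n. (norm (x - s n))\<^sup>2) \<longlonglongrightarrow> (norm (x - p))\<^sup>2" by (intro tendsto_intros p)
  ultimately have pd: "(norm (x - p))\<^sup>2 \<le> d"
    using LIMSEQ_le[of _ "(norm (x - p))\<^sup>2" _ d] s less_imp_le by (smt (verit) add_0_right)
  have "x - p = 0"
  proof (rule orth)
    fix z assume z: "z \<in> S"
    show "inner z (x - p) = 0"
    proof (cases "z = 0")
      case False
      \<comment> \<open>The minimiser of the quadratic polynomial in t that gives the squared
        distance from x to p + t z; minimality of p then forces the inner product to vanish.\<close>
      define t where "t = inner z (x - p) / inner z z"
      have zz: "0 < inner z z" using False by simp
      have "p + t *\<^sub>R z \<in> S" using pS z S(1) by (simp add: subspace_add subspace_scale)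
      from low[OF this] pd have "(norm (x - p))\<^sup>2 \<le> (norm (x - (p + t *\<^sub>R z)))\<^sup>2" by linarith
      also have "\<dots> = (norm (x - p))\<^sup>2 - 2 * t * inner z (x - p) + t\<^sup>2 * inner z z"
        unfolding power2_norm_eq_inner
        by (simp add: inner_simps inner_commute power2_eq_square algebra_simps)
      also have "\<dots> = (norm (x - p))\<^sup>2 - (inner z (x - p))\<^sup>2 / inner z z"
        using zz by (simp add: t_def field_simps power2_eq_square)
      finally have "(inner z (x - p))\<^sup>2 / inner z z \<le> 0" by linarith
      then show ?thesis using zz by (simp add: divide_le_0_iff)
    qed simp
  qed
  then show ?thesis using pS by simp
qed

text \<open>Polarisation expresses \<open>inner (T x) y\<close> through the quadratic form, and the
  parallelogram law adds up the two bounds. The calculus below produces order estimates; this turns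
  them into norm estimates.\<close>

lemma symmetric_norm_le:
  fixes T :: "'h::real_inner \<Rightarrow> 'h"
  assumes T: "linear T" and sym: "\<And>x y. inner (T x) y = inner x (T y)"
    and b: "\<And>x. \<bar>inner (T x) x\<bar> \<le> m * (norm x)\<^sup>2"
  shows "norm (T x) \<le> m * norm x"
proof (cases "T x = 0")
  case True
  have "0 \<le> m * norm x"
  proof (cases "x = 0")
    case False
    have "0 \<le> m * (norm x)\<^sup>2" using b[of x] by (smt (verit) abs_ge_zero)
    then show ?thesis using False by (simp add: zero_le_mult_iff)
  qed simp
  then show ?thesis using True by simp
next
  case False
  then have x0: "x \<noteq> 0" using linear_0[OF T] by auto
  have polar: "4 * inner (T x) y \<le> 2 * m * ((norm x)\<^sup>2 + (norm y)\<^sup>2)" for y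
  proof -
    have "4 * inner (T x) y = inner (T (x + y)) (x + y) - inner (T (x - y)) (x - y)"
      using sym[of y x] by (simp add: linear_add[OF T] linear_diff[OF T] inner_simps inner_commute)
    also have "\<dots> \<le> m * (norm (x + y))\<^sup>2 + m * (norm (x - y))\<^sup>2"
      using b[of "x + y"] b[of "x - y"] by linarith
    also have "\<dots> = 2 * m * ((norm x)\<^sup>2 + (norm y)\<^sup>2)"
      by (simp add: power2_norm_eq_inner inner_simps inner_commute algebra_simps)
    finally show ?thesis .
  qed
  \<comment> \<open>Multiplied by r, the vector \<open>T x\<close> has the norm of x, which balances
    the two squares.\<close>
  define r where "r = norm x / norm (T x)"
  have "4 * (r * (norm (T x))\<^sup>2) \<le> 2 * m * ((norm x)\<^sup>2 + (r * norm (T x))\<^sup>2)"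
    using polar[of "r *\<^sub>R T x"]
    by (simp add: power2_norm_eq_inner[symmetric] power_mult_distrib)
  moreover have "r * norm (T x) = norm x" using False by (simp add: r_def)
  moreover have "r * (norm (T x))\<^sup>2 = norm x * norm (T x)"
    using False by (simp add: r_def power2_eq_square)
  ultimately have "4 * (norm x * norm (T x)) \<le> 2 * m * ((norm x)\<^sup>2 + (norm x)\<^sup>2)" by simp
  then have "norm x * norm (T x) \<le> norm x * (m * norm x)"
    by (simp add: power2_eq_square algebra_simps)
  then show ?thesis using x0 by simp
qed

text \<open>The denominator a + 1 in place of a covers a = 0 in the epsilon arguments below.\<close>

lemma divide_add_one_mult_less:
  fixes e a :: real
  assumes "0 < e" "0 \<le> a"
  shows "e / (a + 1) * a < e"
proof -
  have "e / (a + 1) * a < e / (a + 1) * (a + 1)"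
    using assms by (intro mult_strict_left_mono divide_pos_pos) auto
  then show ?thesis using assms by simp
qed

text \<open>For a symmetric operator, \<open>B \<ge> B\<^sup>2\<close> amounts to \<open>0 \<le> B \<le> 1\<close>.\<close>

locale positive_contraction =
  fixes B :: "'h::{real_inner, complete_space} \<Rightarrow> 'h"
  assumes linear_B: "linear B"
    and symmetric_B: "inner (B x) y = inner x (B y)"
    and B_square_le: "inner (B x) (B x) \<le> inner (B x) x"
begin

text \<open>\<open>bernstein_op n g\<close> is the operator \<open>\<Sum>k\<le>n. (n choose k) g(k) B\<^sup>k (1 - B)\<^bsup>n-k\<^esup>\<close>;
  the recursion is Pascal's rule.\<close>

primrec bernstein_op :: "nat \<Rightarrow> (nat \<Rightarrow> real) \<Rightarrow> 'h \<Rightarrow> 'h" where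
  "bernstein_op 0 = (\<lambda>g x. g 0 *\<^sub>R x)"
| "bernstein_op (Suc n) = (\<lambda>g x. B (bernstein_op n (\<lambda>k. g (Suc k)) x)
      + (bernstein_op n g x - B (bernstein_op n g x)))"

lemmas B_simps = linear_add[OF linear_B] linear_diff[OF linear_B] linear_scale[OF linear_B]
  linear_0[OF linear_B]

lemma linear_bernstein_op: "linear (bernstein_op n g)"
proof (induction n arbitrary: g)
  case 0
  then show ?case by (simp add: linear_iff algebra_simps)
next
  case (Suc n)
  show ?case
    using Suc[of g] Suc[of "\<lambda>k. g (Suc k)"]
    by (simp add: linear_iff B_simps algebra_simps)
qed

lemma bernstein_op_commute: "bernstein_op n g (B x) = B (bernstein_op n g x)"
  by (induction n arbitrary: g) (simp_all add: B_simps)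

lemma bernstein_op_add: "bernstein_op n (\<lambda>k. g k + h k) x = bernstein_op n g x + bernstein_op n h x"
  by (induction n arbitrary: g h) (simp_all add: B_simps algebra_simps)

lemma bernstein_op_scale: "bernstein_op n (\<lambda>k. r * g k) x = r *\<^sub>R bernstein_op n g x"
  by (induction n arbitrary: g) (simp_all add: B_simps algebra_simps)

lemma bernstein_op_const: "bernstein_op n (\<lambda>k. m) x = m *\<^sub>R x"
  by (induction n) (simp_all add: B_simps)

lemma bernstein_op_symmetric: "inner (bernstein_op n g x) y = inner x (bernstein_op n g y)"
proof (induction n arbitrary: g x y)
  case (Suc n)
  then show ?case
    by (simp add: inner_simps symmetric_B bernstein_op_commute[symmetric])
qed simp

section \<open>Positivity and norm bounds of the Bernstein operators\<close>

definition "coB x = x - B x"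

lemma linear_coB: "linear coB"
  by (simp add: linear_iff coB_def B_simps algebra_simps)

lemma coB_symmetric: "inner (coB x) y = inner x (coB y)"
  by (simp only: coB_def inner_diff_left inner_diff_right symmetric_B)

lemma coB_B: "coB (B x) = B (coB x)"
  by (simp add: coB_def B_simps)

lemma funpow_coB_commute: "(coB ^^ a) (B x) = B ((coB ^^ a) x)"
  by (induction a arbitrary: x) (simp_all add: coB_B)

lemma funpow_B_commute: "(B ^^ a) (coB x) = coB ((B ^^ a) x)"
  by (induction a arbitrary: x) (simp_all add: coB_B)

text \<open>By symmetry one factor B, or one factor 1 - B, can be moved to the other side of the
  inner product, so either exponent drops by two while x becomes B x or (1 - B) x. Only exponents 0
  and 1 remain; the case of B (1 - B) is the locale assumption.\<close>

lemma funpow_moment_nonneg: "0 \<le> inner ((B ^^ a) ((coB ^^ b) x)) x"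
proof (induction "a + b" arbitrary: a b x rule: less_induct)
  case less
  have "a \<le> 1 \<or> (\<exists>k. a = Suc (Suc k))" "b \<le> 1 \<or> (\<exists>k. b = Suc (Suc k))" by presburger+
  then consider k where "a = Suc (Suc k)" | k where "b = Suc (Suc k)" | "a \<le> 1" "b \<le> 1" by blast
  then show ?case
  proof cases
    case 1
    have "(B ^^ a) ((coB ^^ b) x) = B ((B ^^ k) ((coB ^^ b) (B x)))"
      by (simp add: 1 funpow_coB_commute funpow_swap1)
    then show ?thesis using less[of k b "B x"] 1 by (simp add: symmetric_B)
  next
    case 2
    have "(B ^^ a) ((coB ^^ b) x) = coB ((B ^^ a) ((coB ^^ k) (coB x)))"
      by (simp add: 2 funpow_B_commute[symmetric] funpow_swap1)
    then show ?thesis using less[of a k "coB x"] 2 by (simp add: coB_symmetric)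
  next
    case 3
    \<comment> \<open>(1 - B)^2 + (B - B^2) = 1 - B, so 1 - B is nonnegative as well.\<close>
    have "0 \<le> inner (coB x) (coB x)" by simp
    then have "0 \<le> inner x x - inner (B x) x + (inner (B x) (B x) - inner (B x) x)"
      by (simp add: coB_def inner_simps inner_commute)
    moreover have "inner (B (B x)) x = inner (B x) (B x)" by (simp add: symmetric_B)
    moreover have "a = 0 \<or> a = 1" "b = 0 \<or> b = 1" using 3 by auto
    ultimately show ?thesis
      using B_square_le[of x] inner_ge_zero[of "B x"] inner_ge_zero[of x]
      by (auto simp: coB_def B_simps inner_diff_left simp del: inner_ge_zero)
  qed
qed

lemma bernstein_op_nonneg:
  assumes "\<And>k. k \<le> n \<Longrightarrow> 0 \<le> g k"
  shows "0 \<le> inner (bernstein_op n g x) x"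
proof -
  have lB: "linear (B ^^ a)" for a
    by (induction a) (simp_all add: linear_iff B_simps)
  have lC: "linear (coB ^^ a)" for a
    by (induction a) (simp_all add: linear_iff linear_add[OF linear_coB] linear_scale[OF linear_coB])
  \<comment> \<open>Strengthened by the factors B^a (1 - B)^b: the recursion only adds such factors,
    so the claim becomes inductive and ends in \<open>funpow_moment_nonneg\<close>.\<close>
  have "0 \<le> inner ((B ^^ a) ((coB ^^ b) (bernstein_op n g x))) x" for a b
    using assms
  proof (induction n arbitrary: g a b)
    case 0
    then show ?case
      by (simp add: linear_scale[OF lB] linear_scale[OF lC] funpow_moment_nonneg)
  next
    case (Suc n)
    have "(B ^^ a) ((coB ^^ b) (bernstein_op (Suc n) g x))
       = (B ^^ Suc a) ((coB ^^ b) (bernstein_op n (\<lambda>k. g (Suc k)) x))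
         + (B ^^ a) ((coB ^^ Suc b) (bernstein_op n g x))"
      by (simp add: linear_add[OF lB] linear_add[OF lC] funpow_coB_commute funpow_swap1 coB_def[symmetric])
    then show ?case
      using Suc.IH[of "\<lambda>k. g (Suc k)" "Suc a" b] Suc.IH[of g a "Suc b"] Suc.prems
      by (simp add: inner_add_left)
  qed
  from this[of 0 0] show ?thesis by simp
qed

text \<open>Both m - g and m + g are nonnegative at the nodes, so the operator lies between -m and m
  in the order of quadratic forms.\<close>

lemma bernstein_op_norm_le:
  assumes "\<And>k. k \<le> n \<Longrightarrow> \<bar>g k\<bar> \<le> m"
  shows "norm (bernstein_op n g x) \<le> m * norm x"
proof (rule symmetric_norm_le[OF linear_bernstein_op bernstein_op_symmetric])
  fix x
  have "0 \<le> inner (bernstein_op n (\<lambda>k. m + (-1) * g k) x) x"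
    and "0 \<le> inner (bernstein_op n (\<lambda>k. m + g k) x) x"
    using assms by (intro bernstein_op_nonneg; force simp: abs_le_iff)+
  then show "\<bar>inner (bernstein_op n g x) x\<bar> \<le> m * (norm x)\<^sup>2"
    unfolding bernstein_op_add bernstein_op_scale bernstein_op_const
    by (simp add: inner_simps power2_norm_eq_inner)
qed

lemma bernstein_op_cong:
  assumes "\<And>k. k \<le> n \<Longrightarrow> g k = h k"
  shows "bernstein_op n g x = bernstein_op n h x"
  using assms
proof (induction n arbitrary: g h)
  case (Suc n)
  have "bernstein_op n g x = bernstein_op n h x"
    and "bernstein_op n (\<lambda>k. g (Suc k)) x = bernstein_op n (\<lambda>k. h (Suc k)) x"
    by (rule Suc.IH, rule Suc.prems, simp)+
  then show ?case by simp
qed simp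

text \<open>Operator form of k * (n + 1 choose k) = (n + 1) * (n choose (k - 1)).\<close>

lemma bernstein_op_shift:
  "bernstein_op (Suc n) (\<lambda>k. real k * g k) x = real (Suc n) *\<^sub>R B (bernstein_op n (\<lambda>k. g (Suc k)) x)"
proof (induction n arbitrary: g)
  case 0
  then show ?case by (simp add: B_simps)
next
  case (Suc n)
  have 1: "bernstein_op (Suc n) (\<lambda>k. real (Suc k) * g (Suc k)) x
    = bernstein_op (Suc n) (\<lambda>k. real k * g (Suc k)) x + bernstein_op (Suc n) (\<lambda>k. g (Suc k)) x"
    by (subst bernstein_op_add[symmetric]) (simp add: algebra_simps)
  have "bernstein_op (Suc (Suc n)) (\<lambda>k. real k * g k) x
     = B (bernstein_op (Suc n) (\<lambda>k. real (Suc k) * g (Suc k)) x)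
       + coB (bernstein_op (Suc n) (\<lambda>k. real k * g k) x)"
    unfolding coB_def by (subst bernstein_op.simps(2)) (rule refl)
  also have "\<dots> = B (real (Suc n) *\<^sub>R B (bernstein_op n (\<lambda>k. g (Suc (Suc k))) x)
        + bernstein_op (Suc n) (\<lambda>k. g (Suc k)) x
        + real (Suc n) *\<^sub>R coB (bernstein_op n (\<lambda>k. g (Suc k)) x))"
    unfolding 1 Suc.IH by (simp only: B_simps linear_scale[OF linear_coB] coB_B add.assoc)
  also have "real (Suc n) *\<^sub>R B (bernstein_op n (\<lambda>k. g (Suc (Suc k))) x)
        + bernstein_op (Suc n) (\<lambda>k. g (Suc k)) x
        + real (Suc n) *\<^sub>R coB (bernstein_op n (\<lambda>k. g (Suc k)) x)
      = real (Suc n) *\<^sub>R bernstein_op (Suc n) (\<lambda>k. g (Suc k)) x + bernstein_op (Suc n) (\<lambda>k. g (Suc k)) x"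
    by (simp add: algebra_simps coB_def)
  also have "\<dots> = real (Suc (Suc n)) *\<^sub>R bernstein_op (Suc n) (\<lambda>k. g (Suc k)) x"
    by (simp only: of_nat_Suc scaleR_add_left scaleR_one add.commute)
  finally show ?case by (simp only: B_simps)
qed

section \<open>Strong convergence of the Bernstein polynomials of B\<close>

definition bernstein :: "nat \<Rightarrow> (real \<Rightarrow> real) \<Rightarrow> 'h \<Rightarrow> 'h" where
  "bernstein n f x = bernstein_op n (\<lambda>k. f (real k / real n)) x"

definition calc :: "(real \<Rightarrow> real) \<Rightarrow> 'h \<Rightarrow> 'h" where
  "calc f x = lim (\<lambda>n. bernstein n f x)"

lemma bernstein_diff: "bernstein n f x - bernstein n g x = bernstein n (\<lambda>b. f b - g b) x"
  using bernstein_op_add[of n "\<lambda>k. f (real k / real n)" "\<lambda>k. (-1) * g (real k / real n)" x]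
  unfolding bernstein_op_scale bernstein_def by simp

lemma div_in_unit: "k \<le> n \<Longrightarrow> real k / real n \<in> {0..1}"
  by (cases "n = 0") (auto simp: divide_le_eq_1)

lemma bernstein_norm_le:
  assumes "\<And>b. b \<in> {0..1} \<Longrightarrow> \<bar>f b\<bar> \<le> m"
  shows "norm (bernstein n f x) \<le> m * norm x"
  unfolding bernstein_def
  by (rule bernstein_op_norm_le) (erule assms[OF div_in_unit])

lemma bounded_linear_B: "bounded_linear B"
proof
  show "B (x + y) = B x + B y" "B (r *\<^sub>R x) = r *\<^sub>R B x" for x y r by (simp_all add: B_simps)
  \<comment> \<open>The Bernstein polynomial of degree 1 of the identity function is B
    itself.\<close>
  have "norm (bernstein 1 (\<lambda>b. b) x) \<le> 1 * norm x" for x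
    by (rule bernstein_norm_le) simp
  then show "\<exists>K. \<forall>x. norm (B x) \<le> norm x * K"
    by (intro exI[of _ 1]) (simp add: bernstein_def B_simps)
qed

text \<open>By \<open>bernstein_op_shift\<close>, the polynomial of degree n + 1 of b f(b) is B
  applied to a Bernstein sum of degree n for f with nodes (k + 1) / (n + 1) instead of k / n. The
  nodes move by at most 1 / (n + 1), which uniform continuity of f absorbs.\<close>

lemma bernstein_mult_id_tendsto:
  assumes f: "continuous_on {0..1} f" and l: "(\<lambda>n. bernstein n f x) \<longlonglongrightarrow> l"
  shows "(\<lambda>n. bernstein n (\<lambda>b. b * f b) x) \<longlonglongrightarrow> B l"
proof -
  define g where "g n = (\<lambda>k. f (real (Suc k) / real (Suc n)))" for n
  have eq: "bernstein (Suc n) (\<lambda>b. b * f b) x = B (bernstein_op n (g n) x)" for n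
  proof -
    have "bernstein (Suc n) (\<lambda>b. b * f b) x
        = bernstein_op (Suc n) (\<lambda>k. (1 / real (Suc n)) * (real k * f (real k / real (Suc n)))) x"
      by (simp add: bernstein_def)
    also have "\<dots> = B (bernstein_op n (g n) x)"
      unfolding bernstein_op_scale
      using bernstein_op_shift[of n "\<lambda>k. f (real k / real (Suc n))" x] by (simp add: g_def)
    finally show ?thesis .
  qed
  have uc: "uniformly_continuous_on {0..1} f" using f by (simp add: compact_uniformly_continuous)
  have "(\<lambda>n. bernstein_op n (g n) x - bernstein n f x) \<longlonglongrightarrow> 0"
  proof (rule LIMSEQ_I)
    fix e :: real assume e: "0 < e"
    have "0 < e / (norm x + 1)" using e by (simp add: add_nonneg_pos)
    then obtain d where d: "0 < d"
      "\<And>a b. a \<in> {0..1} \<Longrightarrow> b \<in> {0..1} \<Longrightarrow> dist b a < d \<Longrightarrow> dist (f b) (f a) < e / (norm x + 1)"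
      using uc unfolding uniformly_continuous_on_def by blast
    obtain N where N: "1 / d < real N" using reals_Archimedean2 by blast
    have "norm (bernstein_op n (g n) x - bernstein n f x - 0) < e" if n: "N \<le> n" for n
    proof -
      have n0: "0 < real n" using N n d(1) by (smt (verit) divide_pos_pos of_nat_mono)
      have "\<bar>g n k + (-1) * f (real k / real n)\<bar> \<le> e / (norm x + 1)" if k: "k \<le> n" for k
      proof -
        have "real (Suc k) / real (Suc n) - real k / real n = (real n - real k) / (real n * real (Suc n))"
          using n0 by (simp add: field_simps)
        moreover have "(real n - real k) / (real n * real (Suc n)) \<le> real n / (real n * real (Suc n))"
          by (intro divide_right_mono) auto
        moreover have "real n / (real n * real (Suc n)) < d"
        proof -
          have "1 / d < real (Suc n)" using N n by linarith
          then have "1 / real (Suc n) < d" using d(1) by (simp add: field_simps)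
          then show ?thesis using n0 by simp
        qed
        moreover have "0 \<le> (real n - real k) / (real n * real (Suc n))" using k by simp
        ultimately have "dist (real (Suc k) / real (Suc n)) (real k / real n) < d"
          by (simp add: dist_real_def)
        then have "dist (f (real (Suc k) / real (Suc n))) (f (real k / real n)) < e / (norm x + 1)"
          using k div_in_unit[of k n] div_in_unit[of "Suc k" "Suc n"] by (intro d(2)) auto
        then show ?thesis by (simp add: g_def dist_real_def)
      qed
      then have "norm (bernstein_op n (\<lambda>k. g n k + (-1) * f (real k / real n)) x) \<le> e / (norm x + 1) * norm x"
        by (rule bernstein_op_norm_le)
      also have "\<dots> < e" by (rule divide_add_one_mult_less) (use e in auto)
      finally show ?thesis unfolding bernstein_op_add bernstein_op_scale bernstein_def by simp
    qed
    then show "\<exists>no. \<forall>n\<ge>no. norm (bernstein_op n (g n) x - bernstein n f x - 0) < e" by blast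
  qed
  from tendsto_add[OF this l] have "(\<lambda>n. bernstein_op n (g n) x) \<longlonglongrightarrow> l" by simp
  then have "(\<lambda>n. B (bernstein_op n (g n) x)) \<longlonglongrightarrow> B l"
    by (rule bounded_linear.tendsto[OF bounded_linear_B])
  then show ?thesis unfolding eq[symmetric] by (rule LIMSEQ_imp_Suc)
qed

text \<open>Monomials converge by induction through \<open>bernstein_mult_id_tendsto\<close>,
  polynomials by linearity. The bound of \<open>bernstein_norm_le\<close> is uniform in n, so
  Weierstrass approximation carries the Cauchy property over to continuous functions.\<close>

lemma bernstein_convergent:
  assumes f: "continuous_on {0..1} f"
  shows "convergent (\<lambda>n. bernstein n f x)"
proof -
  have pow: "convergent (\<lambda>n. bernstein n (\<lambda>b. b ^ i) x)" for i
  proof (induction i)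
    case 0
    then show ?case by (simp add: bernstein_def bernstein_op_const convergent_const)
  next
    case (Suc i)
    then obtain l where "(\<lambda>n. bernstein n (\<lambda>b. b ^ i) x) \<longlonglongrightarrow> l" by (auto simp: convergent_def)
    with bernstein_mult_id_tendsto[of "\<lambda>b. b ^ i" x l]
    have "(\<lambda>n. bernstein n (\<lambda>b. b ^ Suc i) x) \<longlonglongrightarrow> B l" by (simp add: continuous_intros)
    then show ?case unfolding convergent_def by blast
  qed
  have poly: "convergent (\<lambda>n. bernstein n (\<lambda>b. \<Sum>i\<le>m. a i * b ^ i) x)" for a and m :: nat
  proof (induction m)
    case 0
    then show ?case by (simp add: bernstein_def bernstein_op_const convergent_const)
  next
    case (Suc m)
    have "bernstein n (\<lambda>b. \<Sum>i\<le>Suc m. a i * b ^ i) x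
        = bernstein n (\<lambda>b. \<Sum>i\<le>m. a i * b ^ i) x + a (Suc m) *\<^sub>R bernstein n (\<lambda>b. b ^ Suc m) x" for n
      unfolding bernstein_def bernstein_op_scale[symmetric] bernstein_op_add[symmetric] by simp
    moreover obtain l where "(\<lambda>n. bernstein n (\<lambda>b. \<Sum>i\<le>m. a i * b ^ i) x) \<longlonglongrightarrow> l"
      using Suc unfolding convergent_def by blast
    moreover obtain l' where "(\<lambda>n. bernstein n (\<lambda>b. b ^ Suc m) x) \<longlonglongrightarrow> l'"
      using pow[of "Suc m"] unfolding convergent_def by blast
    ultimately have "(\<lambda>n. bernstein n (\<lambda>b. \<Sum>i\<le>Suc m. a i * b ^ i) x) \<longlonglongrightarrow> l + a (Suc m) *\<^sub>R l'"
      by (simp only:) (intro tendsto_intros)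
    then show ?case unfolding convergent_def by blast
  qed
  have "Cauchy (\<lambda>n. bernstein n f x)"
  proof (rule metric_CauchyI)
    fix e :: real assume e: "0 < e"
    define e' where "e' = e / 3 / (norm x + 1)"
    have e': "0 < e'" using e by (simp add: e'_def add_nonneg_pos)
    obtain p where p: "real_polynomial_function p" "\<And>b. b \<in> {0..1} \<Longrightarrow> \<bar>f b - p b\<bar> < e'"
      using Stone_Weierstrass_real_polynomial_function[OF _ f e'] by auto
    then obtain a m where "p = (\<lambda>b. \<Sum>i\<le>m. a i * b ^ i)" by (auto simp: real_polynomial_function_iff_sum)
    then have "Cauchy (\<lambda>n. bernstein n p x)" using poly by (simp add: convergent_Cauchy)
    then obtain N where N: "\<And>m n. m \<ge> N \<Longrightarrow> n \<ge> N \<Longrightarrow> dist (bernstein m p x) (bernstein n p x) < e / 3"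
      using e metric_CauchyD[of "\<lambda>n. bernstein n p x" "e / 3"] by auto
    have close: "dist (bernstein n f x) (bernstein n p x) < e / 3" for n
    proof -
      have "norm (bernstein n (\<lambda>b. f b - p b) x) \<le> e' * norm x"
        by (rule bernstein_norm_le) (use p(2) less_imp_le in blast)
      also have "\<dots> < e / 3" unfolding e'_def using e by (intro divide_add_one_mult_less) auto
      finally show ?thesis by (simp add: dist_norm bernstein_diff)
    qed
    have "dist (bernstein m f x) (bernstein n f x) < e" if "m \<ge> N" "n \<ge> N" for m n
    proof -
      have "dist (bernstein m f x) (bernstein n f x) \<le> dist (bernstein m f x) (bernstein m p x)
         + (dist (bernstein m p x) (bernstein n p x) + dist (bernstein n p x) (bernstein n f x))"
        using dist_triangle[of "bernstein m f x" "bernstein n f x" "bernstein m p x"]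
          dist_triangle[of "bernstein m p x" "bernstein n f x" "bernstein n p x"] by linarith
      then show ?thesis using close[of m] close[of n] N[OF that] by (simp add: dist_commute)
    qed
    then show "\<exists>M. \<forall>m\<ge>M. \<forall>n\<ge>M. dist (bernstein m f x) (bernstein n f x) < e" by blast
  qed
  then show ?thesis by (rule Cauchy_convergent)
qed

section \<open>Laws and bounds of the functional calculus of B\<close>

lemma calc_tendsto:
  assumes "continuous_on {0..1} f"
  shows "(\<lambda>n. bernstein n f x) \<longlonglongrightarrow> calc f x"
  unfolding calc_def using bernstein_convergent[OF assms] by (simp add: convergent_LIMSEQ_iff)

lemma calc_cong:
  assumes "\<And>b. b \<in> {0..1} \<Longrightarrow> f b = g b"
  shows "calc f x = calc g x"
proof -
  have "bernstein n f x = bernstein n g x" for n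
    unfolding bernstein_def
    by (rule bernstein_op_cong) (erule assms[OF div_in_unit])
  then show ?thesis by (simp add: calc_def)
qed

lemma calc_add:
  assumes "continuous_on {0..1} f" "continuous_on {0..1} g"
  shows "calc (\<lambda>b. f b + g b) x = calc f x + calc g x"
proof -
  have "bernstein n (\<lambda>b. f b + g b) x = bernstein n f x + bernstein n g x" for n
    by (simp add: bernstein_def bernstein_op_add)
  then have "(\<lambda>n. bernstein n (\<lambda>b. f b + g b) x) \<longlonglongrightarrow> calc f x + calc g x"
    by (simp only:) (intro tendsto_intros calc_tendsto assms)
  then show ?thesis unfolding calc_def[of "\<lambda>b. f b + g b"] by (rule limI)
qed

lemma calc_scale:
  assumes "continuous_on {0..1} f"
  shows "calc (\<lambda>b. r * f b) x = r *\<^sub>R calc f x"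
proof -
  have "bernstein n (\<lambda>b. r * f b) x = r *\<^sub>R bernstein n f x" for n
    by (simp add: bernstein_def bernstein_op_scale)
  then have "(\<lambda>n. bernstein n (\<lambda>b. r * f b) x) \<longlonglongrightarrow> r *\<^sub>R calc f x"
    by (simp only:) (intro tendsto_intros calc_tendsto assms)
  then show ?thesis unfolding calc_def[of "\<lambda>b. r * f b"] by (rule limI)
qed

lemma calc_diff:
  assumes "continuous_on {0..1} f" "continuous_on {0..1} g"
  shows "calc (\<lambda>b. f b - g b) x = calc f x - calc g x"
proof -
  have "continuous_on {0..1} (\<lambda>b. (-1) * g b)" by (intro continuous_intros assms)
  from calc_add[OF assms(1) this] calc_scale[OF assms(2), of "-1"] show ?thesis by simp
qed

lemma calc_const: "calc (\<lambda>b. m) x = m *\<^sub>R x"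
  by (simp add: calc_def bernstein_def bernstein_op_const)

text \<open>Identifies B with the function b; with linearity it determines the calculus on
  polynomials.\<close>

lemma calc_mult_id:
  assumes f: "continuous_on {0..1} f"
  shows "calc (\<lambda>b. b * f b) x = B (calc f x)"
  unfolding calc_def[of "\<lambda>b. b * f b"]
  by (rule limI) (rule bernstein_mult_id_tendsto[OF f calc_tendsto[OF f]])

lemma linear_calc:
  assumes f: "continuous_on {0..1} f"
  shows "linear (calc f)"
proof (rule linearI)
  fix x y r
  have "(\<lambda>n. bernstein n f x + bernstein n f y) \<longlonglongrightarrow> calc f x + calc f y"
    by (intro tendsto_intros calc_tendsto f)
  moreover have "bernstein n f (x + y) = bernstein n f x + bernstein n f y" for n
    by (simp add: bernstein_def linear_add[OF linear_bernstein_op])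
  ultimately show "calc f (x + y) = calc f x + calc f y"
    using LIMSEQ_unique[OF calc_tendsto[OF f, of "x + y"]] by simp
  have "(\<lambda>n. r *\<^sub>R bernstein n f x) \<longlonglongrightarrow> r *\<^sub>R calc f x"
    by (intro tendsto_intros calc_tendsto f)
  moreover have "bernstein n f (r *\<^sub>R x) = r *\<^sub>R bernstein n f x" for n
    by (simp add: bernstein_def linear_scale[OF linear_bernstein_op])
  ultimately show "calc f (r *\<^sub>R x) = r *\<^sub>R calc f x"
    using LIMSEQ_unique[OF calc_tendsto[OF f, of "r *\<^sub>R x"]] by simp
qed

lemma calc_symmetric:
  assumes f: "continuous_on {0..1} f"
  shows "inner (calc f x) y = inner x (calc f y)"
proof -
  have "(\<lambda>n. inner (bernstein n f x) y) \<longlonglongrightarrow> inner (calc f x) y"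
    and "(\<lambda>n. inner x (bernstein n f y)) \<longlonglongrightarrow> inner x (calc f y)"
    by (intro tendsto_intros calc_tendsto f)+
  moreover have "inner (bernstein n f x) y = inner x (bernstein n f y)" for n
    by (simp add: bernstein_def bernstein_op_symmetric)
  ultimately show ?thesis using LIMSEQ_unique by simp
qed

lemma calc_nonneg:
  assumes f: "continuous_on {0..1} f" and "\<And>b. b \<in> {0..1} \<Longrightarrow> 0 \<le> f b"
  shows "0 \<le> inner (calc f x) x"
proof (rule LIMSEQ_le_const)
  show "(\<lambda>n. inner (bernstein n f x) x) \<longlonglongrightarrow> inner (calc f x) x"
    by (intro tendsto_intros calc_tendsto f)
  show "\<exists>N. \<forall>n\<ge>N. 0 \<le> inner (bernstein n f x) x"
    unfolding bernstein_def
    by (intro exI[of _ 0] allI impI bernstein_op_nonneg) (erule assms(2)[OF div_in_unit])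
qed

lemma calc_norm_le:
  assumes f: "continuous_on {0..1} f" and "\<And>b. b \<in> {0..1} \<Longrightarrow> \<bar>f b\<bar> \<le> m"
  shows "norm (calc f x) \<le> m * norm x"
  using bernstein_norm_le[OF assms(2)]
  by (intro LIMSEQ_le_const2[OF tendsto_norm[OF calc_tendsto[OF f]]] exI[of _ 0] allI impI)

text \<open>Repeated use of \<open>calc_mult_id\<close> settles monomials f with arbitrary g, and
  linearity settles polynomials f. Approximating f alone then suffices, as both sides depend
  continuously on f in the supremum norm.\<close>

lemma calc_mult:
  assumes f: "continuous_on {0..1} f" and g: "continuous_on {0..1} g"
  shows "calc (\<lambda>b. f b * g b) x = calc f (calc g x)"
proof -
  have pow: "calc (\<lambda>b. b ^ i * g b) x = calc (\<lambda>b. b ^ i) (calc g x)" for i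
  proof (induction i)
    case 0
    then show ?case by (simp add: calc_const)
  next
    case (Suc i)
    have "calc (\<lambda>b. b ^ Suc i * g b) x = B (calc (\<lambda>b. b ^ i * g b) x)"
      using calc_mult_id[of "\<lambda>b. b ^ i * g b" x] g by (simp add: algebra_simps continuous_intros)
    also have "\<dots> = calc (\<lambda>b. b ^ Suc i) (calc g x)"
      using calc_mult_id[of "\<lambda>b. b ^ i" "calc g x"] Suc by (simp add: continuous_intros)
    finally show ?case .
  qed
  have poly: "calc (\<lambda>b. (\<Sum>i\<le>m. a i * b ^ i) * g b) x = calc (\<lambda>b. \<Sum>i\<le>m. a i * b ^ i) (calc g x)"
    for a and m :: nat
  proof (induction m)
    case 0
    then show ?case by (simp add: calc_const calc_scale[OF g])
  next
    case (Suc m)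
    have "calc (\<lambda>b. (\<Sum>i\<le>Suc m. a i * b ^ i) * g b) x
       = calc (\<lambda>b. (\<Sum>i\<le>m. a i * b ^ i) * g b + a (Suc m) * (b ^ Suc m * g b)) x"
      by (rule calc_cong) (simp add: algebra_simps)
    also have "\<dots> = calc (\<lambda>b. (\<Sum>i\<le>m. a i * b ^ i) * g b) x + a (Suc m) *\<^sub>R calc (\<lambda>b. b ^ Suc m * g b) x"
    proof -
      have 1: "continuous_on {0..1} (\<lambda>b. b ^ Suc m * g b)" by (intro continuous_intros g)
      have 2: "continuous_on {0..1} (\<lambda>b. (\<Sum>i\<le>m. a i * b ^ i) * g b)" by (intro continuous_intros g)
      have "continuous_on {0..1} (\<lambda>b. a (Suc m) * (b ^ Suc m * g b))" by (intro continuous_intros g)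
      from calc_add[OF 2 this] calc_scale[OF 1] show ?thesis by simp
    qed
    also have "\<dots> = calc (\<lambda>b. \<Sum>i\<le>m. a i * b ^ i) (calc g x) + a (Suc m) *\<^sub>R calc (\<lambda>b. b ^ Suc m) (calc g x)"
      by (simp only: Suc pow)
    also have "\<dots> = calc (\<lambda>b. \<Sum>i\<le>Suc m. a i * b ^ i) (calc g x)"
    proof -
      have 1: "continuous_on {0..1} (\<lambda>b::real. b ^ Suc m)" by (intro continuous_intros)
      have 2: "continuous_on {0..1} (\<lambda>b. \<Sum>i\<le>m. a i * b ^ i)" by (intro continuous_intros)
      have "continuous_on {0..1} (\<lambda>b. a (Suc m) * b ^ Suc m)" by (intro continuous_intros)
      from calc_add[OF 2 this] calc_scale[OF 1] show ?thesis by simp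
    qed
    finally show ?case .
  qed
  obtain G where G: "\<And>b. b \<in> {0..1} \<Longrightarrow> \<bar>g b\<bar> \<le> G" "0 \<le> G"
  proof -
    have "bounded (g ` {0..1})" using g compact_continuous_image compact_imp_bounded by blast
    then obtain G' where "\<forall>y\<in>g ` {0..1}. norm y \<le> G'" unfolding bounded_iff by blast
    then have *: "\<bar>g b\<bar> \<le> G'" if "b \<in> {0..1}" for b using that by simp
    show ?thesis
    proof (rule that[of G'])
      show "0 \<le> G'" using *[of 0] by simp
    qed (rule *)
  qed
  have le: "norm (calc (\<lambda>b. f b * g b) x - calc f (calc g x)) \<le> e" if e: "0 < e" for e :: real
  proof -
    \<comment> \<open>Each of the two error terms below is at most \<open>e' * G * norm x\<close>;
      the \<open>+ 1\<close> keeps the denominator positive.\<close>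
    define e' where "e' = e / (2 * G * norm x + 1)"
    have pos: "0 < 2 * G * norm x + 1" using G(2) by (simp add: add_nonneg_pos)
    have e': "0 < e'" using e pos by (simp add: e'_def)
    obtain p where p: "real_polynomial_function p" "\<And>b. b \<in> {0..1} \<Longrightarrow> \<bar>f b - p b\<bar> < e'"
      using Stone_Weierstrass_real_polynomial_function[OF _ f e'] by auto
    then obtain a m where pe: "p = (\<lambda>b. \<Sum>i\<le>m. a i * b ^ i)" by (auto simp: real_polynomial_function_iff_sum)
    have cp: "continuous_on {0..1} p" unfolding pe by (intro continuous_intros)
    have 1: "norm (calc (\<lambda>b. (f b - p b) * g b) x) \<le> (e' * G) * norm x"
    proof (rule calc_norm_le)
      show "continuous_on {0..1} (\<lambda>b. (f b - p b) * g b)" by (intro continuous_intros f cp g)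
      fix b :: real assume b: "b \<in> {0..1}"
      show "\<bar>(f b - p b) * g b\<bar> \<le> e' * G"
        unfolding abs_mult using p(2)[OF b] G(1)[OF b] e' by (intro mult_mono) auto
    qed
    have "norm (calc (\<lambda>b. f b - p b) (calc g x)) \<le> e' * norm (calc g x)"
      by (rule calc_norm_le) (use p(2) f cp in \<open>auto intro!: continuous_on_diff less_imp_le\<close>)
    also have "\<dots> \<le> e' * (G * norm x)"
      using calc_norm_le[OF g G(1)] e' by simp
    finally have 2: "norm (calc (\<lambda>b. f b - p b) (calc g x)) \<le> e' * (G * norm x)" .
    have "calc (\<lambda>b. f b * g b) x - calc f (calc g x)
       = calc (\<lambda>b. (f b - p b) * g b) x - calc (\<lambda>b. f b - p b) (calc g x)"
    proof -
      have "calc (\<lambda>b. (f b - p b) * g b) x = calc (\<lambda>b. f b * g b - p b * g b) x"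
        by (simp add: algebra_simps)
      moreover have "continuous_on {0..1} (\<lambda>b. f b * g b)" "continuous_on {0..1} (\<lambda>b. p b * g b)"
        by (intro continuous_intros f cp g)+
      moreover have "calc (\<lambda>b. p b * g b) x = calc p (calc g x)"
        unfolding pe by (rule poly)
      ultimately show ?thesis by (simp add: calc_diff f cp)
    qed
    then have "norm (calc (\<lambda>b. f b * g b) x - calc f (calc g x))
        \<le> norm (calc (\<lambda>b. (f b - p b) * g b) x) + norm (calc (\<lambda>b. f b - p b) (calc g x))"
      by (simp only: norm_triangle_ineq4)
    also have "\<dots> \<le> e' * G * norm x + e' * (G * norm x)" by (rule add_mono[OF 1 2])
    also have "\<dots> = e' * (2 * G * norm x)" by simp
    also have "\<dots> \<le> e" using e pos by (simp add: e'_def field_simps)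
    finally show ?thesis .
  qed
  have "norm (calc (\<lambda>b. f b * g b) x - calc f (calc g x)) \<le> 0"
    by (rule field_le_epsilon) (use le in simp)
  then show ?thesis by simp
qed

end

section \<open>Functional calculus and spectral projections of a nonnegative self-adjoint operator\<close>

text \<open>Vanishing for large l gives continuity at the point of the spectrum of the resolvent
  that corresponds to infinity. Nothing is asked for l tending to minus infinity, since only values
  on [0, \<infinity>) will enter the calculus.\<close>

definition test_function :: "(real \<Rightarrow> real) \<Rightarrow> bool" where
  "test_function f \<longleftrightarrow> continuous_on UNIV f \<and> (\<exists>R. \<forall>l\<ge>R. f l = 0)"

lemma test_function_continuous: "test_function f \<Longrightarrow> continuous_on S f"
  unfolding test_function_def using continuous_on_subset by blast

lemma test_function_support:
  assumes "test_function f"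
  obtains R where "\<And>l. R \<le> l \<Longrightarrow> f l = 0" "0 \<le> R"
proof -
  obtain R where "\<And>l. R \<le> l \<Longrightarrow> f l = 0" using assms unfolding test_function_def by blast
  then show ?thesis using that[of "max R 0"] by simp
qed

lemma test_function_mult_right:
  "continuous_on UNIV f \<Longrightarrow> test_function g \<Longrightarrow> test_function (\<lambda>l. f l * g l)"
  unfolding test_function_def by (metis continuous_on_mult mult_zero_right)

lemma test_function_mult: "test_function f \<Longrightarrow> test_function g \<Longrightarrow> test_function (\<lambda>l. f l * g l)"
  by (rule test_function_mult_right[OF test_function_continuous])

lemma test_function_cmult: "test_function f \<Longrightarrow> test_function (\<lambda>l. r * f l)"
  by (rule test_function_mult_right) (rule continuous_on_const)

lemma test_function_add:
  assumes f: "test_function f" and g: "test_function g"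
  shows "test_function (\<lambda>l. f l + g l)"
proof -
  obtain R where "\<And>l. R \<le> l \<Longrightarrow> f l = 0" using test_function_support[OF f] by blast
  moreover obtain R' where "\<And>l. R' \<le> l \<Longrightarrow> g l = 0" using test_function_support[OF g] by blast
  ultimately have "\<forall>l\<ge>max R R'. f l + g l = 0" by simp
  moreover have "continuous_on UNIV (\<lambda>l. f l + g l)"
    by (intro continuous_on_add test_function_continuous f g)
  ultimately show ?thesis unfolding test_function_def by blast
qed

lemma test_function_diff:
  assumes "test_function f" "test_function g"
  shows "test_function (\<lambda>l. f l - g l)"
  using test_function_add[OF assms(1) test_function_cmult[OF assms(2), of "-1"]] by simp

lemma test_function_mult_id: "test_function f \<Longrightarrow> test_function (\<lambda>l. l * f l)"
  by (rule test_function_mult_right) (rule continuous_on_id)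

definition ramp :: "real \<Rightarrow> real \<Rightarrow> real \<Rightarrow> real" where
  "ramp a b l = max 0 (min 1 ((b - l) / (b - a)))"

lemma ramp_eq_1: "a < b \<Longrightarrow> l \<le> a \<Longrightarrow> ramp a b l = 1"
  by (simp add: ramp_def)

lemma ramp_eq_0: "a < b \<Longrightarrow> b \<le> l \<Longrightarrow> ramp a b l = 0"
  by (simp add: ramp_def divide_nonpos_pos)

lemma ramp_nonneg: "0 \<le> ramp a b l"
  by (simp add: ramp_def)

lemma ramp_le_1: "ramp a b l \<le> 1"
  by (simp add: ramp_def)

lemma test_function_ramp: "a < b \<Longrightarrow> test_function (ramp a b)"
  unfolding test_function_def
proof (intro conjI exI[of _ b] allI impI)
  show "continuous_on UNIV (ramp a b)" if "a < b"
    unfolding ramp_def[abs_def] using that by (intro continuous_intros) simp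
qed (rule ramp_eq_0)

text \<open>Meant for monotone families of operators: a is a quadratic form, convergent because
  monotone and bounded, and its increments dominate those of the vectors.\<close>

lemma convergent_of_norm_square_le:
  fixes v :: "nat \<Rightarrow> 'h::{real_inner, complete_space}"
  assumes a: "convergent a" and le: "\<And>i j. j \<le> i \<Longrightarrow> (norm (v i - v j))\<^sup>2 \<le> \<bar>a i - a j\<bar>"
  shows "convergent v"
proof (rule Cauchy_convergent, rule metric_CauchyI)
  fix e :: real assume e: "0 < e"
  have "Cauchy a" using a by (rule convergent_Cauchy)
  then obtain M where M: "\<And>i j. M \<le> i \<Longrightarrow> M \<le> j \<Longrightarrow> dist (a i) (a j) < e\<^sup>2"
    using e metric_CauchyD[of a "e\<^sup>2"] by auto
  have "dist (v i) (v j) < e" if "M \<le> i" "M \<le> j" for i j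
  proof -
    have "(norm (v i - v j))\<^sup>2 \<le> \<bar>a i - a j\<bar>"
      using le[of i j] le[of j i] by (cases "i \<le> j") (auto simp: norm_minus_commute abs_minus_commute)
    also have "\<dots> < e\<^sup>2" using M[OF that] by (simp add: dist_real_def)
    finally show ?thesis using e by (simp add: dist_norm power2_less_imp_less)
  qed
  then show "\<exists>M. \<forall>i\<ge>M. \<forall>j\<ge>M. dist (v i) (v j) < e" by blast
qed

locale nonneg_self_adjoint =
  fixes D :: "'h::{real_inner, complete_space} set" and A :: "'h \<Rightarrow> 'h"
  assumes self_adjoint_A: "self_adjoint D A" and nonneg_A: "nonnegative_operator D A"
begin

section \<open>The resolvent of A at -1\<close>

lemma subspace_D: "subspace D" and closure_D: "closure D = UNIV"
  using self_adjoint_A by (auto simp: self_adjoint_def densely_defined_operator_def)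

lemma A_add: "x \<in> D \<Longrightarrow> y \<in> D \<Longrightarrow> A (x + y) = A x + A y"
  and A_scale: "x \<in> D \<Longrightarrow> A (r *\<^sub>R x) = r *\<^sub>R A x"
  using self_adjoint_A by (auto simp: self_adjoint_def densely_defined_operator_def)

lemma A_diff: "x \<in> D \<Longrightarrow> y \<in> D \<Longrightarrow> A (x - y) = A x - A y"
  using A_add[of x "(-1) *\<^sub>R y"] A_scale[of y "-1"] subspace_scale[OF subspace_D, of y "-1"] by simp

lemma adjointI: "(\<And>x. x \<in> D \<Longrightarrow> inner (A x) y = inner x z) \<Longrightarrow> y \<in> D \<and> A y = z"
  using self_adjoint_A unfolding self_adjoint_def by blast

lemma A_symmetric: "x \<in> D \<Longrightarrow> y \<in> D \<Longrightarrow> inner (A x) y = inner x (A y)"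
  using self_adjoint_A unfolding self_adjoint_def by blast

lemma A_nonneg: "x \<in> D \<Longrightarrow> 0 \<le> inner (A x) x"
  using nonneg_A unfolding nonnegative_operator_def by blast

text \<open>A is its own adjoint, and the relation that defines the adjoint survives limits.\<close>

lemma A_closed:
  assumes "\<And>n. v n \<in> D" "v \<longlonglongrightarrow> y" "(\<lambda>n. A (v n)) \<longlonglongrightarrow> z"
  shows "y \<in> D \<and> A y = z"
proof (rule adjointI)
  fix x assume x: "x \<in> D"
  have "(\<lambda>n. inner (A x) (v n)) \<longlonglongrightarrow> inner (A x) y" by (intro tendsto_intros assms)
  moreover have "(\<lambda>n. inner x (A (v n))) \<longlonglongrightarrow> inner x z" by (intro tendsto_intros assms)
  ultimately show "inner (A x) y = inner x z"
    using A_symmetric[OF x assms(1)] by (simp add: LIMSEQ_unique)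
qed

text \<open>Gives injectivity of 1 + A and, together with \<open>A_closed\<close>, closedness of its
  range.\<close>

lemma norm_le_norm_add_A:
  assumes "y \<in> D"
  shows "norm y \<le> norm (y + A y)"
proof -
  have "norm y * norm y \<le> inner (y + A y) y"
    using A_nonneg[OF assms] by (simp add: inner_simps power2_norm_eq_inner[symmetric] power2_eq_square)
  also have "\<dots> \<le> norm (y + A y) * norm y" by (rule norm_cauchy_schwarz)
  finally show ?thesis by (metis mult_right_le_imp_le norm_ge_zero order_le_less)
qed

text \<open>A vector y orthogonal to the range of 1 + A lies in the domain of the adjoint, which is
  \<open>D\<close>, and A y = - y; nonnegativity of A forces y = 0. As the range is also a closed
  subspace, it is the whole space.\<close>

lemma ex_resolvent: "\<exists>y\<in>D. y + A y = x"
proof -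
  let ?S = "(\<lambda>y. y + A y) ` D"
  have "x \<in> ?S"
  proof (rule hilbert_closed_subspace_eq_UNIV)
    show "subspace ?S"
      unfolding subspace_def
    proof safe
      show "0 \<in> ?S" using subspace_0[OF subspace_D] A_scale[of 0 0] by force
      fix y z assume "y \<in> D" "z \<in> D"
      then show "y + A y + (z + A z) \<in> ?S"
        by (intro image_eqI[of _ _ "y + z"]) (simp_all add: A_add subspace_add[OF subspace_D])
    next
      fix r y assume "y \<in> D"
      then show "r *\<^sub>R (y + A y) \<in> ?S"
        by (intro image_eqI[of _ _ "r *\<^sub>R y"])
          (simp_all add: A_scale subspace_scale[OF subspace_D] scaleR_add_right)
    qed
    show "closed ?S"
      unfolding closed_sequential_limits
    proof (intro allI impI)
      fix w z assume *: "(\<forall>n. w n \<in> ?S) \<and> w \<longlonglongrightarrow> z"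
      then have "\<forall>n. \<exists>y. y \<in> D \<and> w n = y + A y" by blast
      from choice[OF this] obtain y where y: "\<And>n. y n \<in> D" "\<And>n. w n = y n + A (y n)" by blast
      have "Cauchy w" using * LIMSEQ_imp_Cauchy by blast
      have "Cauchy y"
      proof (rule metric_CauchyI)
        fix e :: real assume "0 < e"
        with \<open>Cauchy w\<close> obtain M where M: "\<And>m n. M \<le> m \<Longrightarrow> M \<le> n \<Longrightarrow> dist (w m) (w n) < e"
          using metric_CauchyD by blast
        have "dist (y m) (y n) \<le> dist (w m) (w n)" for m n
          using norm_le_norm_add_A[OF subspace_diff[OF subspace_D y(1) y(1)], of m n]
          by (simp only: dist_norm y A_diff add_diff_add)
        with M show "\<exists>M. \<forall>m\<ge>M. \<forall>n\<ge>M. dist (y m) (y n) < e" by (meson le_less_trans)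
      qed
      then obtain p where p: "y \<longlonglongrightarrow> p" using Cauchy_convergent convergent_def by blast
      have "(\<lambda>n. w n - y n) \<longlonglongrightarrow> z - p" using * p by (intro tendsto_intros) auto
      then have "(\<lambda>n. A (y n)) \<longlonglongrightarrow> z - p" by (simp add: y(2))
      from A_closed[OF y(1) p this] show "z \<in> ?S" by (intro image_eqI[of _ _ p]) auto
    qed
    fix y assume *: "\<And>x. x \<in> ?S \<Longrightarrow> inner x y = 0"
    have "y \<in> D \<and> A y = - y"
    proof (rule adjointI)
      fix x assume "x \<in> D"
      then have "inner (x + A x) y = 0" by (intro *) blast
      then show "inner (A x) y = inner x (- y)" by (simp add: inner_simps)
    qed
    then have "inner y y \<le> 0" using A_nonneg[of y] by (simp add: inner_simps)
    then show "y = 0" by (metis inner_ge_zero inner_eq_zero_iff order_antisym)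
  qed
  then show ?thesis by auto
qed

definition resolvent :: "'h \<Rightarrow> 'h" where
  "resolvent x = (SOME y. y \<in> D \<and> y + A y = x)"

lemma resolvent: "resolvent x \<in> D \<and> resolvent x + A (resolvent x) = x"
  unfolding resolvent_def by (rule someI_ex) (use ex_resolvent in blast)

lemma resolvent_unique:
  assumes "y \<in> D" "y + A y = x"
  shows "resolvent x = y"
proof -
  have "norm (resolvent x - y) \<le> norm ((resolvent x - y) + A (resolvent x - y))"
    using resolvent[of x] assms by (intro norm_le_norm_add_A subspace_diff[OF subspace_D]) auto
  also have "(resolvent x - y) + A (resolvent x - y) = 0"
  proof -
    have "(resolvent x - y) + (A (resolvent x) - A y) = (resolvent x + A (resolvent x)) - (y + A y)"
      by (simp only: add_diff_add)
    then show ?thesis using resolvent[of x] assms by (simp add: A_diff)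
  qed
  finally show ?thesis by simp
qed

sublocale positive_contraction resolvent
proof (rule positive_contraction.intro)
  show "linear resolvent"
  proof (rule linearI)
    fix x y r
    show "resolvent (x + y) = resolvent x + resolvent y"
    proof (rule resolvent_unique)
      show "resolvent x + resolvent y \<in> D" using resolvent subspace_add[OF subspace_D] by blast
      have "resolvent x + resolvent y + A (resolvent x + resolvent y)
          = (resolvent x + A (resolvent x)) + (resolvent y + A (resolvent y))"
        using resolvent[of x] resolvent[of y] by (simp only: A_add ac_simps)
      then show "resolvent x + resolvent y + A (resolvent x + resolvent y) = x + y"
        using resolvent[of x] resolvent[of y] by simp
    qed
    show "resolvent (r *\<^sub>R x) = r *\<^sub>R resolvent x"
      using resolvent[of x]
      by (intro resolvent_unique)
        (simp_all add: A_scale subspace_scale[OF subspace_D] scaleR_add_right[symmetric])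
  qed
  fix x y
  show "inner (resolvent x) y = inner x (resolvent y)"
  proof -
    have "inner (resolvent x) (resolvent y + A (resolvent y))
        = inner (resolvent x + A (resolvent x)) (resolvent y)"
      using conjunct1[OF resolvent[of x]] conjunct1[OF resolvent[of y]]
      by (simp add: inner_add_left inner_add_right A_symmetric)
    then show ?thesis by (simp only: conjunct2[OF resolvent])
  qed
  \<comment> \<open>Pairing x = y + A y with y = \<open>resolvent x\<close> leaves the nonnegative
    excess \<open>inner (A y) y\<close>.\<close>
  have "inner (resolvent x) (resolvent x) + inner (A (resolvent x)) (resolvent x)
      = inner (resolvent x) (resolvent x + A (resolvent x))"
    by (simp add: inner_simps inner_commute)
  then have "inner (resolvent x) (resolvent x) + inner (A (resolvent x)) (resolvent x) = inner (resolvent x) x"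
    using resolvent[of x] by simp
  then show "inner (resolvent x) (resolvent x) \<le> inner (resolvent x) x"
    using A_nonneg[of "resolvent x"] resolvent[of x] by simp
qed

text \<open>The variable \<open>l\<close> of the spectrum of \<open>A\<close> corresponds to \<open>b = 1 / (1 + l)\<close> in the spectrum of
  the resolvent; \<open>b = 0\<close> is the point at infinity, where test functions vanish.\<close>

definition pullback :: "(real \<Rightarrow> real) \<Rightarrow> real \<Rightarrow> real" where
  "pullback f b = (if b \<le> 0 then 0 else f (1 / b - 1))"

definition fc :: "(real \<Rightarrow> real) \<Rightarrow> 'h \<Rightarrow> 'h" where
  "fc f x = calc (pullback f) x"

text \<open>Only b = 0 is delicate: the pullback vanishes for b < 1 / (1 + R), so [0, 1] is covered
  by two overlapping open sets on each of which continuity is clear.\<close>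

lemma continuous_pullback:
  assumes "test_function f"
  shows "continuous_on {0..1} (pullback f)"
proof -
  obtain R where R: "\<And>l. R \<le> l \<Longrightarrow> f l = 0" "0 \<le> R" using test_function_support[OF assms] by blast
  have "continuous_on {..<1 / (1 + R)} (pullback f)"
  proof (subst continuous_on_cong[OF refl])
    fix b assume b: "b \<in> {..<1 / (1 + R)}"
    show "pullback f b = 0"
    proof (cases "b \<le> 0")
      case False
      then have "R \<le> 1 / b - 1" using b R(2) by (simp add: field_simps)
      then show ?thesis by (simp add: pullback_def R)
    qed (simp add: pullback_def)
  qed simp
  moreover have "continuous_on {0<..} (pullback f)"
  proof (subst continuous_on_cong[OF refl])
    show "pullback f b = f (1 / b - 1)" if "b \<in> {0<..}" for b using that by (simp add: pullback_def)
    show "continuous_on {0<..} (\<lambda>b. f (1 / b - 1))"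
      by (rule continuous_on_compose2[OF test_function_continuous[OF assms, of UNIV]])
        (auto intro!: continuous_intros)
  qed
  ultimately have "continuous_on ({..<1 / (1 + R)} \<union> {0<..}) (pullback f)"
    by (intro continuous_on_open_Un) auto
  moreover have "{0..1} \<subseteq> {..<1 / (1 + R)} \<union> {0<..}" using R(2) by force
  ultimately show ?thesis by (rule continuous_on_subset)
qed

section \<open>Laws of the functional calculus of A\<close>

lemma fc_cong: "(\<And>l. 0 \<le> l \<Longrightarrow> f l = g l) \<Longrightarrow> fc f x = fc g x"
  unfolding fc_def by (rule calc_cong) (simp add: pullback_def)

lemma fc_add: "test_function f \<Longrightarrow> test_function g \<Longrightarrow> fc (\<lambda>l. f l + g l) x = fc f x + fc g x"
  unfolding fc_def calc_add[OF continuous_pullback continuous_pullback, symmetric]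
  by (rule calc_cong) (simp add: pullback_def)

lemma fc_cmult: "test_function f \<Longrightarrow> fc (\<lambda>l. r * f l) x = r *\<^sub>R fc f x"
  unfolding fc_def calc_scale[OF continuous_pullback, symmetric] by (rule calc_cong) (simp add: pullback_def)

lemma fc_diff: "test_function f \<Longrightarrow> test_function g \<Longrightarrow> fc (\<lambda>l. f l - g l) x = fc f x - fc g x"
  unfolding fc_def calc_diff[OF continuous_pullback continuous_pullback, symmetric]
  by (rule calc_cong) (simp add: pullback_def)

lemma fc_mult: "test_function f \<Longrightarrow> test_function g \<Longrightarrow> fc (\<lambda>l. f l * g l) x = fc f (fc g x)"
  unfolding fc_def calc_mult[OF continuous_pullback continuous_pullback, symmetric]
  by (rule calc_cong) (simp add: pullback_def)

lemma fc_commute: "test_function f \<Longrightarrow> test_function g \<Longrightarrow> fc f (fc g x) = fc g (fc f x)"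
  using fc_mult[of f g x] fc_mult[of g f x] by (simp add: mult.commute)

lemma linear_fc: "test_function f \<Longrightarrow> linear (fc f)"
  using linear_calc[OF continuous_pullback, of f] by (simp add: fc_def[abs_def])

lemma fc_symmetric: "test_function f \<Longrightarrow> inner (fc f x) y = inner x (fc f y)"
  unfolding fc_def by (rule calc_symmetric[OF continuous_pullback])

lemma fc_nonneg:
  assumes "test_function f" "\<And>l. 0 \<le> l \<Longrightarrow> 0 \<le> f l"
  shows "0 \<le> inner (fc f x) x"
  unfolding fc_def using assms by (intro calc_nonneg continuous_pullback) (auto simp: pullback_def)

lemma fc_mono:
  assumes f: "test_function f" and g: "test_function g" and "\<And>l. 0 \<le> l \<Longrightarrow> f l \<le> g l"
  shows "inner (fc f x) x \<le> inner (fc g x) x"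
  using fc_nonneg[OF test_function_diff[OF g f], of x] assms(3) by (simp add: fc_diff f g inner_simps)

lemma fc_norm_le:
  assumes "test_function f" "\<And>l. 0 \<le> l \<Longrightarrow> \<bar>f l\<bar> \<le> m"
  shows "norm (fc f x) \<le> m * norm x"
  unfolding fc_def
proof (rule calc_norm_le[OF continuous_pullback[OF assms(1)]])
  show "\<bar>pullback f b\<bar> \<le> m" if "b \<in> {0..1}" for b
    using that assms(2)[of 0] assms(2)[of "1 / b - 1"] by (auto simp: pullback_def)
qed

lemma bounded_linear_fc:
  assumes "test_function f"
  shows "bounded_linear (fc f)"
proof -
  obtain R where R: "\<And>l. R \<le> l \<Longrightarrow> f l = 0" "0 \<le> R" using test_function_support[OF assms] by blast
  have "bounded (f ` {0..R})"
    using compact_continuous_image[OF test_function_continuous[OF assms]] compact_imp_bounded by blast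
  then obtain m where "\<forall>y\<in>f ` {0..R}. norm y \<le> m" unfolding bounded_iff by blast
  then have m: "\<bar>f l\<bar> \<le> m" if "l \<in> {0..R}" for l using that by simp
  have "\<bar>f l\<bar> \<le> m" if "0 \<le> l" for l
    using m[of l] m[of 0] R that by (cases "l \<le> R") auto
  then have "norm (fc f x) \<le> norm x * m" for x
    using fc_norm_le[OF assms] by (simp add: mult.commute)
  with linear_fc[OF assms] show ?thesis
    by (auto simp: bounded_linear_def bounded_linear_axioms_def)
qed

lemma fc_norm_square: "test_function f \<Longrightarrow> (norm (fc f x))\<^sup>2 = inner (fc (\<lambda>l. f l * f l) x) x"
  by (simp add: fc_mult power2_norm_eq_inner fc_symmetric)

text \<open>In the variable b = 1 / (1 + l), the factor 1 + l cancels the factor b of the resolvent.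
  So \<open>fc f x\<close> is in the range of the resolvent, which is \<open>D\<close>, and 1 + A
  acts on it as multiplication by 1 + l.\<close>

lemma fc_in_D:
  assumes f: "test_function f"
  shows "fc f x \<in> D \<and> A (fc f x) = fc (\<lambda>l. l * f l) x"
proof -
  have g: "test_function (\<lambda>l. (1 + l) * f l)"
    by (rule test_function_mult_right[OF _ f]) (intro continuous_intros)
  have "resolvent (fc (\<lambda>l. (1 + l) * f l) x) = fc f x"
    unfolding fc_def calc_mult_id[OF continuous_pullback[OF g], symmetric]
    by (rule calc_cong) (simp add: pullback_def)
  with resolvent[of "fc (\<lambda>l. (1 + l) * f l) x"]
  have 1: "fc f x \<in> D" "fc f x + A (fc f x) = fc (\<lambda>l. (1 + l) * f l) x" by auto
  have "fc (\<lambda>l. (1 + l) * f l) x = fc f x + fc (\<lambda>l. l * f l) x"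
    by (subst fc_add[symmetric]) (auto simp: f test_function_mult_id distrib_right)
  with 1 show ?thesis by simp
qed

lemma fc_resolvent:
  assumes f: "test_function f"
  shows "fc f (resolvent z) = calc (\<lambda>b. pullback f b * b) z" "fc f (resolvent z) = resolvent (fc f z)"
proof -
  have id: "resolvent z = calc (\<lambda>b. b) z"
    using calc_mult_id[of "\<lambda>b. 1" z] by (simp add: calc_const)
  show "fc f (resolvent z) = calc (\<lambda>b. pullback f b * b) z"
    unfolding fc_def id by (rule calc_mult[symmetric]) (auto intro: continuous_pullback f)
  then show "fc f (resolvent z) = resolvent (fc f z)"
    unfolding fc_def calc_mult_id[OF continuous_pullback[OF f], symmetric] by (simp add: mult.commute)
qed

text \<open>Every x in \<open>D\<close> is the resolvent of x + A x, so commutation with the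
  resolvent passes to A.\<close>

lemma A_fc:
  assumes f: "test_function f" and x: "x \<in> D"
  shows "A (fc f x) = fc f (A x)"
proof -
  have "resolvent (x + A x) = x" using x by (simp add: resolvent_unique)
  then have "resolvent (fc f (x + A x)) = fc f x" using fc_resolvent(2)[OF f, of "x + A x"] by simp
  then have "fc f x + A (fc f x) = fc f (x + A x)" using resolvent[of "fc f (x + A x)"] by simp
  then show ?thesis by (simp add: linear_add[OF linear_fc[OF f]])
qed

section \<open>Approximation of the identity and the spectral projections\<close>

definition cutoff :: "real \<Rightarrow> real \<Rightarrow> real" where
  "cutoff k = ramp k (k + 1)"

lemma cutoff_simps:
  "l \<le> k \<Longrightarrow> cutoff k l = 1" "k + 1 \<le> l \<Longrightarrow> cutoff k l = 0" "0 \<le> cutoff k l" "cutoff k l \<le> 1"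
  by (auto simp: cutoff_def ramp_eq_1 ramp_eq_0 ramp_nonneg ramp_le_1)

lemma test_function_cutoff: "test_function (cutoff k)"
  unfolding cutoff_def by (rule test_function_ramp) simp

text \<open>On the range of the resolvent the error is the function b (1 - cutoff), at most 1 / (k +
  1) because the cutoff differs from 1 only for l > k, that is, for b < 1 / (k + 1). That range is
  \<open>D\<close>, hence dense, and the operators are contractions.\<close>

lemma fc_cutoff_tendsto: "(\<lambda>k. fc (cutoff (real k)) x) \<longlonglongrightarrow> x"
proof -
  have res: "norm (resolvent z - fc (cutoff (real k)) (resolvent z)) \<le> norm z / real (Suc k)" for z k
  proof -
    have id: "resolvent z = calc (\<lambda>b. b) z"
      using calc_mult_id[of "\<lambda>b. 1" z] by (simp add: calc_const)
    have c: "continuous_on {0..1} (\<lambda>b. pullback (cutoff (real k)) b * b)"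
      by (intro continuous_intros continuous_pullback test_function_cutoff)
    have "resolvent z - fc (cutoff (real k)) (resolvent z) = calc (\<lambda>b. b - pullback (cutoff (real k)) b * b) z"
      unfolding fc_resolvent(1)[OF test_function_cutoff] using c
      by (subst calc_diff) (simp_all add: id[symmetric])
    also have "norm \<dots> \<le> (1 / real (Suc k)) * norm z"
    proof (rule calc_norm_le)
      show "continuous_on {0..1} (\<lambda>b. b - pullback (cutoff (real k)) b * b)"
        by (intro continuous_intros c)
      fix b :: real assume b: "b \<in> {0..1}"
      show "\<bar>b - pullback (cutoff (real k)) b * b\<bar> \<le> 1 / real (Suc k)"
      proof (cases "b \<le> 0 \<or> 1 / real (Suc k) \<le> b")
        case True
        then consider "b = 0" | "0 < b" "1 / b - 1 \<le> real k"
          using b by (force simp: field_simps)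
        then show ?thesis by cases (auto simp: pullback_def cutoff_simps)
      next
        case False
        have "0 \<le> (1 - pullback (cutoff (real k)) b) * b"
          using False by (simp add: pullback_def cutoff_simps)
        moreover have "(1 - pullback (cutoff (real k)) b) * b \<le> 1 * b"
          using False by (intro mult_right_mono) (auto simp: pullback_def cutoff_simps)
        ultimately show ?thesis using False by (simp add: algebra_simps)
      qed
    qed
    finally show ?thesis by simp
  qed
  show ?thesis
  proof (rule LIMSEQ_I)
    fix e :: real assume e: "0 < e"
    have "x \<in> closure D" by (simp add: closure_D)
    then obtain y where y: "y \<in> D" "dist y x < e / 3"
      using e closure_approachable[of x D] by (meson divide_pos_pos zero_less_numeral)
    define z where "z = y + A y"
    have yz: "y = resolvent z" using resolvent_unique[OF y(1)] by (simp add: z_def)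
    obtain N where N: "3 * norm z / e < real N" using reals_Archimedean2 by blast
    have "norm (fc (cutoff (real k)) x - x) < e" if k: "N \<le> k" for k
    proof -
      have "3 * norm z / e < real (Suc k)" using N k by linarith
      then have "norm z / real (Suc k) < e / 3" using e by (simp add: field_simps)
      with res[of z k] have 1: "norm (y - fc (cutoff (real k)) y) < e / 3"
        unfolding yz by (rule le_less_trans)
      have "norm (fc (cutoff (real k)) (x - y)) \<le> 1 * norm (x - y)"
        by (rule fc_norm_le[OF test_function_cutoff]) (simp add: cutoff_simps)
      then have 2: "norm (fc (cutoff (real k)) (x - y)) < e / 3" using y(2) by (simp add: dist_norm norm_minus_commute)
      have "fc (cutoff (real k)) x - x = fc (cutoff (real k)) (x - y) + ((y - x) - (y - fc (cutoff (real k)) y))"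
        by (simp add: linear_diff[OF linear_fc[OF test_function_cutoff]])
      also have "norm \<dots> \<le> norm (fc (cutoff (real k)) (x - y)) + (norm (y - x) + norm (y - fc (cutoff (real k)) y))"
        by (meson norm_triangle_ineq norm_triangle_ineq4 add_left_mono order_trans)
      finally show ?thesis using 1 2 y(2) by (simp add: dist_norm)
    qed
    then show "\<exists>no. \<forall>n\<ge>no. norm (fc (cutoff (real n)) x - x) < e" by blast
  qed
qed

text \<open>The ramps decrease to the indicator of the half-line up to s, endpoint included.
  Consecutive ramps drop on adjacent intervals, so each equals 1 wherever the next is nonzero; this
  is what makes \<open>step_mult\<close> true.\<close>

definition step :: "real \<Rightarrow> nat \<Rightarrow> real \<Rightarrow> real" where
  "step s j = ramp (s + 1 / real (j + 2)) (s + 1 / real (j + 1))"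

definition E :: "real \<Rightarrow> 'h \<Rightarrow> 'h" where
  "E s x = lim (\<lambda>j. fc (step s j) x)"

lemma step_less: "s + 1 / real (j + 2) < s + 1 / real (j + 1)"
  by (simp add: frac_less2)

lemma step_simps:
  "l \<le> s + 1 / real (j + 2) \<Longrightarrow> step s j l = 1" "s + 1 / real (j + 1) \<le> l \<Longrightarrow> step s j l = 0"
  "0 \<le> step s j l" "step s j l \<le> 1" "l \<le> s \<Longrightarrow> step s j l = 1"
proof -
  show "l \<le> s \<Longrightarrow> step s j l = 1"
    unfolding step_def by (rule ramp_eq_1[OF step_less]) (simp add: add_increasing2)
qed (use step_less[of s j] in \<open>auto simp only: step_def ramp_eq_1 ramp_eq_0 ramp_nonneg ramp_le_1\<close>)

lemma test_function_step: "test_function (step s j)"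
  unfolding step_def by (rule test_function_ramp[OF step_less])

lemma step_mult:
  assumes "j < i"
  shows "step s j l * step s i l = step s i l"
proof (cases "l \<le> s + 1 / real (j + 2)")
  case False
  moreover have "1 / real (i + 1) \<le> 1 / real (j + 2)" using assms by (intro divide_left_mono) auto
  ultimately have "s + 1 / real (i + 1) \<le> l" by linarith
  then show ?thesis by (simp only: step_simps mult_zero_right)
qed (simp only: step_simps mult_1)

lemma step_antimono:
  assumes "j \<le> i"
  shows "step s i l \<le> step s j l"
proof (cases "j = i")
  case False
  with assms have "step s i l = step s j l * step s i l" by (simp add: step_mult)
  also have "\<dots> \<le> step s j l * 1" by (intro mult_left_mono step_simps)
  finally show ?thesis by simp
qed simp

text \<open>The quadratic forms decrease and are nonnegative, hence converge. The difference d of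
  two steps has values in [0, 1], so d^2 \<le> d, and the increments of the forms control those of
  the vectors.\<close>

lemma E_tendsto: "(\<lambda>j. fc (step s j) x) \<longlonglongrightarrow> E s x"
proof -
  define a where "a j = inner (fc (step s j) x) x" for j
  have mono: "a i \<le> a j" if "j \<le> i" for i j
    unfolding a_def by (intro fc_mono test_function_step step_antimono that)
  have "convergent a"
  proof (rule Bseq_monoseq_convergent)
    show "monoseq a" using mono by (auto simp: monoseq_def)
    have "0 \<le> a j" for j unfolding a_def by (intro fc_nonneg test_function_step step_simps)
    then show "Bseq a" using mono[of 0] by (intro BseqI'[of _ "a 0"]) simp
  qed
  then have "convergent (\<lambda>j. fc (step s j) x)"
  proof (rule convergent_of_norm_square_le)
    fix i j :: nat assume ij: "j \<le> i"
    let ?d = "\<lambda>l. step s j l - step s i l"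
    have d: "test_function ?d" by (intro test_function_diff test_function_step)
    have "(norm (fc ?d x))\<^sup>2 \<le> inner (fc ?d x) x"
      unfolding fc_norm_square[OF d]
    proof (intro fc_mono test_function_mult d)
      show "?d l * ?d l \<le> ?d l" for l
        using step_antimono[OF ij, of s l] step_simps(4)[of s j l] step_simps(3)[of s i l]
        by (intro mult_left_le) auto
    qed
    moreover have "inner (fc ?d x) x = a j - a i"
      by (simp add: fc_diff test_function_step a_def inner_simps)
    ultimately show "(norm (fc (step s i) x - fc (step s j) x))\<^sup>2 \<le> \<bar>a i - a j\<bar>"
      by (simp add: fc_diff test_function_step norm_minus_commute)
  qed
  then show ?thesis unfolding E_def by (simp add: convergent_LIMSEQ_iff)
qed

lemma linear_E: "linear (E s)"
proof (rule linearI)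
  fix x y r
  have "(\<lambda>j. fc (step s j) x + fc (step s j) y) \<longlonglongrightarrow> E s x + E s y"
    by (intro tendsto_add E_tendsto)
  then show "E s (x + y) = E s x + E s y"
    using LIMSEQ_unique[OF E_tendsto[of s "x + y"]]
    by (simp add: linear_add[OF linear_fc[OF test_function_step]])
  have "(\<lambda>j. r *\<^sub>R fc (step s j) x) \<longlonglongrightarrow> r *\<^sub>R E s x"
    by (intro tendsto_scaleR tendsto_const E_tendsto)
  then show "E s (r *\<^sub>R x) = r *\<^sub>R E s x"
    using LIMSEQ_unique[OF E_tendsto[of s "r *\<^sub>R x"]]
    by (simp add: linear_scale[OF linear_fc[OF test_function_step]])
qed

lemma E_norm_le: "norm (E s x) \<le> norm x"
proof (rule LIMSEQ_le_const2[OF tendsto_norm[OF E_tendsto]])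
  have "norm (fc (step s j) x) \<le> 1 * norm x" for j
    by (rule fc_norm_le[OF test_function_step]) (simp add: step_simps)
  then show "\<exists>N. \<forall>n\<ge>N. norm (fc (step s n) x) \<le> norm x" by simp
qed

lemma bounded_linear_E: "bounded_linear (E s)"
  using linear_E E_norm_le by (auto simp: bounded_linear_def bounded_linear_axioms_def intro!: exI[of _ 1])

lemma E_symmetric: "inner (E s x) y = inner x (E s y)"
proof (rule LIMSEQ_unique)
  show "(\<lambda>j. inner (fc (step s j) x) y) \<longlonglongrightarrow> inner (E s x) y"
    by (intro tendsto_inner tendsto_const E_tendsto)
  have "(\<lambda>j. inner x (fc (step s j) y)) \<longlonglongrightarrow> inner x (E s y)"
    by (intro tendsto_inner tendsto_const E_tendsto)
  then show "(\<lambda>j. inner (fc (step s j) x) y) \<longlonglongrightarrow> inner x (E s y)"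
    by (simp add: fc_symmetric[OF test_function_step])
qed

lemma fc_E_tendsto:
  assumes "test_function f"
  shows "(\<lambda>j. fc (\<lambda>l. f l * step s j l) x) \<longlonglongrightarrow> fc f (E s x)"
  using bounded_linear.tendsto[OF bounded_linear_fc[OF assms] E_tendsto]
  by (simp add: fc_mult assms test_function_step)

lemma fc_E_commute:
  assumes f: "test_function f"
  shows "fc f (E s x) = E s (fc f x)"
proof (rule LIMSEQ_unique[OF fc_E_tendsto[OF f]])
  have "fc (\<lambda>l. f l * step s j l) x = fc (step s j) (fc f x)" for j
    using fc_mult[OF f test_function_step] fc_commute[OF f test_function_step] by simp
  then show "(\<lambda>j. fc (\<lambda>l. f l * step s j l) x) \<longlonglongrightarrow> E s (fc f x)"
    using E_tendsto by simp
qed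

lemma eventually_inverse_Suc_less: "0 < e \<Longrightarrow> eventually (\<lambda>j. 1 / real (j + 1) < e) sequentially"
  using order_tendstoD(2)[OF LIMSEQ_inverse_real_of_nat, of e] by (simp add: inverse_eq_divide)

text \<open>The gap between s and s' leaves room for the steps, which are nonzero a little to the
  right of s.\<close>

lemma fc_E_eq_self:
  assumes f: "test_function f" and "s < s'" and "\<And>l. 0 \<le> l \<Longrightarrow> l \<le> s' \<Longrightarrow> f l = 1"
  shows "fc f (E s x) = E s x"
proof (rule LIMSEQ_unique[OF fc_E_tendsto[OF f]])
  have "eventually (\<lambda>j. 1 / real (j + 1) < s' - s) sequentially"
    using assms(2) by (intro eventually_inverse_Suc_less) simp
  then have "eventually (\<lambda>j. fc (step s j) x = fc (\<lambda>l. f l * step s j l) x) sequentially"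
  proof eventually_elim
    case (elim j)
    show ?case
    proof (rule fc_cong)
      fix l :: real assume "0 \<le> l"
      then show "step s j l = f l * step s j l"
        using assms(3)[of l] step_simps(2)[of s j l] elim by (cases "l \<le> s'") auto
    qed
  qed
  then show "(\<lambda>j. fc (\<lambda>l. f l * step s j l) x) \<longlonglongrightarrow> E s x"
    by (rule Lim_transform_eventually[OF E_tendsto])
qed

lemma E_fc_eq_self:
  assumes f: "test_function f" and "\<And>l. s < l \<Longrightarrow> f l = 0"
  shows "E s (fc f x) = fc f x"
proof -
  have "f l * step s j l = f l" for l j
    using assms(2)[of l] step_simps(5)[of l s j] by (cases "l \<le> s") auto
  then have "fc (\<lambda>l. f l * step s j l) x = fc f x" for j by (intro fc_cong)
  then show ?thesis
    using fc_E_tendsto[OF f, of s x] fc_E_commute[OF f, of s x] by (simp add: LIMSEQ_const_iff)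
qed

lemma E_mult_le:
  assumes "s \<le> t"
  shows "E t (E s x) = E s x" "E s (E t x) = E s x"
proof -
  \<comment> \<open>Each step for t equals 1 up to t + 1 / (j + 2), strictly beyond s, so the gap
    required by \<open>fc_E_eq_self\<close> is there even if s = t.\<close>
  have "fc (step t j) (E s x) = E s x" for j
  proof (rule fc_E_eq_self[OF test_function_step])
    have "0 < 1 / real (j + 2)" by simp
    with assms show "s < t + 1 / real (j + 2)" by linarith
  qed (simp only: step_simps)
  then show 1: "E t (E s x) = E s x" using LIMSEQ_unique[OF E_tendsto[of t "E s x"]] by simp
  have "(\<lambda>j. E s (fc (step t j) x)) \<longlonglongrightarrow> E s (E t x)"
    by (rule bounded_linear.tendsto[OF bounded_linear_E E_tendsto])
  moreover have "E s (fc (step t j) x) = fc (step t j) (E s x)" for j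
    by (simp add: fc_E_commute test_function_step)
  ultimately have "(\<lambda>j. fc (step t j) (E s x)) \<longlonglongrightarrow> E s (E t x)" by simp
  from LIMSEQ_unique[OF this E_tendsto] show "E s (E t x) = E s x" by (simp add: 1)
qed

lemma E_mult: "E s (E t x) = E (min s t) x"
  by (cases "s \<le> t") (simp_all add: E_mult_le min_def)

lemma E_negative:
  assumes "s < 0"
  shows "E s x = 0"
proof (rule LIMSEQ_unique[OF E_tendsto])
  have "eventually (\<lambda>j. 1 / real (j + 1) < - s) sequentially"
    using assms by (intro eventually_inverse_Suc_less) simp
  then have "eventually (\<lambda>j. fc (step s j) x = 0) sequentially"
  proof eventually_elim
    case (elim j)
    have "fc (step s j) x = fc (\<lambda>l. 0 * step s j l) x"
      by (rule fc_cong) (use elim step_simps(2)[of s j] in force)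
    then show ?case by (simp only: fc_cmult[OF test_function_step] scaleR_zero_left)
  qed
  then show "(\<lambda>j. fc (step s j) x) \<longlonglongrightarrow> 0" by (rule tendsto_eventually)
qed

lemma inner_E: "inner (E s x) x = (norm (E s x))\<^sup>2"
  using E_symmetric[of s "E s x" x] by (simp add: E_mult power2_norm_eq_inner inner_commute)

lemma norm_E_mono: "s \<le> t \<Longrightarrow> norm (E s x) \<le> norm (E t x)"
  using E_norm_le[of s "E t x"] by (simp add: E_mult_le)

lemma norm_E_diff:
  assumes "s \<le> t"
  shows "(norm (E t x - E s x))\<^sup>2 = (norm (E t x))\<^sup>2 - (norm (E s x))\<^sup>2"
proof -
  have "inner (E t x) (E s x) = (norm (E s x))\<^sup>2"
    using E_symmetric[of s "E t x" x] inner_E[of s x] E_mult_le[OF assms, of x]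
    by (metis E_symmetric inner_commute)
  then show ?thesis
    by (simp add: power2_norm_eq_inner inner_simps inner_commute)
qed

text \<open>For t slightly above s the norm of \<open>E t x\<close> is at most that of
  \<open>fc (step s j) x\<close>, which approaches the norm of \<open>E s x\<close>. By
  orthogonality (\<open>norm_E_diff\<close>), closeness of the norms is closeness of the
  vectors.\<close>

lemma E_right_continuous: "((\<lambda>t. E t x) \<longlongrightarrow> E s x) (at_right s)"
proof (rule tendstoI)
  fix e :: real assume e: "0 < e"
  have "(\<lambda>j. (norm (fc (step s j) x))\<^sup>2) \<longlonglongrightarrow> (norm (E s x))\<^sup>2"
    by (intro tendsto_power tendsto_norm E_tendsto)
  moreover have "(norm (E s x))\<^sup>2 < (norm (E s x))\<^sup>2 + e\<^sup>2" using e by simp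
  ultimately have "eventually (\<lambda>j. (norm (fc (step s j) x))\<^sup>2 < (norm (E s x))\<^sup>2 + e\<^sup>2) sequentially"
    by (rule order_tendstoD)
  then obtain j where j: "(norm (fc (step s j) x))\<^sup>2 < (norm (E s x))\<^sup>2 + e\<^sup>2"
    by (auto simp: eventually_sequentially)
  have "dist (E t x) (E s x) < e" if t: "s < t" "t < s + 1 / real (j + 2)" for t
  proof -
    have "fc (step s j) (E t x) = E t x"
      by (rule fc_E_eq_self[OF test_function_step t(2)]) (simp only: step_simps)
    then have "norm (E t x) \<le> norm (fc (step s j) x)"
      using E_norm_le[of t "fc (step s j) x"] fc_E_commute[OF test_function_step] by simp
    then have "(norm (E t x))\<^sup>2 \<le> (norm (fc (step s j) x))\<^sup>2" by (simp add: power_mono)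
    with j have "(norm (E t x - E s x))\<^sup>2 < e\<^sup>2"
      using norm_E_diff[of s t x] t(1) by linarith
    then show ?thesis using e by (simp add: dist_norm power2_less_imp_less)
  qed
  then show "eventually (\<lambda>t. dist (E t x) (E s x) < e) (at_right s)"
    unfolding eventually_at_right_field
    by (intro exI[of _ "s + 1 / real (j + 2)"]) (simp add: add_pos_pos)
qed

lemma E_tendsto_at_top: "((\<lambda>t. E t x) \<longlongrightarrow> x) at_top"
proof (rule tendstoI)
  fix e :: real assume e: "0 < e"
  have "eventually (\<lambda>k. dist (fc (cutoff (real k)) x) x < e / 2) sequentially"
    using e by (intro tendstoD[OF fc_cutoff_tendsto]) simp
  then obtain k where k: "dist (fc (cutoff (real k)) x) x < e / 2" by (auto simp: eventually_sequentially)
  have "dist (E t x) x < e" if t: "real k + 1 \<le> t" for t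
  proof -
    let ?y = "fc (cutoff (real k)) x"
    have "E t ?y = ?y"
      by (rule E_fc_eq_self[OF test_function_cutoff]) (use t in \<open>simp add: cutoff_simps\<close>)
    then have "E t x - x = E t (x - ?y) + (?y - x)" by (simp add: linear_diff[OF linear_E])
    also have "norm \<dots> \<le> norm (x - ?y) + norm (?y - x)"
      using norm_triangle_ineq[of "E t (x - ?y)" "?y - x"] E_norm_le[of t "x - ?y"] by linarith
    finally show ?thesis using k by (simp add: dist_norm norm_minus_commute)
  qed
  then show "eventually (\<lambda>t. dist (E t x) x < e) at_top"
    unfolding eventually_at_top_linorder by blast
qed

lemma resolution_of_identity_E: "resolution_of_identity E"
  unfolding resolution_of_identity_def orthogonal_projection_def
  using bounded_linear_E E_mult E_symmetric E_negative E_right_continuous E_tendsto_at_top by simp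

end

section \<open>The spectral measure and the spectral theorem\<close>

text \<open>Discrete form of the principle that G is constant if its derivative with respect to F
  vanishes: telescoping over a fine partition bounds the increment of G by e times that of F, for
  every e > 0.\<close>

lemma eq_of_fine_increments:
  fixes F G :: "real \<Rightarrow> real"
  assumes ab: "a \<le> b"
    and fine: "\<And>e. 0 < e \<Longrightarrow> \<exists>d>0. \<forall>s t. a \<le> s \<longrightarrow> s \<le> t \<longrightarrow> t \<le> b \<longrightarrow> t - s < d \<longrightarrow>
      \<bar>G t - G s\<bar> \<le> e * (F t - F s)"
  shows "G b = G a"
proof -
  have le: "\<bar>G b - G a\<bar> \<le> e * (F b - F a)" if e: "0 < e" for e
  proof -
    obtain d where d: "0 < d"
      "\<And>s t. a \<le> s \<Longrightarrow> s \<le> t \<Longrightarrow> t \<le> b \<Longrightarrow> t - s < d \<Longrightarrow> \<bar>G t - G s\<bar> \<le> e * (F t - F s)"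
      using fine[OF e] by blast
    obtain N where N: "(b - a) / d < real N" using reals_Archimedean2 by blast
    have N0: "0 < real N" using N ab d(1) by (smt (verit) divide_nonneg_pos)
    define p where "p i = a + real i * ((b - a) / real N)" for i
    have step: "p (Suc i) - p i = (b - a) / real N" for i
      unfolding p_def of_nat_Suc distrib_right by simp
    have small: "(b - a) / real N < d" using N N0 d(1) by (simp add: field_simps)
    have pN: "p N = b" and p0: "p 0 = a" using N0 by (simp_all add: p_def)
    have "\<bar>G (p (Suc i)) - G (p i)\<bar> \<le> e * (F (p (Suc i)) - F (p i))" if i: "i < N" for i
    proof (rule d(2))
      show "a \<le> p i" using ab N0 by (simp add: p_def)
      show "p i \<le> p (Suc i)" using step[of i] ab N0 by (smt (verit) divide_nonneg_pos)
      show "p (Suc i) - p i < d" using step small by simp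
      have "real (Suc i) * ((b - a) / real N) \<le> real N * ((b - a) / real N)"
        using i ab N0 by (intro mult_right_mono) auto
      then show "p (Suc i) \<le> b" using N0 by (simp add: p_def)
    qed
    then have "(\<Sum>i<N. \<bar>G (p (Suc i)) - G (p i)\<bar>) \<le> (\<Sum>i<N. e * (F (p (Suc i)) - F (p i)))"
      by (intro sum_mono) simp
    moreover have "(\<Sum>i<N. e * (F (p (Suc i)) - F (p i))) = e * (F b - F a)"
      using sum_lessThan_telescope[of "\<lambda>i. F (p i)" N] by (simp add: sum_distrib_left[symmetric] pN p0)
    moreover have "\<bar>G b - G a\<bar> \<le> (\<Sum>i<N. \<bar>G (p (Suc i)) - G (p i)\<bar>)"
      using sum_abs[of "\<lambda>i. G (p (Suc i)) - G (p i)" "{..<N}"]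
        sum_lessThan_telescope[of "\<lambda>i. G (p i)" N] by (simp add: pN p0)
    ultimately show ?thesis by linarith
  qed
  have "\<bar>G b - G a\<bar> \<le> 0 + e" if e: "0 < e" for e
  proof -
    have "\<bar>G b - G a\<bar> \<le> e / (\<bar>F b - F a\<bar> + 1) * (F b - F a)"
      using e by (intro le divide_pos_pos) auto
    also have "\<dots> \<le> e / (\<bar>F b - F a\<bar> + 1) * \<bar>F b - F a\<bar>"
      using e by (intro mult_left_mono divide_nonneg_pos) auto
    also have "\<dots> < e" by (rule divide_add_one_mult_less) (use e in auto)
    finally show ?thesis by simp
  qed
  then have "\<bar>G b - G a\<bar> \<le> 0" by (rule field_le_epsilon)
  then show ?thesis by simp
qed

context nonneg_self_adjoint
begin

section \<open>Mass and support of the scalar spectral measures\<close>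

abbreviation \<mu> where "\<mu> \<equiv> spectral_measure E"

lemma sets_\<mu> [measurable_cong, simp]: "sets (\<mu> x) = sets borel" and space_\<mu> [simp]: "space (\<mu> x) = UNIV"
  by (simp_all add: spectral_measure_def)

lemma emeasure_\<mu>_Ioc:
  assumes "a \<le> b"
  shows "emeasure (\<mu> x) {a<..b} = ennreal ((norm (E b x))\<^sup>2 - (norm (E a x))\<^sup>2)"
  unfolding spectral_measure_def
proof (subst emeasure_interval_measure_Ioc[OF assms])
  show "inner (E s x) x \<le> inner (E t x) x" if "s \<le> t" for s t
    using norm_E_mono[OF that, of x] by (simp add: inner_E power_mono)
  show "continuous (at_right s) (\<lambda>s. inner (E s x) x)" for s
    unfolding continuous_within by (intro tendsto_inner tendsto_const E_right_continuous)
qed (simp add: inner_E)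

lemma emeasure_\<mu>_UNIV: "emeasure (\<mu> x) UNIV = ennreal ((norm x)\<^sup>2)"
proof (rule LIMSEQ_unique)
  let ?I = "\<lambda>n. {- real (Suc n)<..real n}"
  have "(\<lambda>n. emeasure (\<mu> x) (?I n)) \<longlonglongrightarrow> emeasure (\<mu> x) (\<Union>n. ?I n)"
    by (rule Lim_emeasure_incseq) (auto simp: incseq_def)
  moreover have "(\<Union>n. ?I n) = UNIV"
  proof -
    have "l \<in> (\<Union>n. ?I n)" for l
    proof -
      obtain n where "\<bar>l\<bar> < real n" using reals_Archimedean2 by blast
      then show ?thesis by (intro UN_I[of n]) auto
    qed
    then show ?thesis by blast
  qed
  ultimately show "(\<lambda>n. emeasure (\<mu> x) (?I n)) \<longlonglongrightarrow> emeasure (\<mu> x) UNIV" by simp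
  have "(\<lambda>n. E (real n) x) \<longlonglongrightarrow> x"
    by (rule filterlim_compose[OF E_tendsto_at_top filterlim_real_sequentially])
  then have "(\<lambda>n. ennreal ((norm (E (real n) x))\<^sup>2)) \<longlonglongrightarrow> ennreal ((norm x)\<^sup>2)"
    by (intro tendsto_ennrealI tendsto_power tendsto_norm)
  then show "(\<lambda>n. emeasure (\<mu> x) (?I n)) \<longlonglongrightarrow> ennreal ((norm x)\<^sup>2)"
    by (simp add: emeasure_\<mu>_Ioc E_negative)
qed

lemma finite_\<mu>: "finite_measure (\<mu> x)"
  by standard (simp add: emeasure_\<mu>_UNIV)

text \<open>Used with c = 0 and with c the constant of coercivity. The covering intervals end
  strictly below c, where \<open>E\<close> vanishes; an atom at c remains possible.\<close>

lemma AE_\<mu>_ge: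
  assumes "\<And>s. s < c \<Longrightarrow> E s x = 0"
  shows "AE l in \<mu> x. c \<le> l"
proof -
  let ?I = "\<lambda>n. {c - 1 - real n<..c - 1 / real (Suc n)}"
  have "{..<c} \<subseteq> (\<Union>n. ?I n)"
  proof
    fix l assume l: "l \<in> {..<c}"
    obtain n where n: "max (c - 1 - l) (1 / (c - l)) < real n" using reals_Archimedean2 by blast
    then have "1 / (c - l) < real (Suc n)" by simp
    then have "1 / real (Suc n) < c - l" using l by (simp add: field_simps)
    then show "l \<in> (\<Union>n. ?I n)" using n by (intro UN_I[of n]) auto
  qed
  moreover have "?I n \<in> null_sets (\<mu> x)" for n
  proof -
    have "1 / real (Suc n) \<le> 1" "0 < 1 / real (Suc n)" by simp_all
    then have "c - 1 - real n \<le> c - 1 / real (Suc n)" "c - 1 / real (Suc n) < c" "c - 1 - real n < c"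
      by linarith+
    then show ?thesis by (intro null_setsI) (simp_all add: emeasure_\<mu>_Ioc assms)
  qed
  ultimately show ?thesis
    by (intro AE_I'[of "\<Union>n. ?I n"] null_sets_UN) auto
qed

lemma AE_\<mu>_nonneg: "AE l in \<mu> x. 0 \<le> l"
  by (rule AE_\<mu>_ge) (rule E_negative)

lemma AE_\<mu>_le:
  assumes "E b x = x"
  shows "AE l in \<mu> x. l \<le> b"
proof -
  have "E t x = x" if "b \<le> t" for t using E_mult_le(1)[OF that, of x] assms by simp
  then have "{b<..b + real n} \<in> null_sets (\<mu> x)" for n
    by (intro null_setsI) (simp_all add: emeasure_\<mu>_Ioc assms)
  moreover have "{b<..} \<subseteq> (\<Union>n. {b<..b + real n})"
  proof
    fix l assume "l \<in> {b<..}"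
    moreover obtain n where "l - b < real n" using reals_Archimedean2 by blast
    ultimately show "l \<in> (\<Union>n. {b<..b + real n})" by (intro UN_I[of n]) auto
  qed
  ultimately show ?thesis
    by (intro AE_I'[of "\<Union>n. {b<..b + real n}"] null_sets_UN) auto
qed

text \<open>\<open>E b - E a\<close> is the strong limit of the nonnegative functions
  \<open>?g j\<close> of A, which live between a and b + 1 / (j + 1). The overshoot beyond b is
  absorbed by continuity of f at b, at the price of the slack e.\<close>

lemma fc_E_diff_le:
  assumes f: "test_function f" and ab: "a \<le> b" and le: "\<And>l. a \<le> l \<Longrightarrow> l \<le> b \<Longrightarrow> f l \<le> m"
  shows "inner (fc f (E b x - E a x)) x \<le> m * ((norm (E b x))\<^sup>2 - (norm (E a x))\<^sup>2)"
proof (rule field_le_epsilon)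
  fix e' :: real assume e': "0 < e'"
  define N where "N = (norm (E b x))\<^sup>2 - (norm (E a x))\<^sup>2"
  have N: "0 \<le> N" using norm_E_mono[OF ab, of x] by (simp add: N_def power_mono)
  define e where "e = e' / (N + 1)"
  have e: "0 < e" using e' N by (simp add: e_def)
  let ?g = "\<lambda>j l. step b j l - step a j l"
  have g: "test_function (?g j)" for j by (intro test_function_diff test_function_step)
  have "isCont f b" using f by (simp add: test_function_def continuous_on_eq_continuous_at)
  then obtain d where d: "0 < d" "\<And>l. \<bar>l - b\<bar> < d \<Longrightarrow> \<bar>f l - f b\<bar> < e"
    using e unfolding continuous_at_eps_delta by (auto simp: dist_real_def)
  \<comment> \<open>Both ramps have the same width, so the one for b is the one for a translated to
    the right.\<close>
  have gn: "0 \<le> ?g j l" for j l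
  proof -
    define p q where "p = 1 / real (j + 2)" and "q = 1 / real (j + 1)"
    have "p < q" using step_less[of 0 j] by (simp add: p_def q_def)
    have "(a + q - l) / ((a + q) - (a + p)) \<le> (b + q - l) / ((b + q) - (b + p))"
      using ab \<open>p < q\<close> by (simp add: divide_right_mono)
    then show ?thesis
      unfolding step_def ramp_def p_def[symmetric] q_def[symmetric] diff_ge_0_iff_ge
      by (intro max.mono min.mono order_refl)
  qed
  have bound: "f l * ?g j l \<le> (m + e) * ?g j l" if j: "1 / real (j + 1) < d" for j l
  proof -
    consider "l \<le> a" | "a \<le> l" "l \<le> b" | "b < l" "l < b + 1 / real (j + 1)" | "b + 1 / real (j + 1) \<le> l"
      by linarith
    then show ?thesis
    proof cases
      case 1
      then have "?g j l = 0" using ab by (simp add: step_simps)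
      then show ?thesis by simp
    next
      case 2
      then show ?thesis using le[of l] e by (intro mult_right_mono gn) simp
    next
      case 3
      then have "f l \<le> m + e" using d(2)[of l] j le[OF ab] by auto
      then show ?thesis by (intro mult_right_mono gn)
    next
      case 4
      then have "?g j l = 0" using ab step_simps(2)[of b j l] step_simps(2)[of a j l] by simp
      then show ?thesis by simp
    qed
  qed
  have lim1: "(\<lambda>j. inner (fc (\<lambda>l. f l * ?g j l) x) x) \<longlonglongrightarrow> inner (fc f (E b x - E a x)) x"
    unfolding fc_mult[OF f g] fc_diff[OF test_function_step test_function_step]
    by (intro tendsto_inner tendsto_const bounded_linear.tendsto[OF bounded_linear_fc[OF f]]
        tendsto_diff E_tendsto)
  have lim2: "(\<lambda>j. inner (fc (\<lambda>l. (m + e) * ?g j l) x) x) \<longlonglongrightarrow> (m + e) * inner (E b x - E a x) x"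
    unfolding fc_cmult[OF g] fc_diff[OF test_function_step test_function_step] inner_scaleR_left
    by (intro tendsto_mult tendsto_inner tendsto_const tendsto_diff E_tendsto)
  have "eventually (\<lambda>j. inner (fc (\<lambda>l. f l * ?g j l) x) x \<le> inner (fc (\<lambda>l. (m + e) * ?g j l) x) x) sequentially"
    using eventually_inverse_Suc_less[OF d(1)]
  proof eventually_elim
    case (elim j)
    then show ?case by (intro fc_mono bound test_function_mult test_function_cmult f g)
  qed
  from tendsto_le[OF trivial_limit_sequentially lim2 lim1 this]
  have "inner (fc f (E b x - E a x)) x \<le> (m + e) * N"
    by (simp add: inner_diff_left inner_E N_def)
  also have "\<dots> \<le> m * N + e'"
    using divide_add_one_mult_less[OF e' N] by (simp add: e_def distrib_right)
  finally show "inner (fc f (E b x - E a x)) x \<le> m * ((norm (E b x))\<^sup>2 - (norm (E a x))\<^sup>2) + e'"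
    by (simp add: N_def)
qed

lemma fc_E_diff_approx:
  assumes f: "test_function f" and ab: "a \<le> b" and le: "\<And>l. a \<le> l \<Longrightarrow> l \<le> b \<Longrightarrow> \<bar>f l - c\<bar> \<le> e"
  shows "\<bar>inner (fc f (E b x - E a x)) x - c * ((norm (E b x))\<^sup>2 - (norm (E a x))\<^sup>2)\<bar>
     \<le> e * ((norm (E b x))\<^sup>2 - (norm (E a x))\<^sup>2)"
proof -
  have "f l \<le> c + e" if "a \<le> l" "l \<le> b" for l using le[OF that] by linarith
  from fc_E_diff_le[OF f ab this, of x]
  have 1: "inner (fc f (E b x - E a x)) x \<le> (c + e) * ((norm (E b x))\<^sup>2 - (norm (E a x))\<^sup>2)" by simp
  have "(-1) * f l \<le> e - c" if "a \<le> l" "l \<le> b" for l using le[OF that] by linarith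
  from fc_E_diff_le[OF test_function_cmult[OF f] ab this, of x]
  have 2: "- inner (fc f (E b x - E a x)) x \<le> (e - c) * ((norm (E b x))\<^sup>2 - (norm (E a x))\<^sup>2)"
    unfolding fc_cmult[OF f] by simp
  show ?thesis using 1 2 by (simp add: abs_le_iff algebra_simps)
qed

text \<open>Restricted to the spectrum up to s, both sides have increments f(s) dF up to a small
  multiple of dF, with F(s) the squared norm of \<open>E s x\<close>. Their difference G is
  therefore constant by \<open>eq_of_fine_increments\<close>.\<close>

lemma integral_\<mu>_bounded:
  assumes f: "test_function f" and B: "\<And>l. \<bar>f l\<bar> \<le> B"
  shows "integrable (\<mu> x) f" "integral\<^sup>L (\<mu> x) f = inner (fc f x) x"
proof -
  interpret finite_measure "\<mu> x" by (rule finite_\<mu>)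
  have meas [measurable]: "f \<in> borel_measurable borel"
    by (rule borel_measurable_continuous_onI[OF test_function_continuous[OF f]])
  show int: "integrable (\<mu> x) f"
    using B by (intro integrable_const_bound[of _ B]) auto
  have intI: "integrable (\<mu> x) (\<lambda>l. indicator S l * h l)"
    if "h \<in> borel_measurable borel" "\<And>l. \<bar>h l\<bar> \<le> K" "S \<in> sets borel"
    for S :: "real set" and h :: "real \<Rightarrow> real" and K :: real
    using that by (intro integrable_const_bound[of _ K])
      (auto simp: indicator_def abs_mult intro: order_trans[OF abs_ge_zero])
  obtain R where R: "\<And>l. R \<le> l \<Longrightarrow> f l = 0" "0 \<le> R" using test_function_support[OF f] by blast
  define F where "F s = (norm (E s x))\<^sup>2" for s
  \<comment> \<open>The lower limit -1 lies below the spectrum: G(-1) = 0, and an atom at 0 is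
    counted.\<close>
  define G where "G s = inner (fc f (E s x)) x - (\<integral>l. indicator {-1<..s} l * f l \<partial>\<mu> x)" for s
  have "G R = G (-1)"
  proof (rule eq_of_fine_increments[where F = F and G = G and a = "-1" and b = R])
    show "-1 \<le> R" using R by simp
    fix e :: real assume e: "0 < e"
    have "uniformly_continuous_on {-1..R} f"
      by (intro compact_uniformly_continuous test_function_continuous f) simp
    then obtain d where d: "0 < d"
      "\<And>s t. s \<in> {-1..R} \<Longrightarrow> t \<in> {-1..R} \<Longrightarrow> dist t s < d \<Longrightarrow> dist (f t) (f s) < e / 2"
      unfolding uniformly_continuous_on_def using e by (meson half_gt_zero)
    have "\<bar>G t - G s\<bar> \<le> e * (F t - F s)" if st: "-1 \<le> s" "s \<le> t" "t \<le> R" "t - s < d" for s t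
    proof -
      have close: "\<bar>f l - f s\<bar> \<le> e / 2" if "s \<le> l" "l \<le> t" for l
        using d(2)[of s l] st that by (simp add: dist_real_def)
      have 1: "\<bar>inner (fc f (E t x - E s x)) x - f s * (F t - F s)\<bar> \<le> e / 2 * (F t - F s)"
        unfolding F_def by (rule fc_E_diff_approx[OF f st(2) close])
      let ?I = "indicator {s<..t} :: real \<Rightarrow> real"
      have mI: "integral\<^sup>L (\<mu> x) ?I = F t - F s"
        using norm_E_mono[OF st(2), of x]
        by (simp add: measure_def emeasure_\<mu>_Ioc st F_def power_mono)
      have "\<bar>\<integral>l. ?I l * (f l - f s) \<partial>\<mu> x\<bar> \<le> (\<integral>l. \<bar>?I l * (f l - f s)\<bar> \<partial>\<mu> x)"
        by (rule integral_abs_bound)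
      also have "\<dots> \<le> (\<integral>l. e / 2 * ?I l \<partial>\<mu> x)"
      proof (rule integral_mono)
        show "integrable (\<mu> x) (\<lambda>l. \<bar>?I l * (f l - f s)\<bar>)"
        proof (intro integrable_abs intI[of _ "2 * B"])
          show "\<bar>f l - f s\<bar> \<le> 2 * B" for l using B[of l] B[of s] by linarith
        qed auto
        show "integrable (\<mu> x) (\<lambda>l. e / 2 * ?I l)" by (simp add: emeasure_\<mu>_Ioc st less_top)
        show "\<bar>?I l * (f l - f s)\<bar> \<le> e / 2 * ?I l" for l
          using close[of l] by (simp add: indicator_def)
      qed
      also have "\<dots> = e / 2 * (F t - F s)" using mI by simp
      also have "(\<integral>l. ?I l * (f l - f s) \<partial>\<mu> x) = (\<integral>l. ?I l * f l - f s * ?I l \<partial>\<mu> x)"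
        by (simp add: algebra_simps)
      also have "\<dots> = (\<integral>l. ?I l * f l \<partial>\<mu> x) - f s * (F t - F s)"
        using intI[OF meas B] mI by (subst Bochner_Integration.integral_diff)
          (simp_all add: emeasure_\<mu>_Ioc st less_top)
      finally have 2: "\<bar>(\<integral>l. ?I l * f l \<partial>\<mu> x) - f s * (F t - F s)\<bar> \<le> e / 2 * (F t - F s)" .
      have "(\<integral>l. indicator {-1<..t} l * f l \<partial>\<mu> x)
          = (\<integral>l. indicator {-1<..s} l * f l + ?I l * f l \<partial>\<mu> x)"
        using st by (intro Bochner_Integration.integral_cong) (auto simp: indicator_def)
      also have "\<dots> = (\<integral>l. indicator {-1<..s} l * f l \<partial>\<mu> x) + (\<integral>l. ?I l * f l \<partial>\<mu> x)"
        by (intro Bochner_Integration.integral_add intI[OF meas B]) auto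
      finally have "G t - G s = inner (fc f (E t x - E s x)) x - (\<integral>l. ?I l * f l \<partial>\<mu> x)"
        by (simp add: G_def linear_diff[OF linear_fc[OF f]] inner_diff_left)
      then have "\<bar>G t - G s\<bar> \<le> e / 2 * (F t - F s) + e / 2 * (F t - F s)" using 1 2 by linarith
      also have "\<dots> = e * (F t - F s)" by (simp only: distrib_right[symmetric] field_sum_of_halves)
      finally show ?thesis .
    qed
    with d(1) show "\<exists>d>0. \<forall>s t. -1 \<le> s \<longrightarrow> s \<le> t \<longrightarrow> t \<le> R \<longrightarrow> t - s < d \<longrightarrow> \<bar>G t - G s\<bar> \<le> e * (F t - F s)"
      by blast
  qed
  moreover have "G (-1) = 0"
    by (simp add: G_def E_negative linear_0[OF linear_fc[OF f]])
  moreover have "fc f (E R x) = fc f x"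
    using E_fc_eq_self[OF f, of R x] R(1) by (simp add: fc_E_commute[OF f])
  moreover have "(\<integral>l. indicator {-1<..R} l * f l \<partial>\<mu> x) = integral\<^sup>L (\<mu> x) f"
  proof (rule integral_cong_AE)
    show "AE l in \<mu> x. indicator {-1<..R} l * f l = f l"
      using AE_\<mu>_nonneg[of x]
    proof eventually_elim
      case (elim l)
      then show ?case using R(1)[of l] by (auto simp: indicator_def)
    qed
  qed measurable
  ultimately show "integral\<^sup>L (\<mu> x) f = inner (fc f x) x" by (simp add: G_def)
qed

text \<open>A test function may be unbounded on the negative axis; composing it with
  \<open>max 0\<close> makes it bounded without changing it on the spectrum.\<close>

lemma integral_\<mu>:
  assumes f: "test_function f"
  shows "integrable (\<mu> x) f" "integral\<^sup>L (\<mu> x) f = inner (fc f x) x"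
proof -
  let ?f = "\<lambda>l. f (max 0 l)"
  obtain R where R: "\<And>l. R \<le> l \<Longrightarrow> f l = 0" "0 \<le> R" using test_function_support[OF f] by blast
  have tf: "test_function ?f"
    unfolding test_function_def
  proof (intro conjI exI[of _ R] allI impI)
    show "continuous_on UNIV ?f"
      by (rule continuous_on_compose2[OF test_function_continuous[OF f, of UNIV]])
        (auto intro!: continuous_intros)
    show "f (max 0 l) = 0" if "R \<le> l" for l using that R by (intro R(1)) simp
  qed
  have "bounded (f ` {0..R})"
    by (intro compact_imp_bounded compact_continuous_image test_function_continuous f) simp
  then obtain B where "\<forall>y\<in>f ` {0..R}. norm y \<le> B" unfolding bounded_iff by blast
  then have B: "\<bar>f l\<bar> \<le> B" if "l \<in> {0..R}" for l using that by simp
  have B': "\<bar>?f l\<bar> \<le> B" for l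
  proof (cases "max 0 l \<le> R")
    case False
    then show ?thesis using R(1)[of "max 0 l"] B[of 0] R(2) by simp
  qed (use B in simp)
  have AE: "AE l in \<mu> x. f l = ?f l"
    using AE_\<mu>_nonneg[of x] by eventually_elim simp
  have [measurable]: "f \<in> borel_measurable borel" "?f \<in> borel_measurable borel"
    by (intro borel_measurable_continuous_onI test_function_continuous f tf)+
  show "integrable (\<mu> x) f"
    using integrable_cong_AE[of f "\<mu> x" ?f] AE integral_\<mu>_bounded(1)[OF tf B', of x] by simp
  have "integral\<^sup>L (\<mu> x) f = integral\<^sup>L (\<mu> x) ?f"
    by (rule integral_cong_AE) (use AE in auto)
  also have "\<dots> = inner (fc ?f x) x" by (rule integral_\<mu>_bounded(2)[OF tf B'])
  also have "fc ?f x = fc f x" by (rule fc_cong) simp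
  finally show "integral\<^sup>L (\<mu> x) f = inner (fc f x) x" .
qed

lemma nn_integral_\<mu>:
  assumes f: "test_function f" and "\<And>l. 0 \<le> l \<Longrightarrow> 0 \<le> f l"
  shows "(\<integral>\<^sup>+ l. ennreal (f l) \<partial>\<mu> x) = ennreal (inner (fc f x) x)"
proof -
  have "AE l in \<mu> x. 0 \<le> f l" using AE_\<mu>_nonneg[of x] by eventually_elim (rule assms(2))
  then show ?thesis using nn_integral_eq_integral[OF integral_\<mu>(1)[OF f]] integral_\<mu>(2)[OF f] by simp
qed

section \<open>Domain and quadratic form of A in terms of the spectral measure\<close>

lemma cutoff_mono: "k \<le> m \<Longrightarrow> cutoff k l \<le> cutoff m l"
  by (simp add: cutoff_def ramp_def min_le_iff_disj max_def)

lemma test_function_mult_cutoff: "continuous_on UNIV f \<Longrightarrow> test_function (\<lambda>l. f l * cutoff k l)"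
  by (rule test_function_mult_right[OF _ test_function_cutoff])

text \<open>Monotone convergence in the cutoff: finiteness of the second moment becomes boundedness
  of the vectors \<open>A (fc (cutoff k) x)\<close>.\<close>

lemma nn_integral_square_\<mu>:
  "(\<integral>\<^sup>+ l. ennreal (l\<^sup>2) \<partial>\<mu> x) = (SUP k. ennreal ((norm (A (fc (cutoff (real k)) x)))\<^sup>2))"
proof -
  let ?g = "\<lambda>k l. l * cutoff (real k) l"
  have tg: "test_function (?g k)" for k by (intro test_function_mult_id test_function_cutoff)
  have "(\<integral>\<^sup>+ l. ennreal (?g k l * ?g k l) \<partial>\<mu> x) = ennreal ((norm (A (fc (cutoff (real k)) x)))\<^sup>2)" for k
    using nn_integral_\<mu>[OF test_function_mult[OF tg tg], of k k x]
    by (simp add: fc_in_D[OF test_function_cutoff] fc_norm_square[OF tg])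
  moreover have "(\<integral>\<^sup>+ l. ennreal (l\<^sup>2) \<partial>\<mu> x) = (\<integral>\<^sup>+ l. (SUP k. ennreal (?g k l * ?g k l)) \<partial>\<mu> x)"
  proof (rule nn_integral_cong)
    fix l
    obtain k where k: "l < real k" using reals_Archimedean2 by blast
    show "ennreal (l\<^sup>2) = (SUP k. ennreal (?g k l * ?g k l))"
    proof (rule antisym)
      have "ennreal (l\<^sup>2) = ennreal (?g k l * ?g k l)" using k by (simp add: cutoff_simps power2_eq_square)
      also have "\<dots> \<le> (SUP k. ennreal (?g k l * ?g k l))" by (rule SUP_upper) simp
      finally show "ennreal (l\<^sup>2) \<le> (SUP k. ennreal (?g k l * ?g k l))" .
      show "(SUP k. ennreal (?g k l * ?g k l)) \<le> ennreal (l\<^sup>2)"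
      proof (rule SUP_least, rule ennreal_leI)
        fix k
        have "?g k l * ?g k l = l\<^sup>2 * (cutoff (real k) l)\<^sup>2" by (simp add: power2_eq_square)
        also have "\<dots> \<le> l\<^sup>2 * 1" by (intro mult_left_mono) (auto simp: power_le_one cutoff_simps)
        finally show "?g k l * ?g k l \<le> l\<^sup>2" by simp
      qed
    qed
  qed
  moreover have "(\<integral>\<^sup>+ l. (SUP k. ennreal (?g k l * ?g k l)) \<partial>\<mu> x)
      = (SUP k. \<integral>\<^sup>+ l. ennreal (?g k l * ?g k l) \<partial>\<mu> x)"
  proof (rule nn_integral_monotone_convergence_SUP)
    show "incseq (\<lambda>k l. ennreal (?g k l * ?g k l))"
    proof (intro incseq_SucI le_funI ennreal_leI)
      fix k l
      have "cutoff (real k) l \<le> cutoff (real (Suc k)) l" by (rule cutoff_mono) simp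
      then have "(cutoff (real k) l)\<^sup>2 \<le> (cutoff (real (Suc k)) l)\<^sup>2" by (intro power_mono cutoff_simps)
      then have "l\<^sup>2 * (cutoff (real k) l)\<^sup>2 \<le> l\<^sup>2 * (cutoff (real (Suc k)) l)\<^sup>2" by (intro mult_left_mono) auto
      then show "?g k l * ?g k l \<le> ?g (Suc k) l * ?g (Suc k) l" by (simp add: power2_eq_square ac_simps)
    qed
    have [measurable]: "?g k \<in> borel_measurable borel" for k
      by (intro borel_measurable_continuous_onI test_function_continuous tg)
    show "(\<lambda>l. ennreal (?g k l * ?g k l)) \<in> borel_measurable (\<mu> x)" for k by measurable
  qed
  ultimately show ?thesis by simp
qed

text \<open>For x in \<open>D\<close>, A commutes with the cutoffs, which are contractions.
  Conversely, the norms of \<open>A (fc (cutoff k) x)\<close> increase and are bounded, so these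
  vectors converge by \<open>convergent_of_norm_square_le\<close>, and closedness of A puts x in
  \<open>D\<close>.\<close>

lemma D_eq: "D = {x. (\<integral>\<^sup>+ l. ennreal (l\<^sup>2) \<partial>\<mu> x) < \<infinity>}"
proof (intro equalityI subsetI CollectI)
  fix x assume x: "x \<in> D"
  have "(\<integral>\<^sup>+ l. ennreal (l\<^sup>2) \<partial>\<mu> x) \<le> ennreal ((norm (A x))\<^sup>2)"
    unfolding nn_integral_square_\<mu>
  proof (rule SUP_least, rule ennreal_leI, rule power_mono)
    fix k :: nat
    have "norm (fc (cutoff (real k)) (A x)) \<le> 1 * norm (A x)"
      by (rule fc_norm_le[OF test_function_cutoff]) (simp add: cutoff_simps)
    then show "norm (A (fc (cutoff (real k)) x)) \<le> norm (A x)" by (simp add: A_fc test_function_cutoff x)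
  qed simp
  then show "(\<integral>\<^sup>+ l. ennreal (l\<^sup>2) \<partial>\<mu> x) < \<infinity>" by (simp add: order_le_less_trans)
next
  fix x assume "x \<in> {x. (\<integral>\<^sup>+ l. ennreal (l\<^sup>2) \<partial>\<mu> x) < \<infinity>}"
  then have fin: "(\<integral>\<^sup>+ l. ennreal (l\<^sup>2) \<partial>\<mu> x) < \<infinity>" by simp
  define v where "v k = A (fc (cutoff (real k)) x)" for k
  define a where "a k = (norm (v k))\<^sup>2" for k
  let ?g = "\<lambda>k l. l * cutoff (real k) l"
  have tg: "test_function (?g k)" for k by (intro test_function_mult_id test_function_cutoff)
  have v: "v k = fc (?g k) x" for k by (simp add: v_def fc_in_D[OF test_function_cutoff])
  have incr: "(norm (v k - v m))\<^sup>2 \<le> a k - a m" if mk: "m \<le> k" for k m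
  proof -
    have "(norm (v k - v m))\<^sup>2 = inner (fc (\<lambda>l. (?g k l - ?g m l) * (?g k l - ?g m l)) x) x"
      unfolding v fc_diff[OF tg tg, symmetric] by (rule fc_norm_square[OF test_function_diff[OF tg tg]])
    also have "\<dots> \<le> inner (fc (\<lambda>l. ?g k l * ?g k l - ?g m l * ?g m l) x) x"
    proof (rule fc_mono)
      fix l :: real assume "0 \<le> l"
      have "cutoff (real m) l \<le> cutoff (real k) l" by (rule cutoff_mono) (use mk in simp)
      then have "0 \<le> 2 * ?g m l * (?g k l - ?g m l)"
        using \<open>0 \<le> l\<close> by (intro mult_nonneg_nonneg) (auto simp: cutoff_simps mult_left_mono)
      then show "(?g k l - ?g m l) * (?g k l - ?g m l) \<le> ?g k l * ?g k l - ?g m l * ?g m l"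
        by (simp add: algebra_simps)
    qed (intro test_function_mult test_function_diff tg)+
    also have "\<dots> = a k - a m"
      by (simp add: fc_diff test_function_mult tg inner_diff_left a_def v fc_norm_square)
    finally show ?thesis .
  qed
  have "convergent v"
  proof (rule convergent_of_norm_square_le)
    show "(norm (v k - v m))\<^sup>2 \<le> \<bar>a k - a m\<bar>" if "m \<le> k" for k m using incr[OF that] by linarith
    have mono: "a m \<le> a k" if "m \<le> k" for k m using incr[OF that] zero_le_power2[of "norm (v k - v m)"] by linarith
    obtain K where K: "(\<integral>\<^sup>+ l. ennreal (l\<^sup>2) \<partial>\<mu> x) = ennreal K" "0 \<le> K"
      using fin by (metis ennreal_cases infinity_ennreal_def less_irrefl)
    have "ennreal (a k) \<le> ennreal K" for k
      unfolding K(1)[symmetric] nn_integral_square_\<mu> a_def v_def by (rule SUP_upper) simp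
    then have "a k \<le> K" for k using K(2) by simp
    then show "convergent a"
      by (intro Bseq_monoseq_convergent BseqI'[of _ K]) (auto simp: monoseq_def mono, simp add: a_def)
  qed
  then obtain z where "(\<lambda>k. A (fc (cutoff (real k)) x)) \<longlonglongrightarrow> z" by (auto simp: convergent_def v_def[abs_def])
  from A_closed[OF conjunct1[OF fc_in_D[OF test_function_cutoff]] fc_cutoff_tendsto this]
  show "x \<in> D" by simp
qed

text \<open>Dominated convergence with majorant l^2 + 1, integrable because x is in \<open>D\<close>
  and the measure is finite.\<close>

lemma inner_A_eq_integral:
  assumes x: "x \<in> D"
  shows "inner (A x) x = (\<integral>l. l \<partial>\<mu> x)"
proof (rule LIMSEQ_unique)
  interpret finite_measure "\<mu> x" by (rule finite_\<mu>)
  have "(\<lambda>k. inner (fc (cutoff (real k)) (A x)) x) \<longlonglongrightarrow> inner (A x) x"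
    by (intro tendsto_inner tendsto_const fc_cutoff_tendsto)
  moreover have "inner (fc (cutoff (real k)) (A x)) x = (\<integral>l. l * cutoff (real k) l \<partial>\<mu> x)" for k
    using fc_in_D[OF test_function_cutoff, of "real k" x] A_fc[OF test_function_cutoff x, of "real k"]
    by (simp add: integral_\<mu>(2) test_function_mult_id test_function_cutoff)
  ultimately show "(\<lambda>k. \<integral>l. l * cutoff (real k) l \<partial>\<mu> x) \<longlonglongrightarrow> inner (A x) x" by simp
  have [measurable]: "cutoff k \<in> borel_measurable borel" for k
    by (intro borel_measurable_continuous_onI test_function_continuous test_function_cutoff)
  have int2: "integrable (\<mu> x) (\<lambda>l. l\<^sup>2)"
    using x D_eq by (intro integrableI_bounded) auto
  have int1: "integrable (\<mu> x) (\<lambda>l. l\<^sup>2 + 1)" by (intro Bochner_Integration.integrable_add int2) simp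
  have l_le: "\<bar>l\<bar> \<le> l\<^sup>2 + 1" for l :: real
  proof -
    have "2 * \<bar>l\<bar> \<le> l\<^sup>2 + 1" using zero_le_power2[of "\<bar>l\<bar> - 1"] by (simp add: power2_diff)
    then show ?thesis by linarith
  qed
  show "(\<lambda>k. \<integral>l. l * cutoff (real k) l \<partial>\<mu> x) \<longlonglongrightarrow> (\<integral>l. l \<partial>\<mu> x)"
  proof (rule integral_dominated_convergence[where w = "\<lambda>l. l\<^sup>2 + 1"])
    show "AE l in \<mu> x. (\<lambda>k. l * cutoff (real k) l) \<longlonglongrightarrow> l"
    proof (rule AE_I2)
      fix l
      have "eventually (\<lambda>k. l * cutoff (real k) l = l) sequentially"
        using eventually_ge_at_top[of "nat \<lceil>l\<rceil>"]
      proof eventually_elim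
        case (elim k)
        then have "l \<le> real k" by linarith
        then show ?case by (simp add: cutoff_simps)
      qed
      then show "(\<lambda>k. l * cutoff (real k) l) \<longlonglongrightarrow> l" by (rule tendsto_eventually)
    qed
    show "AE l in \<mu> x. norm (l * cutoff (real k) l) \<le> l\<^sup>2 + 1" for k
    proof (rule AE_I2)
      fix l
      have "\<bar>l\<bar> * cutoff (real k) l \<le> \<bar>l\<bar> * 1" by (intro mult_left_mono) (simp_all add: cutoff_simps)
      with l_le[of l] show "norm (l * cutoff (real k) l) \<le> l\<^sup>2 + 1" by (simp add: abs_mult cutoff_simps)
    qed
  qed (use int1 in measurable)
qed

lemma spectral_resolution_E: "spectral_resolution D A E"
  unfolding spectral_resolution_def
  using resolution_of_identity_E D_eq inner_A_eq_integral by blast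

text \<open>On the range of \<open>E s\<close> with s \<ge> 0 the quadratic form of A is at most s
  times the squared norm, which is compatible with a coercivity constant above s only for the vector
  0.\<close>

lemma E_eq_0_of_coercive:
  assumes c: "\<And>x. x \<in> D \<Longrightarrow> \<nu> * (norm x)\<^sup>2 \<le> inner (A x) x" and s: "s < \<nu>"
  shows "E s x = 0"
proof (cases "s < 0")
  case False
  define y where "y = E s x"
  let ?f = "cutoff (s + 1)"
  have Ey: "E s y = y" by (simp add: y_def E_mult)
  have y: "fc ?f y = y"
    unfolding y_def by (rule fc_E_eq_self[OF test_function_cutoff, of s "s + 1"]) (simp_all add: cutoff_simps)
  have "y \<in> D" "A y = fc (\<lambda>l. l * ?f l) y"
    using fc_in_D[OF test_function_cutoff, of "s + 1" y] y by auto
  have "inner (fc (\<lambda>l. l * ?f l) (E s y - E (-1) y)) y \<le> s * ((norm (E s y))\<^sup>2 - (norm (E (-1) y))\<^sup>2)"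
    by (rule fc_E_diff_le[OF test_function_mult_id[OF test_function_cutoff]])
      (use False in \<open>auto simp: cutoff_simps\<close>)
  then have "inner (A y) y \<le> s * (norm y)\<^sup>2"
    using \<open>A y = _\<close> by (simp add: Ey E_negative)
  with c[OF \<open>y \<in> D\<close>] have "(\<nu> - s) * (norm y)\<^sup>2 \<le> 0" by (simp add: algebra_simps)
  then have "y = 0" using s by (simp add: mult_le_0_iff)
  then show ?thesis by (simp add: y_def)
qed (rule E_negative)

end

section \<open>The scalar equation: power series in the spectral parameter\<close>

lemma has_integral_power_from_0:
  fixes s :: real
  assumes "0 \<le> s"
  shows "((\<lambda>r. r ^ k) has_integral s ^ Suc k / real (Suc k)) {0..s}"
proof -
  have "((\<lambda>r. r ^ k) has_integral (s ^ Suc k / real (Suc k) - 0 ^ Suc k / real (Suc k))) {0..s}"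
  proof (rule fundamental_theorem_of_calculus[OF assms])
    fix x :: real
    have "((\<lambda>r. r ^ Suc k / real (Suc k)) has_real_derivative x ^ k) (at x within {0..s})"
      by (rule derivative_eq_intros refl | simp)+
    then show "((\<lambda>r. r ^ Suc k / real (Suc k)) has_vector_derivative x ^ k) (at x within {0..s})"
      by (simp add: has_real_derivative_iff_has_vector_derivative)
  qed
  then show ?thesis by simp
qed

lemma at_within_left_open:
  fixes t :: real
  assumes "0 < t"
  shows "at t within {0<..T} = at t within {0..T}"
  by (rule at_within_nhd[of t "{0<..}"]) (use assms in auto)

locale bounded_coefficient =
  fixes c :: "real \<Rightarrow> real" and T m :: real
  assumes T: "0 < T" "T \<le> 1"
    and c_continuous: "continuous_on {0<..T} c"
    and c_bounded: "\<And>t. t \<in> {0..T} \<Longrightarrow> \<bar>c t\<bar> \<le> m"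
begin

lemma m_nonneg: "0 \<le> m"
  using c_bounded[of T] T by simp

text \<open>On the half-open interval the product is continuous and bounded, hence integrable; the
  point 0 is negligible.\<close>

lemma c_mult_integrable:
  assumes f: "continuous_on {0..T} f" and s: "s \<le> T"
  shows "(\<lambda>r. c r * f r) integrable_on {0..s}"
proof (rule integrable_spike_set)
  have "bounded (f ` {0..T})" by (intro compact_imp_bounded compact_continuous_image f) simp
  then obtain K where K: "\<forall>y\<in>f ` {0..T}. norm y \<le> K" unfolding bounded_iff by blast
  show "(\<lambda>r. c r * f r) integrable_on {0<..s}"
  proof (rule measurable_bounded_by_integrable_imp_integrable)
    have "continuous_on {0<..s} (\<lambda>r. c r * f r)"
      using s by (intro continuous_on_mult continuous_on_subset[OF c_continuous] continuous_on_subset[OF f]) auto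
    then show "(\<lambda>r. c r * f r) \<in> borel_measurable (lebesgue_on {0<..s})"
      by (intro continuous_imp_measurable_on_sets_lebesgue) auto
    show "(\<lambda>r. m * K) integrable_on {0<..s}"
      by (intro integrable_on_const bounded_set_imp_lmeasurable) auto
    show "norm (c r * f r) \<le> m * K" if "r \<in> {0<..s}" for r
      unfolding norm_mult using that s c_bounded[of r] K by (intro mult_mono m_nonneg) auto
  qed auto
  have "negligible {0::real}" by simp
  then show "negligible {x \<in> {0..s} - {0<..s}. c x * f x \<noteq> 0}"
    by (rule negligible_subset) auto
  have "{x \<in> {0<..s} - {0..s}. c x * f x \<noteq> 0} = {}" by auto
  then show "negligible {x \<in> {0<..s} - {0..s}. c x * f x \<noteq> 0}" by (simp only: negligible_empty)
qed

lemma c_mult_integral_continuous: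
  "continuous_on {0..T} f \<Longrightarrow> continuous_on {0..T} (\<lambda>s. integral {0..s} (\<lambda>r. c r * f r))"
  by (intro indefinite_integral_continuous_1 c_mult_integrable) auto

text \<open>Picard iteration for u'' = - l c u with u(0) = p and u'(0) = q, sorted by powers of -l:
  \<open>pcoeff p q k\<close> is the coefficient of (-l)^k in u, and \<open>dcoeff p q k\<close> the
  one in u'.\<close>

primrec pcoeff :: "real \<Rightarrow> real \<Rightarrow> nat \<Rightarrow> real \<Rightarrow> real" where
  "pcoeff p q 0 = (\<lambda>t. p + q * t)"
| "pcoeff p q (Suc k) = (\<lambda>t. integral {0..t} (\<lambda>s. integral {0..s} (\<lambda>r. c r * pcoeff p q k r)))"

definition dcoeff :: "real \<Rightarrow> real \<Rightarrow> nat \<Rightarrow> real \<Rightarrow> real" where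
  "dcoeff p q k = (case k of 0 \<Rightarrow> (\<lambda>t. q) | Suc j \<Rightarrow> (\<lambda>s. integral {0..s} (\<lambda>r. c r * pcoeff p q j r)))"

lemma pcoeff_continuous: "continuous_on {0..T} (pcoeff p q k)"
proof (induction k)
  case (Suc k)
  show ?case
    unfolding pcoeff.simps
    by (intro indefinite_integral_continuous_1 integrable_continuous_real c_mult_integral_continuous Suc)
qed (auto intro!: continuous_intros)

lemma dcoeff_continuous: "continuous_on {0..T} (dcoeff p q k)"
  by (cases k) (simp_all add: dcoeff_def c_mult_integral_continuous pcoeff_continuous)

lemma pcoeff_derivative:
  assumes "t \<in> {0..T}"
  shows "(pcoeff p q k has_real_derivative dcoeff p q k t) (at t within {0..T})"
proof (cases k)
  case 0
  then show ?thesis by (auto simp: dcoeff_def intro!: derivative_eq_intros)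
next
  case (Suc j)
  have eq: "pcoeff p q k = (\<lambda>t. integral {0..t} (dcoeff p q k))"
    by (simp add: Suc dcoeff_def)
  show ?thesis
    unfolding eq by (rule integral_has_real_derivative[OF dcoeff_continuous assms])
qed

lemma dcoeff_derivative:
  assumes t: "t \<in> {0<..T}"
  shows "(dcoeff p q k has_real_derivative (case k of 0 \<Rightarrow> 0 | Suc j \<Rightarrow> c t * pcoeff p q j t)) (at t within {0..T})"
proof (cases k)
  case (Suc j)
  have "continuous (at t within {0<..T}) c" "continuous (at t within {0..T}) (pcoeff p q j)"
    using c_continuous pcoeff_continuous[of p q j] t by (auto simp: continuous_on_eq_continuous_within)
  then have "continuous (at t within ({0..T} - {})) (\<lambda>r. c r * pcoeff p q j r)"
    using t by (simp add: at_within_left_open continuous_mult)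
  from integral_has_vector_derivative_continuous_at[OF c_mult_integrable[OF pcoeff_continuous order_refl] _ _ this] t
  show ?thesis
    by (simp add: Suc dcoeff_def has_real_derivative_iff_has_vector_derivative)
qed (simp add: dcoeff_def)

text \<open>Since T \<le> 1, the second integration costs at most a factor 1, so one bound serves
  both coefficients. The factorial makes both series entire in l.\<close>

lemma pcoeff_bound:
  assumes "t \<in> {0..T}"
  shows "\<bar>pcoeff p q k t\<bar> \<le> (\<bar>p\<bar> + \<bar>q\<bar>) * m ^ k * t ^ k / fact k
     \<and> \<bar>dcoeff p q k t\<bar> \<le> (\<bar>p\<bar> + \<bar>q\<bar>) * m ^ k * t ^ k / fact k"
  using assms
proof (induction k arbitrary: t)
  case 0
  have "\<bar>p + q * t\<bar> \<le> \<bar>p\<bar> + \<bar>q\<bar> * \<bar>t\<bar>" using abs_triangle_ineq[of p "q * t"] by (simp add: abs_mult)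
  also have "\<dots> \<le> \<bar>p\<bar> + \<bar>q\<bar> * 1" using 0 T by (intro add_left_mono mult_left_mono) auto
  finally show ?case by (simp add: dcoeff_def)
next
  case (Suc k)
  define Q where "Q = \<bar>p\<bar> + \<bar>q\<bar>"
  have Q: "0 \<le> Q" by (simp add: Q_def)
  have d: "\<bar>dcoeff p q (Suc k) s\<bar> \<le> Q * m ^ Suc k * s ^ Suc k / fact (Suc k)" if s: "s \<in> {0..T}" for s
  proof -
    have "norm (integral {0..s} (\<lambda>r. c r * pcoeff p q k r)) \<le> integral {0..s} (\<lambda>r. Q * m ^ Suc k / fact k * r ^ k)"
    proof (rule integral_norm_bound_integral)
      show "(\<lambda>r. c r * pcoeff p q k r) integrable_on {0..s}"
        using s by (intro c_mult_integrable pcoeff_continuous) auto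
      show "(\<lambda>r. Q * m ^ Suc k / fact k * r ^ k) integrable_on {0..s}"
        by (intro integrable_continuous_real continuous_intros)
      fix r assume r: "r \<in> {0..s}"
      have "norm (c r * pcoeff p q k r) \<le> m * (Q * m ^ k * r ^ k / fact k)"
        unfolding norm_mult Q_def using Suc.IH[of r] c_bounded[of r] r s
        by (intro mult_mono m_nonneg) auto
      then show "norm (c r * pcoeff p q k r) \<le> Q * m ^ Suc k / fact k * r ^ k" by (simp add: mult_ac)
    qed
    also have "\<dots> = Q * m ^ Suc k / fact k * (s ^ Suc k / real (Suc k))"
      using s by (intro integral_unique has_integral_mult_right has_integral_power_from_0) auto
    also have "\<dots> = Q * m ^ Suc k * s ^ Suc k / fact (Suc k)" by simp
    finally show ?thesis by (simp add: dcoeff_def)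
  qed
  let ?b = "Q * m ^ Suc k * t ^ Suc k / fact (Suc k)"
  have b: "0 \<le> ?b" using Q m_nonneg Suc.prems by simp
  have "norm (integral {0..t} (dcoeff p q (Suc k))) \<le> integral {0..t} (\<lambda>s. ?b)"
  proof (rule integral_norm_bound_integral)
    show "dcoeff p q (Suc k) integrable_on {0..t}"
      using Suc.prems by (intro integrable_continuous_real continuous_on_subset[OF dcoeff_continuous]) auto
    fix s assume s: "s \<in> {0..t}"
    then have "\<bar>dcoeff p q (Suc k) s\<bar> \<le> Q * m ^ Suc k * s ^ Suc k / fact (Suc k)"
      using Suc.prems by (intro d) auto
    also have "\<dots> \<le> ?b"
      using s Q m_nonneg by (intro divide_right_mono mult_left_mono power_mono) auto
    finally show "norm (dcoeff p q (Suc k) s) \<le> ?b" by simp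
  qed auto
  also have "\<dots> = t * ?b" using Suc.prems by simp
  also have "\<dots> \<le> 1 * ?b" using Suc.prems T b by (intro mult_right_mono) auto
  finally have "\<bar>pcoeff p q (Suc k) t\<bar> \<le> ?b" by (simp add: dcoeff_def)
  with d[OF Suc.prems] show ?case by (simp add: Q_def)
qed

definition sol :: "real \<Rightarrow> real \<Rightarrow> real \<Rightarrow> real \<Rightarrow> real" where
  "sol p q l t = (\<Sum>k. (- l) ^ k * pcoeff p q k t)"

definition dsol :: "real \<Rightarrow> real \<Rightarrow> real \<Rightarrow> real \<Rightarrow> real" where
  "dsol p q l t = (\<Sum>k. (- l) ^ k * dcoeff p q k t)"

definition major :: "real \<Rightarrow> real \<Rightarrow> real \<Rightarrow> nat \<Rightarrow> real" where
  "major p q l k = (\<bar>p\<bar> + \<bar>q\<bar>) * ((\<bar>l\<bar> * m) ^ k / fact k)"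

lemma summable_major: "summable (major p q l)"
  unfolding major_def[abs_def]
  by (intro summable_mult) (use summable_exp_generic[of "\<bar>l\<bar> * m"] in \<open>simp add: field_simps\<close>)

lemma term_bound:
  assumes "t \<in> {0..T}"
  shows "\<bar>(- l) ^ k * pcoeff p q k t\<bar> \<le> major p q l k" "\<bar>(- l) ^ k * dcoeff p q k t\<bar> \<le> major p q l k"
proof -
  have "(\<bar>p\<bar> + \<bar>q\<bar>) * m ^ k * t ^ k / fact k \<le> (\<bar>p\<bar> + \<bar>q\<bar>) * m ^ k * 1 / fact k"
    using assms T m_nonneg by (intro divide_right_mono mult_left_mono power_le_one) auto
  then have "\<bar>l\<bar> ^ k * ((\<bar>p\<bar> + \<bar>q\<bar>) * m ^ k * t ^ k / fact k)
      \<le> \<bar>l\<bar> ^ k * ((\<bar>p\<bar> + \<bar>q\<bar>) * m ^ k * 1 / fact k)"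
    by (rule mult_left_mono) simp
  also have "\<dots> = major p q l k" by (simp add: major_def power_mult_distrib)
  finally have "\<bar>l\<bar> ^ k * ((\<bar>p\<bar> + \<bar>q\<bar>) * m ^ k * t ^ k / fact k) \<le> major p q l k" .
  moreover have "\<bar>(- l) ^ k * y\<bar> \<le> \<bar>l\<bar> ^ k * ((\<bar>p\<bar> + \<bar>q\<bar>) * m ^ k * t ^ k / fact k)"
    if "\<bar>y\<bar> \<le> (\<bar>p\<bar> + \<bar>q\<bar>) * m ^ k * t ^ k / fact k" for y
    unfolding abs_mult power_abs abs_minus_cancel using that by (intro mult_left_mono) auto
  ultimately show "\<bar>(- l) ^ k * pcoeff p q k t\<bar> \<le> major p q l k" "\<bar>(- l) ^ k * dcoeff p q k t\<bar> \<le> major p q l k"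
    using pcoeff_bound[OF assms, of p q k] by (meson order_trans)+
qed

lemma summable_terms:
  assumes "t \<in> {0..T}"
  shows "summable (\<lambda>k. (- l) ^ k * pcoeff p q k t)" "summable (\<lambda>k. (- l) ^ k * dcoeff p q k t)"
  using term_bound[OF assms]
  by (auto intro!: summable_comparison_test'[OF summable_major])

lemma sol_derivative:
  assumes t: "t \<in> {0..T}"
  shows "(sol p q l has_real_derivative dsol p q l t) (at t within {0..T})"
proof -
  have "\<exists>g. \<forall>x\<in>{0..T}. (\<lambda>k. (- l) ^ k * pcoeff p q k x) sums g x \<and>
      (g has_real_derivative dsol p q l x) (at x within {0..T})"
  proof (rule has_field_derivative_series)
    show "((\<lambda>x. (- l) ^ k * pcoeff p q k x) has_real_derivative (- l) ^ k * dcoeff p q k x) (at x within {0..T})"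
      if "x \<in> {0..T}" for k x
      by (intro DERIV_cmult pcoeff_derivative that)
    show "uniform_limit {0..T} (\<lambda>n x. \<Sum>i<n. (- l) ^ i * dcoeff p q i x) (dsol p q l) sequentially"
      unfolding dsol_def[abs_def]
      by (rule Weierstrass_m_test[OF _ summable_major[of p q l]]) (use term_bound in simp)
  qed (use summable_terms[OF t] t in auto)
  then obtain g where g: "\<And>x. x \<in> {0..T} \<Longrightarrow> (\<lambda>k. (- l) ^ k * pcoeff p q k x) sums g x"
    "(g has_real_derivative dsol p q l t) (at t within {0..T})" using t by blast
  have "sol p q l x = g x" if "x \<in> {0..T}" for x
    using g(1)[OF that] by (simp add: sol_def sums_iff)
  then show ?thesis
    using has_field_derivative_transform_within[OF g(2) zero_less_one t, of "sol p q l"] by simp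
qed

text \<open>Termwise differentiation on the half-open interval, where c is continuous; the powers of
  -l shift by one, which produces the factor -l c.\<close>

lemma dsol_derivative:
  assumes t: "t \<in> {0<..T}"
  shows "(dsol p q l has_real_derivative - (l * c t * sol p q l t)) (at t within {0..T})"
proof -
  let ?d = "\<lambda>k x. (- l) ^ k * (case k of 0 \<Rightarrow> 0 | Suc j \<Rightarrow> c x * pcoeff p q j x)"
  have Suc: "?d (Suc j) x = (- l * c x) * ((- l) ^ j * pcoeff p q j x)" for j x by simp
  have s: "summable (\<lambda>j. ?d (Suc j) x)" if "x \<in> {0..T}" for x
    unfolding Suc by (intro summable_mult summable_terms that)
  have sum: "suminf (\<lambda>k. ?d k x) = - (l * c x * sol p q l x)" if "x \<in> {0..T}" for x
  proof -
    have "summable (\<lambda>k. ?d k x)" by (rule iffD1[OF summable_Suc_iff s[OF that]])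
    then have "suminf (\<lambda>k. ?d k x) = (\<Sum>j. ?d (Suc j) x)"
      using suminf_split_head[of "\<lambda>k. ?d k x"] by simp
    also have "\<dots> = (- l * c x) * sol p q l x"
      unfolding Suc sol_def by (rule suminf_mult[OF summable_terms(1)[OF that]])
    finally show ?thesis by simp
  qed
  have "\<exists>g. \<forall>x\<in>{0<..T}. (\<lambda>k. (- l) ^ k * dcoeff p q k x) sums g x \<and>
      (g has_real_derivative suminf (\<lambda>k. ?d k x)) (at x within {0<..T})"
  proof (rule has_field_derivative_series)
    show "((\<lambda>x. (- l) ^ k * dcoeff p q k x) has_real_derivative ?d k x) (at x within {0<..T})"
      if "x \<in> {0<..T}" for k x
      using that by (intro DERIV_cmult) (use dcoeff_derivative[OF that] in \<open>simp add: at_within_left_open\<close>)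
    define M where "M k = (case k of 0 \<Rightarrow> 0 | Suc j \<Rightarrow> \<bar>l\<bar> * m * major p q l j)" for k
    have "summable (\<lambda>j. M (Suc j))" unfolding M_def by (simp add: summable_mult summable_major)
    then have M: "summable M" by (simp only: summable_Suc_iff)
    show "uniform_limit {0<..T} (\<lambda>n x. \<Sum>i<n. ?d i x) (\<lambda>x. suminf (\<lambda>k. ?d k x)) sequentially"
    proof (rule Weierstrass_m_test[OF _ M])
      fix k x assume x: "x \<in> {0<..T}"
      show "norm (?d k x) \<le> M k"
      proof (cases k)
        case (Suc j)
        have "norm (?d k x) = (\<bar>l\<bar> * \<bar>c x\<bar>) * \<bar>(- l) ^ j * pcoeff p q j x\<bar>"
          by (simp add: Suc abs_mult)
        also have "\<dots> \<le> (\<bar>l\<bar> * m) * major p q l j"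
          using x c_bounded[of x] m_nonneg term_bound(1)[of x l j p q] by (intro mult_mono) auto
        finally show ?thesis by (simp add: Suc M_def)
      qed (simp add: M_def)
    qed
  qed (use summable_terms[of t] t in auto)
  then obtain g where g: "\<And>x. x \<in> {0<..T} \<Longrightarrow> (\<lambda>k. (- l) ^ k * dcoeff p q k x) sums g x"
    "(g has_real_derivative suminf (\<lambda>k. ?d k t)) (at t within {0<..T})" using t by blast
  have "dsol p q l x = g x" if "x \<in> {0<..T}" for x
    using g(1)[OF that] by (simp add: dsol_def sums_iff)
  then have "(dsol p q l has_real_derivative suminf (\<lambda>k. ?d k t)) (at t within {0<..T})"
    using has_field_derivative_transform_within[OF g(2) zero_less_one t, of "dsol p q l"] by simp
  then show ?thesis using t by (simp add: sum at_within_left_open)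
qed

lemma dsol_continuous: "continuous_on {0..T} (dsol p q l)"
proof (rule uniform_limit_theorem)
  show "uniform_limit {0..T} (\<lambda>n x. \<Sum>i<n. (- l) ^ i * dcoeff p q i x) (dsol p q l) sequentially"
    unfolding dsol_def[abs_def]
    by (rule Weierstrass_m_test[OF _ summable_major[of p q l]]) (use term_bound in simp)
  show "\<forall>\<^sub>F n in sequentially. continuous_on {0..T} (\<lambda>x. \<Sum>i<n. (- l) ^ i * dcoeff p q i x)"
    by (intro always_eventually allI continuous_on_sum continuous_on_mult continuous_on_const dcoeff_continuous)
qed simp

lemma sol_initial: "sol p q l 0 = p" "dsol p q l 0 = q"
proof -
  have "(- l) ^ k * pcoeff p q k 0 = (if k = 0 then p else 0)" for k by (cases k) auto
  then have "sol p q l 0 = (\<Sum>k. if k = 0 then p else 0)" unfolding sol_def by presburger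
  then show "sol p q l 0 = p" using sums_single[of 0 "\<lambda>k. p"] by (simp add: sums_iff)
  have "(- l) ^ k * dcoeff p q k 0 = (if k = 0 then q else 0)" for k by (cases k) (auto simp: dcoeff_def)
  then have "dsol p q l 0 = (\<Sum>k. if k = 0 then q else 0)" unfolding dsol_def by presburger
  then show "dsol p q l 0 = q" using sums_single[of 0 "\<lambda>k. q"] by (simp add: sums_iff)
qed

text \<open>A power series that converges for every l is continuous, which is what the functional
  calculus asks of a multiplier.\<close>

lemma sol_continuous_parameter:
  assumes t: "t \<in> {0..T}"
  shows "continuous_on UNIV (\<lambda>l. sol p q l t)" "continuous_on UNIV (\<lambda>l. dsol p q l t)"
proof -
  have *: "continuous_on UNIV (\<lambda>l. \<Sum>k. (- l) ^ k * a k)" if "\<And>l. summable (\<lambda>k. (- l) ^ k * a k)" for a :: "nat \<Rightarrow> real"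
  proof -
    have "summable (\<lambda>k. a k * y ^ k)" for y using that[of "-y"] by (simp add: mult.commute)
    then have "isCont (\<lambda>y. \<Sum>k. a k * y ^ k) y" for y by (rule isCont_powser_converges_everywhere)
    then have "continuous_on UNIV (\<lambda>y. \<Sum>k. a k * y ^ k)" by (simp add: continuous_at_imp_continuous_on)
    then have "continuous_on UNIV (\<lambda>l. \<Sum>k. a k * (- l) ^ k)"
      by (rule continuous_on_compose2) (auto intro!: continuous_intros)
    then show ?thesis by (simp add: mult.commute)
  qed
  show "continuous_on UNIV (\<lambda>l. sol p q l t)" "continuous_on UNIV (\<lambda>l. dsol p q l t)"
    unfolding sol_def dsol_def by (intro * summable_terms t)+
qed

end

section \<open>Polynomial growth in the spectral parameter\<close>

text \<open>The function e exp (-k) is nonincreasing. Derivatives are asked for only in the open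
  interval, so t = 0, where c may have no limit, can be an endpoint.\<close>

lemma gronwall:
  fixes e k :: "real \<Rightarrow> real"
  assumes ab: "a \<le> b" and e: "continuous_on {a..b} e" and k: "continuous_on {a..b} k"
    and der: "\<And>t. a < t \<Longrightarrow> t < b \<Longrightarrow> \<exists>e' k'. (e has_real_derivative e') (at t) \<and>
      (k has_real_derivative k') (at t) \<and> e' \<le> k' * e t"
  shows "e b \<le> exp (k b - k a) * e a"
proof -
  have "e b * exp (- k b) \<le> e a * exp (- k a)"
  proof (rule DERIV_nonpos_imp_decreasing_open[OF ab])
    fix t assume "a < t" "t < b"
    then obtain e' k' where d: "(e has_real_derivative e') (at t)" "(k has_real_derivative k') (at t)"
      "e' \<le> k' * e t" using der by blast
    have "((\<lambda>t. e t * exp (- k t)) has_real_derivative (e' - k' * e t) * exp (- k t)) (at t)"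
      using d(1,2) by (auto intro!: derivative_eq_intros simp: algebra_simps)
    moreover have "(e' - k' * e t) * exp (- k t) \<le> 0" using d(3) by (simp add: mult_le_0_iff)
    ultimately show "\<exists>y. ((\<lambda>t. e t * exp (- k t)) has_real_derivative y) (at t) \<and> y \<le> 0" by blast
  qed (intro continuous_intros e k)
  then have "e b * exp (- k b) * exp (k b) \<le> e a * exp (- k a) * exp (k b)"
    by (rule mult_right_mono) simp
  moreover have "e b * exp (- k b) * exp (k b) = e b"
    by (simp add: mult.assoc exp_add[symmetric])
  moreover have "e a * exp (- k a) * exp (k b) = exp (k b - k a) * e a"
    by (simp add: exp_diff exp_minus field_simps)
  ultimately show ?thesis by simp
qed

definition wave_solution :: "(real \<Rightarrow> real) \<Rightarrow> real \<Rightarrow> real \<Rightarrow> (real \<Rightarrow> real) \<Rightarrow> (real \<Rightarrow> real) \<Rightarrow> bool" where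
  "wave_solution c T l u u' \<longleftrightarrow>
     (\<forall>t\<in>{0..T}. (u has_real_derivative u' t) (at t within {0..T})) \<and>
     (\<forall>t\<in>{0<..T}. (u' has_real_derivative - (l * c t * u t)) (at t within {0..T})) \<and>
     continuous_on {0..T} u'"

lemma wave_solution_continuous:
  assumes "wave_solution c T l u u'"
  shows "continuous_on {0..T} u" "continuous_on {0..T} u'"
  using assms DERIV_continuous_on[of "{0..T}" u u'] by (auto simp: wave_solution_def)

lemma wave_solution_derivative:
  assumes "wave_solution c T l u u'" "0 < t" "t < T"
  shows "(u has_real_derivative u' t) (at t)" "(u' has_real_derivative - (l * c t * u t)) (at t)"
proof -
  have "(u has_real_derivative u' t) (at t within {0..T})"
    "(u' has_real_derivative - (l * c t * u t)) (at t within {0..T})"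
    using assms unfolding wave_solution_def by simp_all
  then show "(u has_real_derivative u' t) (at t)" "(u' has_real_derivative - (l * c t * u t)) (at t)"
    unfolding at_within_Icc_at[OF assms(2,3)] .
qed

locale oscillating_coefficient =
  fixes T0 K0 \<mu>1 \<mu>2 :: real and \<omega> \<psi> c c' c'' :: "real \<Rightarrow> real"
  assumes T0: "0 < T0" "T0 < 1"
    and \<omega>_pos: "\<And>t. t \<in> {0<..T0} \<Longrightarrow> \<omega> t > 0" and \<omega>_mono: "antimono_on {0<..T0} \<omega>"
    and \<psi>_pos: "\<And>t. t \<in> {0<..T0} \<Longrightarrow> \<psi> t > 0" and \<psi>_mono: "antimono_on {0<..T0} \<psi>"
    and \<omega>_\<psi>: "\<And>t. t \<in> {0<..T0} \<Longrightarrow> \<omega> t * (1 + \<psi> t) \<le> K0 * \<bar>ln t\<bar>"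
    and c': "\<And>t. t \<in> {0<..T0} \<Longrightarrow> (c has_real_derivative c' t) (at t within {0<..T0})"
    and c'': "\<And>t. t \<in> {0<..T0} \<Longrightarrow> (c' has_real_derivative c'' t) (at t within {0<..T0})"
    and \<mu>: "0 < \<mu>1" "0 < \<mu>2" and c_bounds_open: "\<And>t. t \<in> {0<..<T0} \<Longrightarrow> \<mu>1 \<le> c t \<and> c t \<le> \<mu>2"
    and c'_bound: "\<And>t. t \<in> {0<..T0} \<Longrightarrow> \<bar>c' t\<bar> \<le> \<omega> t / t"
    and c''_bound: "\<And>t. t \<in> {0<..T0} \<Longrightarrow> \<bar>c'' t\<bar> \<le> (\<omega> t)\<^sup>2 / t\<^sup>2 * exp (\<psi> t)"
begin

section \<open>Energy estimates for the scalar equation\<close>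

lemma c_continuous: "continuous_on {0<..T0} c" and c'_continuous: "continuous_on {0<..T0} c'"
  using DERIV_continuous_on[of "{0<..T0}" c c'] DERIV_continuous_on[of "{0<..T0}" c' c''] c' c'' by blast+

lemma c_bounds:
  assumes t: "t \<in> {0<..T0}"
  shows "\<mu>1 \<le> c t" "c t \<le> \<mu>2"
proof -
  have cl: "closure {t / 2<..<T0} = {t / 2..T0}" using t T0 by (intro closure_greaterThanLessThan) auto
  have cont: "continuous_on (closure {t / 2<..<T0}) c"
    unfolding cl using t by (intro continuous_on_subset[OF c_continuous]) auto
  have t': "t \<in> closure {t / 2<..<T0}" unfolding cl using t by auto
  show "\<mu>1 \<le> c t"
    by (rule continuous_ge_on_closure[OF cont t']) (use t c_bounds_open in auto)
  show "c t \<le> \<mu>2"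
    by (rule continuous_le_on_closure[OF cont t']) (use t c_bounds_open in auto)
qed

lemma c_derivative:
  assumes "0 < t" "t < T0"
  shows "(c has_real_derivative c' t) (at t)" "(c' has_real_derivative c'' t) (at t)"
proof -
  have "at t within {0<..T0} = at t"
    using assms by (intro at_within_interior) (simp add: interior_atLeastAtMost_real[of 0 T0] )
  then show "(c has_real_derivative c' t) (at t)" "(c' has_real_derivative c'' t) (at t)"
    using c'[of t] c''[of t] assms by auto
qed

text \<open>The derivative of the energy is 2 u u' (w - l c), and 2 |u'| sqrt w |u| is at most the
  energy. The weight w will be 1 for bounded l, and l in the initial time interval.\<close>

lemma energy_weighted:
  assumes u: "wave_solution c T0 l u u'" and w: "0 < w" and t: "t \<in> {0..T0}"
    and K: "\<And>s. s \<in> {0<..T0} \<Longrightarrow> \<bar>w - l * c s\<bar> \<le> K * sqrt w"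
  shows "(u' t)\<^sup>2 + w * (u t)\<^sup>2 \<le> exp (K * t) * ((u' 0)\<^sup>2 + w * (u 0)\<^sup>2)"
proof -
  let ?e = "\<lambda>t. (u' t)\<^sup>2 + w * (u t)\<^sup>2"
  have cont: "continuous_on {0..t} u" "continuous_on {0..t} u'"
    using t wave_solution_continuous[OF u] by (auto intro: continuous_on_subset)
  have "?e t \<le> exp (K * t - K * 0) * ?e 0"
  proof (rule gronwall[where e = ?e and k = "\<lambda>t. K * t"])
    fix s assume s: "0 < s" "s < t"
    have d: "(u has_real_derivative u' s) (at s)" "(u' has_real_derivative - (l * c s * u s)) (at s)"
      using wave_solution_derivative[OF u, of s] s t by auto
    let ?d = "2 * u' s * u s * (w - l * c s)"
    have "(?e has_real_derivative ?d) (at s)"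
      using d by (auto intro!: derivative_eq_intros simp: algebra_simps)
    moreover have "((\<lambda>t. K * t) has_real_derivative K) (at s)"
      by (auto intro!: derivative_eq_intros)
    moreover have "?d \<le> K * ?e s"
    proof -
      have Ks: "\<bar>w - l * c s\<bar> \<le> K * sqrt w" using s t by (intro K) auto
      then have K0: "0 \<le> K" using w by (smt (verit) zero_le_mult_iff real_sqrt_gt_0_iff)
      have "2 * \<bar>u' s\<bar> * (sqrt w * \<bar>u s\<bar>) \<le> ?e s"
        using sum_squares_bound[of "\<bar>u' s\<bar>" "sqrt w * \<bar>u s\<bar>"] w by (simp add: power_mult_distrib)
      then have "K * (2 * \<bar>u' s\<bar> * (sqrt w * \<bar>u s\<bar>)) \<le> K * ?e s" using K0 by (rule mult_left_mono)
      moreover have "?d \<le> \<bar>2 * u' s * u s\<bar> * \<bar>w - l * c s\<bar>" by (metis abs_ge_self abs_mult)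
      moreover have "\<dots> \<le> \<bar>2 * u' s * u s\<bar> * (K * sqrt w)" by (intro mult_left_mono Ks) simp
      ultimately show ?thesis by (simp add: abs_mult mult_ac)
    qed
    ultimately show "\<exists>e' k'. (?e has_real_derivative e') (at s) \<and>
        ((\<lambda>t. K * t) has_real_derivative k') (at s) \<and> e' \<le> k' * ?e s" by blast
  qed (use t cont in \<open>auto intro!: continuous_intros\<close>)
  then show ?thesis by simp
qed

lemma energy_low:
  assumes u: "wave_solution c T0 l u u'" and l: "0 \<le> l" "l \<le> \<Lambda>" and t: "t \<in> {0..T0}"
  shows "(u' t)\<^sup>2 + (u t)\<^sup>2 \<le> exp (1 + \<Lambda> * \<mu>2) * ((u' 0)\<^sup>2 + (u 0)\<^sup>2)"
proof -
  let ?K = "1 + \<Lambda> * \<mu>2"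
  have "\<bar>1 - l * c s\<bar> \<le> ?K * sqrt 1" if "s \<in> {0<..T0}" for s
  proof -
    have c: "0 \<le> c s" "c s \<le> \<mu>2" using c_bounds[OF that] \<mu> by auto
    have "l * c s \<le> \<Lambda> * \<mu>2" using c l \<mu> by (intro mult_mono) auto
    moreover have "0 \<le> l * c s" using c l by simp
    ultimately show ?thesis by (simp add: abs_le_iff)
  qed
  from energy_weighted[OF u zero_less_one t this]
  have "(u' t)\<^sup>2 + (u t)\<^sup>2 \<le> exp (?K * t) * ((u' 0)\<^sup>2 + (u 0)\<^sup>2)" by simp
  also have "\<dots> \<le> exp ?K * ((u' 0)\<^sup>2 + (u 0)\<^sup>2)"
  proof (rule mult_right_mono)
    have "?K * t \<le> ?K * 1" using t T0 l \<mu> by (intro mult_left_mono) (auto intro!: add_nonneg_nonneg)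
    then show "exp (?K * t) \<le> exp ?K" by simp
  qed simp
  finally show ?thesis .
qed

text \<open>Only the bounds of c enter, so the exponent is of order t sqrt l; this is affordable up
  to t = ln (sqrt l) / sqrt l.\<close>

lemma energy_initial:
  assumes u: "wave_solution c T0 l u u'" and l: "0 < l" and t: "t \<in> {0..T0}"
  shows "(u' t)\<^sup>2 + l * (u t)\<^sup>2 \<le> exp ((1 + \<mu>2) * sqrt l * t) * ((u' 0)\<^sup>2 + l * (u 0)\<^sup>2)"
proof (rule energy_weighted[OF u l t])
  fix s assume s: "s \<in> {0<..T0}"
  have "l - l * c s = l * (1 - c s)" by (simp add: algebra_simps)
  then have "\<bar>l - l * c s\<bar> = l * \<bar>1 - c s\<bar>" using l by (simp add: abs_mult)
  also have "\<dots> \<le> l * (1 + \<mu>2)" using l c_bounds[OF s] \<mu> by (intro mult_left_mono) auto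
  also have "\<dots> = (1 + \<mu>2) * sqrt l * sqrt l" using l by simp
  finally show "\<bar>l - l * c s\<bar> \<le> (1 + \<mu>2) * sqrt l * sqrt l" .
qed

text \<open>With weight l c the terms in u u' cancel; what remains is c' l u^2, at most \<omega> /
  (\<mu>1 t) times the energy. Monotonicity replaces \<omega> by its value at a, and 1 / t
  integrates to a logarithm.\<close>

lemma energy_hyperbolic:
  assumes u: "wave_solution c T0 l u u'" and l: "0 < l" and ab: "0 < a" "a \<le> b" "b \<le> T0"
  shows "(u' b)\<^sup>2 + l * c b * (u b)\<^sup>2 \<le> exp (\<omega> a / \<mu>1 * (ln b - ln a)) * ((u' a)\<^sup>2 + l * c a * (u a)\<^sup>2)"
proof -
  let ?K = "\<omega> a / \<mu>1"
  have cont: "continuous_on {a..b} u" "continuous_on {a..b} u'" "continuous_on {a..b} c"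
    using ab wave_solution_continuous[OF u] c_continuous by (auto intro: continuous_on_subset)
  have "(u' b)\<^sup>2 + l * c b * (u b)\<^sup>2 \<le> exp (?K * ln b - ?K * ln a) * ((u' a)\<^sup>2 + l * c a * (u a)\<^sup>2)"
  proof (rule gronwall[where e = "\<lambda>t. (u' t)\<^sup>2 + l * c t * (u t)\<^sup>2" and k = "\<lambda>t. ?K * ln t"])
    fix s assume s: "a < s" "s < b"
    have s0: "s \<in> {0<..T0}" using s ab by auto
    have d: "(u has_real_derivative u' s) (at s)" "(u' has_real_derivative - (l * c s * u s)) (at s)"
      "(c has_real_derivative c' s) (at s)"
      using wave_solution_derivative[OF u, of s] c_derivative[of s] s ab by auto
    let ?e = "c' s * (l * (u s)\<^sup>2)"
    have "((\<lambda>t. (u' t)\<^sup>2 + l * c t * (u t)\<^sup>2) has_real_derivative ?e) (at s)"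
      using d by (auto intro!: derivative_eq_intros simp: algebra_simps)
    moreover have "((\<lambda>t. ?K * ln t) has_real_derivative ?K / s) (at s)"
      using s ab \<mu> by (auto intro!: derivative_eq_intros)
    moreover have "?e \<le> ?K / s * ((u' s)\<^sup>2 + l * c s * (u s)\<^sup>2)"
    proof -
      have om: "\<omega> s \<le> \<omega> a" using monotone_onD[OF \<omega>_mono, of a s] s s0 ab by auto
      have "c' s \<le> \<omega> s / s" using c'_bound[OF s0] by linarith
      also have "\<dots> \<le> \<omega> a / s" using om s0 by (intro divide_right_mono) auto
      finally have 1: "c' s \<le> \<omega> a / s" .
      have om0: "0 < \<omega> a" using \<omega>_pos[of a] ab by auto
      have "?e \<le> \<omega> a / s * (l * (u s)\<^sup>2)" using 1 l by (intro mult_right_mono) auto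
      also have "\<dots> = ?K / s * (\<mu>1 * (l * (u s)\<^sup>2))" using \<mu> by simp
      also have "\<dots> \<le> ?K / s * ((u' s)\<^sup>2 + l * c s * (u s)\<^sup>2)"
      proof (rule mult_left_mono)
        have "\<mu>1 * (l * (u s)\<^sup>2) \<le> c s * (l * (u s)\<^sup>2)" using c_bounds[OF s0] l by (intro mult_right_mono) auto
        also have "\<dots> \<le> (u' s)\<^sup>2 + l * c s * (u s)\<^sup>2" by (simp add: mult_ac)
        finally show "\<mu>1 * (l * (u s)\<^sup>2) \<le> (u' s)\<^sup>2 + l * c s * (u s)\<^sup>2" .
        show "0 \<le> ?K / s" using om0 \<mu> s0 by simp
      qed
      finally show ?thesis .
    qed
    ultimately show "\<exists>e' k'. ((\<lambda>t. (u' t)\<^sup>2 + l * c t * (u t)\<^sup>2) has_real_derivative e') (at s) \<and>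
        ((\<lambda>t. ?K * ln t) has_real_derivative k') (at s) \<and> e' \<le> k' * ((u' s)\<^sup>2 + l * c s * (u s)\<^sup>2)" by blast
  qed (use ab cont \<mu> in \<open>auto intro!: continuous_intros\<close>)
  then show ?thesis by (simp add: right_diff_distrib)
qed

text \<open>With \<open>z = u' + (c' / 4c) u\<close>, the energy \<open>z\<^sup>2 / \<surd>c + l \<surd>c u\<^sup>2\<close> is the classical energy of the
  Liouville transform \<open>c\<^bsup>1/4\<^esup> u\<close>; all terms of its derivative that are of the order of \<open>c'\<close> cancel.\<close>

definition corrected :: "(real \<Rightarrow> real) \<Rightarrow> (real \<Rightarrow> real) \<Rightarrow> real \<Rightarrow> real" where
  "corrected u u' t = u' t + c' t / (4 * c t) * u t"

definition liouville_energy :: "real \<Rightarrow> (real \<Rightarrow> real) \<Rightarrow> (real \<Rightarrow> real) \<Rightarrow> real \<Rightarrow> real" where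
  "liouville_energy l u u' t = (corrected u u' t)\<^sup>2 / sqrt (c t) + l * sqrt (c t) * (u t)\<^sup>2"

text \<open>With g = c' / (4 c) this is g' - g^2, what survives the cancellation: linear in c'' and
  quadratic in c'.\<close>

definition remainder :: "real \<Rightarrow> real" where
  "remainder t = c'' t / (4 * c t) - 5 * (c' t)\<^sup>2 / (16 * (c t)\<^sup>2)"

text \<open>With s = sqrt c one has u' = z - g u, s' = 2 s g and z' = g z + (remainder - l s^2) u.
  Hence z^2 / s and l s u^2 have the derivatives 2 remainder z u / s - 2 l s z u and 2 l s z
  u.\<close>

lemma liouville_energy_derivative:
  assumes u: "wave_solution c T0 l u u'" and t: "0 < t" "t < T0"
  shows "(liouville_energy l u u' has_real_derivative
      2 * remainder t * corrected u u' t * u t / sqrt (c t)) (at t)"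
proof -
  have ct: "0 < c t" using c_bounds[of t] t \<mu> by auto
  have d: "(u has_real_derivative u' t) (at t)" "(u' has_real_derivative - (l * c t * u t)) (at t)"
    "(c has_real_derivative c' t) (at t)" "(c' has_real_derivative c'' t) (at t)"
    using wave_solution_derivative[OF u t] c_derivative[OF t] by auto
  define s where "s = sqrt (c t)"
  have s: "0 < s" "c t = s\<^sup>2" using ct by (simp_all add: s_def)
  define g where "g = c' t / (4 * c t)"
  define z where "z = corrected u u' t"
  have c'g: "c' t = 4 * s\<^sup>2 * g" using s by (simp add: g_def)
  have u'z: "u' t = z - g * u t" by (simp add: z_def corrected_def g_def)
  define g' where "g' = remainder t + g\<^sup>2"
  have g'_eq: "g' = (c'' t * c t - c' t * c' t) / (4 * c t * c t)"
    using ct by (simp add: g'_def remainder_def g_def field_simps power2_eq_square)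
  have dg: "((\<lambda>t. c' t / (4 * c t)) has_real_derivative g') (at t)"
    unfolding g'_eq using d(3,4) ct
    by (auto intro!: derivative_eq_intros simp: field_simps)
  have dz: "(corrected u u' has_real_derivative - l * s\<^sup>2 * u t + g' * u t + g * u' t) (at t)"
    unfolding corrected_def[abs_def]
    by (rule DERIV_cong[OF DERIV_add[OF d(2) DERIV_mult[OF dg d(1)]]])
      (simp add: g_def s(2) algebra_simps)
  have ds: "((\<lambda>t. sqrt (c t)) has_real_derivative 2 * s * g) (at t)"
    using DERIV_chain2[OF DERIV_real_sqrt[OF ct] d(3)] s(1)
    by (simp add: c'g s_def[symmetric] power2_eq_square field_simps)
  have "(liouville_energy l u u' has_real_derivative
      (2 * z * (- l * s\<^sup>2 * u t + g' * u t + g * u' t) * s - z\<^sup>2 * (2 * s * g)) / (s * s)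
      + l * (2 * s * g * (u t)\<^sup>2 + s * (2 * u t * u' t))) (at t)"
  proof -
    have *: "((\<lambda>t. (w t)\<^sup>2 / r t + l * r t * (v t)\<^sup>2) has_real_derivative
        (2 * w t * w' * r t - (w t)\<^sup>2 * r') / (r t * r t) + l * (r' * (v t)\<^sup>2 + r t * (2 * v t * v'))) (at t)"
      if "(w has_real_derivative w') (at t)" "(r has_real_derivative r') (at t)"
        "(v has_real_derivative v') (at t)" "r t \<noteq> 0" for w r v :: "real \<Rightarrow> real" and w' r' v'
      using that by (auto intro!: derivative_eq_intros simp: algebra_simps)
    show ?thesis
      unfolding liouville_energy_def[abs_def]
      using *[OF dz ds d(1)] s(1) by (simp add: s_def z_def)
  qed
  also have "(2 * z * (- l * s\<^sup>2 * u t + g' * u t + g * u' t) * s - z\<^sup>2 * (2 * s * g)) / (s * s)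
      + l * (2 * s * g * (u t)\<^sup>2 + s * (2 * u t * u' t)) = 2 * remainder t * z * u t / s"
    unfolding u'z g'_def using s(1) by (simp add: field_simps power2_eq_square)
  finally show ?thesis by (simp add: s_def z_def)
qed

text \<open>2 |z| |u| is at most the energy divided by sqrt l; this gain makes the bound R / t^2
  affordable, whose integral is R (1 / a - 1 / b).\<close>

lemma energy_liouville:
  assumes u: "wave_solution c T0 l u u'" and l: "0 < l" and ab: "0 < a" "a \<le> b" "b \<le> T0"
    and r: "\<And>t. a < t \<Longrightarrow> t < b \<Longrightarrow> \<bar>remainder t\<bar> \<le> R / t\<^sup>2"
  shows "liouville_energy l u u' b \<le> exp (R / sqrt (l * \<mu>1) * (1 / a - 1 / b)) * liouville_energy l u u' a"
proof -
  let ?K = "R / sqrt (l * \<mu>1)"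
  have cont: "continuous_on {a..b} u" "continuous_on {a..b} u'" "continuous_on {a..b} c" "continuous_on {a..b} c'"
    using ab wave_solution_continuous[OF u] c_continuous c'_continuous by (auto intro: continuous_on_subset)
  have cpos: "0 < c t" if "t \<in> {a..b}" for t using c_bounds[of t] \<mu> that ab by auto
  have "liouville_energy l u u' b \<le> exp (- ?K / b - - ?K / a) * liouville_energy l u u' a"
  proof (rule gronwall[where k = "\<lambda>t. - ?K / t"])
    show "continuous_on {a..b} (liouville_energy l u u')"
      unfolding liouville_energy_def[abs_def] corrected_def
      using cpos by (intro continuous_intros cont) force+
    show "continuous_on {a..b} (\<lambda>t. - ?K / t)" using ab by (intro continuous_intros) auto
    fix s assume s: "a < s" "s < b"
    have s0: "s \<in> {0<..T0}" "0 < s" "s < T0" using s ab by auto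
    have cs: "0 < c s" "\<mu>1 \<le> c s" using c_bounds[OF s0(1)] \<mu> by auto
    let ?z = "corrected u u' s"
    let ?e = "2 * remainder s * ?z * u s / sqrt (c s)"
    have "((\<lambda>t. - ?K / t) has_real_derivative ?K / s\<^sup>2) (at s)"
      using s0 l \<mu> by (auto intro!: derivative_eq_intros simp: power2_eq_square)
    moreover have "?e \<le> ?K / s\<^sup>2 * liouville_energy l u u' s"
    proof -
      define q where "q = sqrt (c s)"
      have q: "0 < q" "c s = q\<^sup>2" using cs by (simp_all add: q_def)
      have sl: "0 < sqrt l" "(sqrt l)\<^sup>2 = l" using l by simp_all
      have "2 * \<bar>?z\<bar> * \<bar>sqrt l * q * u s\<bar> \<le> ?z\<^sup>2 + (sqrt l * q * u s)\<^sup>2"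
        using sum_squares_bound[of "\<bar>?z\<bar>" "\<bar>sqrt l * q * u s\<bar>"] by simp
      then have "2 * \<bar>?z\<bar> * \<bar>u s\<bar> * sqrt l * q \<le> ?z\<^sup>2 + l * q\<^sup>2 * (u s)\<^sup>2"
        using q(1) sl by (simp add: abs_mult power_mult_distrib mult_ac)
      also have "\<dots> = liouville_energy l u u' s * q"
        using q(1) by (simp add: liouville_energy_def q_def[symmetric] field_simps power2_eq_square)
      finally have "2 * \<bar>?z\<bar> * \<bar>u s\<bar> * sqrt l \<le> liouville_energy l u u' s"
        using q(1) by simp
      then have 1: "2 * \<bar>?z\<bar> * \<bar>u s\<bar> \<le> liouville_energy l u u' s / sqrt l"
        using sl(1) by (simp add: field_simps)
      have R: "0 \<le> R / s\<^sup>2" using r[OF s] by linarith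
      have F: "0 \<le> liouville_energy l u u' s / sqrt l"
        using 1 by (smt (verit, best) abs_ge_zero mult_nonneg_nonneg)
      have "?e \<le> \<bar>remainder s\<bar> * (2 * \<bar>?z\<bar> * \<bar>u s\<bar>) / sqrt (c s)"
      proof (rule divide_right_mono)
        show "2 * remainder s * ?z * u s \<le> \<bar>remainder s\<bar> * (2 * \<bar>?z\<bar> * \<bar>u s\<bar>)"
          using abs_ge_self[of "2 * remainder s * ?z * u s"] by (simp add: abs_mult mult_ac)
      qed (use cs in simp)
      also have "\<dots> \<le> R / s\<^sup>2 * (liouville_energy l u u' s / sqrt l) / sqrt \<mu>1"
        using r[OF s] 1 cs \<mu> R F by (intro frac_le mult_mono mult_nonneg_nonneg) auto
      also have "\<dots> = ?K / s\<^sup>2 * liouville_energy l u u' s" by (simp add: real_sqrt_mult)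
      finally show ?thesis .
    qed
    ultimately show "\<exists>e' k'. (liouville_energy l u u' has_real_derivative e') (at s) \<and>
        ((\<lambda>t. - ?K / t) has_real_derivative k') (at s) \<and> e' \<le> k' * liouville_energy l u u' s"
      using liouville_energy_derivative[OF u s0(2,3)] by blast
  qed (use ab in auto)
  then show ?thesis by (simp add: right_diff_distrib)
qed

text \<open>The hypothesis makes z differ from u' by a term whose square is at most q l u^2. In the
  third time interval q will not depend on l.\<close>

lemma liouville_energy_equiv:
  assumes l: "0 < l" and t: "t \<in> {0<..T0}" and G: "(c' t / (4 * c t))\<^sup>2 \<le> q * l" and q: "0 \<le> q"
  defines "P \<equiv> 1 + (3 + 2 * q) / sqrt \<mu>1 + 2 * sqrt \<mu>2"
  shows "liouville_energy l u u' t \<le> P * ((u' t)\<^sup>2 + l * (u t)\<^sup>2)"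
    and "(u' t)\<^sup>2 + l * (u t)\<^sup>2 \<le> P * liouville_energy l u u' t"
proof -
  define s where "s = sqrt (c t)"
  define g where "g = c' t / (4 * c t)"
  define z where "z = corrected u u' t"
  have ct: "\<mu>1 \<le> c t" "c t \<le> \<mu>2" using c_bounds[OF t] by auto
  have s: "0 < s" "sqrt \<mu>1 \<le> s" "s \<le> sqrt \<mu>2" using ct \<mu> by (simp_all add: s_def)
  have m1: "0 < sqrt \<mu>1" using \<mu> by simp
  have F: "liouville_energy l u u' t = z\<^sup>2 / s + s * (l * (u t)\<^sup>2)"
    by (simp add: liouville_energy_def z_def s_def mult_ac)
  have z: "z = u' t + g * u t" by (simp add: z_def corrected_def g_def)
  have sq2: "(x + y)\<^sup>2 \<le> 2 * x\<^sup>2 + 2 * y\<^sup>2" for x y :: real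
    using sum_squares_bound[of x y] by (simp add: power2_sum)
  have gu: "(g * u t)\<^sup>2 \<le> q * (l * (u t)\<^sup>2)"
    using mult_right_mono[OF G, of "(u t)\<^sup>2"] by (simp only: g_def power_mult_distrib mult.assoc zero_le_power2)
  have w: "0 \<le> l * (u t)\<^sup>2" using l by simp
  have z2: "z\<^sup>2 \<le> 2 * (u' t)\<^sup>2 + 2 * (q * (l * (u t)\<^sup>2))"
    unfolding z using sq2[of "u' t" "g * u t"] gu by linarith
  have "z\<^sup>2 / s \<le> (2 * (u' t)\<^sup>2 + 2 * (q * (l * (u t)\<^sup>2))) / sqrt \<mu>1"
    using z2 s m1 order_trans[OF zero_le_power2 z2] by (intro frac_le) auto
  moreover have "s * (l * (u t)\<^sup>2) \<le> sqrt \<mu>2 * (l * (u t)\<^sup>2)"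
    using s w by (intro mult_right_mono)
  moreover have "(2 * (u' t)\<^sup>2 + 2 * (q * (l * (u t)\<^sup>2))) / sqrt \<mu>1
      = 2 / sqrt \<mu>1 * (u' t)\<^sup>2 + 2 * q / sqrt \<mu>1 * (l * (u t)\<^sup>2)"
    by (simp add: add_divide_distrib)
  ultimately have 1: "liouville_energy l u u' t
      \<le> 2 / sqrt \<mu>1 * (u' t)\<^sup>2 + (2 * q / sqrt \<mu>1 + sqrt \<mu>2) * (l * (u t)\<^sup>2)"
    unfolding F by (simp add: distrib_right)
  \<comment> \<open>The four coefficients that occur in the two comparisons.\<close>
  have P: "2 / sqrt \<mu>1 \<le> P" "2 * q / sqrt \<mu>1 + sqrt \<mu>2 \<le> P"
    "2 * sqrt \<mu>2 \<le> P" "(2 * q + 1) / sqrt \<mu>1 \<le> P"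
  proof -
    define r where "r = 1 / sqrt \<mu>1"
    have r: "0 < r" "0 \<le> q * r" "0 \<le> sqrt \<mu>2" using q m1 \<mu> by (simp_all add: r_def)
    have "P = 1 + 3 * r + 2 * (q * r) + 2 * sqrt \<mu>2" by (simp add: P_def r_def add_divide_distrib)
    moreover have "2 / sqrt \<mu>1 = 2 * r" "2 * q / sqrt \<mu>1 = 2 * (q * r)" "(2 * q + 1) / sqrt \<mu>1 = 2 * (q * r) + r"
      by (simp_all add: r_def add_divide_distrib)
    ultimately show "2 / sqrt \<mu>1 \<le> P" "2 * q / sqrt \<mu>1 + sqrt \<mu>2 \<le> P"
      "2 * sqrt \<mu>2 \<le> P" "(2 * q + 1) / sqrt \<mu>1 \<le> P" using r by linarith+
  qed
  have "2 / sqrt \<mu>1 * (u' t)\<^sup>2 + (2 * q / sqrt \<mu>1 + sqrt \<mu>2) * (l * (u t)\<^sup>2)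
      \<le> P * (u' t)\<^sup>2 + P * (l * (u t)\<^sup>2)"
    using P w by (intro add_mono mult_right_mono) auto
  with 1 show "liouville_energy l u u' t \<le> P * ((u' t)\<^sup>2 + l * (u t)\<^sup>2)"
    by (simp add: distrib_left)
  have "(u' t)\<^sup>2 \<le> 2 * z\<^sup>2 + 2 * (q * (l * (u t)\<^sup>2))"
    using sq2[of z "- (g * u t)"] gu by (simp add: z)
  then have "(u' t)\<^sup>2 + l * (u t)\<^sup>2 \<le> 2 * z\<^sup>2 + (2 * q + 1) * (l * (u t)\<^sup>2)"
    by (simp add: algebra_simps)
  also have "2 * z\<^sup>2 \<le> P * (z\<^sup>2 / s)"
  proof -
    have "2 * z\<^sup>2 = 2 * s * (z\<^sup>2 / s)" using s by simp
    also have "\<dots> \<le> P * (z\<^sup>2 / s)" using s P(3) by (intro mult_right_mono) auto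
    finally show ?thesis .
  qed
  also have "(2 * q + 1) * (l * (u t)\<^sup>2) \<le> P * (s * (l * (u t)\<^sup>2))"
  proof -
    have "(2 * q + 1) * (l * (u t)\<^sup>2) = (2 * q + 1) / sqrt \<mu>1 * (sqrt \<mu>1 * (l * (u t)\<^sup>2))" using m1 by simp
    also have "\<dots> \<le> P * (s * (l * (u t)\<^sup>2))"
      using P(4) s(2) less_imp_le[OF s(1)] w q m1 l order_trans[OF _ P(4), of 0]
      by (intro mult_mono mult_right_mono mult_nonneg_nonneg) auto
    finally show ?thesis .
  qed
  finally show "(u' t)\<^sup>2 + l * (u t)\<^sup>2 \<le> P * liouville_energy l u u' t"
    unfolding F by (simp add: distrib_left)
qed

lemma hyperbolic_energy_equiv:
  assumes l: "0 < l" and t: "t \<in> {0<..T0}"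
  defines "P \<equiv> 1 + \<mu>2 + 1 / \<mu>1"
  shows "(u' t)\<^sup>2 + l * c t * (u t)\<^sup>2 \<le> P * ((u' t)\<^sup>2 + l * (u t)\<^sup>2)"
    and "(u' t)\<^sup>2 + l * (u t)\<^sup>2 \<le> P * ((u' t)\<^sup>2 + l * c t * (u t)\<^sup>2)"
proof -
  have ct: "\<mu>1 \<le> c t" "c t \<le> \<mu>2" using c_bounds[OF t] by auto
  have w: "0 \<le> l * (u t)\<^sup>2" using l by simp
  have P: "1 \<le> P" "\<mu>2 \<le> P" "1 / \<mu>1 \<le> P" "0 \<le> P" using \<mu> by (simp_all add: P_def)
  have "c t * (l * (u t)\<^sup>2) \<le> P * (l * (u t)\<^sup>2)" using ct P w by (intro mult_right_mono) auto
  moreover have u': "1 * (u' t)\<^sup>2 \<le> P * (u' t)\<^sup>2" using P(1) by (intro mult_right_mono) auto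
  ultimately show "(u' t)\<^sup>2 + l * c t * (u t)\<^sup>2 \<le> P * ((u' t)\<^sup>2 + l * (u t)\<^sup>2)"
    by (simp add: distrib_left mult_ac)
  have "l * (u t)\<^sup>2 = 1 / \<mu>1 * (\<mu>1 * (l * (u t)\<^sup>2))" using \<mu> by simp
  also have "\<dots> \<le> P * (c t * (l * (u t)\<^sup>2))"
    using P ct w \<mu> l by (intro mult_mono mult_right_mono mult_nonneg_nonneg) auto
  finally show "(u' t)\<^sup>2 + l * (u t)\<^sup>2 \<le> P * ((u' t)\<^sup>2 + l * c t * (u t)\<^sup>2)"
    using u' by (simp add: distrib_left mult_ac)
qed

text \<open>As exp \<psi> \<ge> 1, the square of c' obeys the same bound as c''.\<close>

lemma remainder_bound:
  assumes t: "t \<in> {0<..T0}"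
  shows "\<bar>remainder t\<bar> \<le> (1 / (4 * \<mu>1) + 5 / (16 * \<mu>1\<^sup>2)) * ((\<omega> t)\<^sup>2 * exp (\<psi> t)) / t\<^sup>2"
proof -
  have ct: "\<mu>1 \<le> c t" using c_bounds[OF t] by auto
  define W where "W = (\<omega> t)\<^sup>2 / t\<^sup>2 * exp (\<psi> t)"
  have W: "0 \<le> W" by (simp add: W_def)
  have "\<bar>c' t\<bar>\<^sup>2 \<le> (\<omega> t / t)\<^sup>2" using c'_bound[OF t] by (intro power_mono) auto
  also have "\<dots> \<le> W" unfolding W_def power_divide
    using \<psi>_pos[OF t] by (simp add: divide_right_mono mult_le_cancel_left1)
  finally have 1: "(c' t)\<^sup>2 \<le> W" by simp
  have 2: "\<bar>c'' t\<bar> \<le> W" using c''_bound[OF t] by (simp add: W_def)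
  have "\<bar>remainder t\<bar> \<le> \<bar>c'' t\<bar> / (4 * c t) + 5 * (c' t)\<^sup>2 / (16 * (c t)\<^sup>2)"
    unfolding remainder_def using ct \<mu> abs_triangle_ineq4[of "c'' t / (4 * c t)" "5 * (c' t)\<^sup>2 / (16 * (c t)\<^sup>2)"]
    by (simp add: abs_mult)
  also have "\<dots> \<le> W / (4 * \<mu>1) + 5 * W / (16 * \<mu>1\<^sup>2)"
    using 1 2 ct \<mu> W by (intro add_mono frac_le mult_left_mono power_mono) auto
  also have "\<dots> = (1 / (4 * \<mu>1) + 5 / (16 * \<mu>1\<^sup>2)) * W" by (simp add: distrib_right)
  finally show ?thesis by (simp add: W_def)
qed

text \<open>The three summands are the growth exponents, per unit of ln (sqrt l), of the three time
  intervals.\<close>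

definition \<kappa> :: real where
  "\<kappa> = (1 + \<mu>2) + K0 / \<mu>1 + (1 / (4 * \<mu>1) + 5 / (16 * \<mu>1\<^sup>2)) * K0\<^sup>2 / sqrt \<mu>1"

lemma K0_pos: "0 < K0"
proof -
  have "0 < \<omega> T0 * (1 + \<psi> T0)" using \<omega>_pos[of T0] \<psi>_pos[of T0] T0 by (intro mult_pos_pos add_pos_pos) auto
  also have "\<dots> \<le> K0 * \<bar>ln T0\<bar>" using \<omega>_\<psi>[of T0] T0 by simp
  finally show ?thesis by (simp add: zero_less_mult_iff)
qed

text \<open>With \<open>\<xi> = \<surd>l\<close>, the time interval is split at \<open>a = ln \<xi> / \<xi>\<close> and \<open>b = a exp (1 + \<psi> a)\<close>. The
  three energies grow by a factor \<open>exp (O (ln \<xi>))\<close> in the three parts: in the second one because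
  \<open>\<integral>\<^sub>a\<^sup>b \<omega> t / t dt \<le> \<omega> a (1 + \<psi> a)\<close>, and in the third one because
  \<open>\<omega>\<^sup>2 exp \<psi> / (\<xi> b) \<le> (\<omega> a)\<^sup>2 / ln \<xi>\<close>.\<close>

lemma energy_high:
  assumes u: "wave_solution c T0 l u u'" and l: "0 < l"
    and L: "1 \<le> ln (sqrt l)" "ln (sqrt l) / sqrt l < T0" and t: "t \<in> {0..T0}"
  defines "P \<equiv> 1 + (3 + 2 * (K0 / (4 * \<mu>1))\<^sup>2) / sqrt \<mu>1 + 2 * sqrt \<mu>2" and "Q \<equiv> 1 + \<mu>2 + 1 / \<mu>1"
  shows "(u' t)\<^sup>2 + l * (u t)\<^sup>2 \<le> P\<^sup>2 * Q\<^sup>2 * exp (\<kappa> * ln (sqrt l)) * ((u' 0)\<^sup>2 + l * (u 0)\<^sup>2)"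
proof -
  define \<xi> where "\<xi> = sqrt l"
  define L where "L = ln \<xi>"
  define a where "a = L / \<xi>"
  define b where "b = a * exp (1 + \<psi> a)"
  define N where "N t = (u' t)\<^sup>2 + l * (u t)\<^sup>2" for t
  define H where "H t = (u' t)\<^sup>2 + l * c t * (u t)\<^sup>2" for t
  define S where "S = 1 / (4 * \<mu>1) + 5 / (16 * \<mu>1\<^sup>2)"
  have S: "0 < S" using \<mu> by (simp add: S_def add_pos_pos)
  have \<xi>: "0 < \<xi>" "\<xi>\<^sup>2 = l" using l by (simp_all add: \<xi>_def)
  have L1: "1 \<le> L" and aT: "a < T0" using L by (simp_all add: L_def a_def \<xi>_def)
  have a0: "0 < a" using L1 \<xi> by (simp add: a_def)
  have aI: "a \<in> {0<..T0}" using a0 aT by simp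
  \<comment> \<open>ln a = ln L - L lies between -L and 0, so the hypothesis at time a bounds
    \<open>\<omega> a * (1 + \<psi> a)\<close> by K0 L.\<close>
  have ln_a: "\<bar>ln a\<bar> \<le> L"
  proof -
    have "ln a = ln L - L" using L1 \<xi> by (simp add: a_def ln_div L_def)
    moreover have "0 \<le> ln L" "ln L \<le> L - 1" using L1 by (simp_all add: ln_le_minus_one)
    ultimately show ?thesis by simp
  qed
  have \<omega>a: "0 < \<omega> a" and \<psi>a: "0 < \<psi> a" using \<omega>_pos[OF aI] \<psi>_pos[OF aI] by auto
  have \<omega>\<psi>a: "\<omega> a * (1 + \<psi> a) \<le> K0 * L"
    using \<omega>_\<psi>[OF aI] mult_left_mono[OF ln_a, of K0] K0_pos by linarith
  have "\<omega> a * 1 \<le> \<omega> a * (1 + \<psi> a)" using \<omega>a \<psi>a by (intro mult_left_mono) auto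
  then have \<omega>aL: "\<omega> a \<le> K0 * L" using \<omega>\<psi>a by simp
  have ab: "a < b" using a0 \<psi>a by (simp add: b_def mult_less_cancel_left1)
  have P1: "1 \<le> P" and Q1: "1 \<le> Q" using \<mu> by (simp_all add: P_def Q_def add_nonneg_nonneg)
  have N0: "0 \<le> N t" for t using l by (simp add: N_def)
  define x1 x2 x3 where "x1 = (1 + \<mu>2) * L" and "x2 = K0 / \<mu>1 * L" and "x3 = S * K0\<^sup>2 / sqrt \<mu>1 * L"
  have x: "0 \<le> x1" "0 \<le> x2" "0 \<le> x3" using \<mu> K0_pos L1 S by (simp_all add: x1_def x2_def x3_def)
  have first: "N t \<le> exp x1 * N 0" if "t \<in> {0..a}" for t
  proof -
    have "N t \<le> exp ((1 + \<mu>2) * \<xi> * t) * N 0"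
      unfolding N_def \<xi>_def using that aT by (intro energy_initial[OF u l]) auto
    also have "\<dots> \<le> exp x1 * N 0"
    proof (intro mult_right_mono N0)
      have "(1 + \<mu>2) * \<xi> * t \<le> (1 + \<mu>2) * \<xi> * a" using that \<mu> \<xi> by (intro mult_left_mono) auto
      also have "\<dots> = x1" using \<xi> by (simp add: a_def x1_def)
      finally show "exp ((1 + \<mu>2) * \<xi> * t) \<le> exp x1" by simp
    qed
    finally show ?thesis .
  qed
  \<comment> \<open>By the choice of b, ln t - ln a is at most 1 + \<psi> a here, so the hyperbolic
    exponent is at most K0 L / \<mu>1.\<close>
  have second: "N t \<le> Q\<^sup>2 * exp x2 * N a" if "a \<le> t" "t \<le> b" "t \<le> T0" for t
  proof -
    have tI: "t \<in> {0<..T0}" using that a0 by auto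
    have "ln t \<le> ln b" using that tI by simp
    also have "ln b = ln a + (1 + \<psi> a)" using a0 by (simp add: b_def ln_mult)
    finally have "\<omega> a * (ln t - ln a) \<le> \<omega> a * (1 + \<psi> a)" using \<omega>a by (intro mult_left_mono) auto
    then have "\<omega> a * (ln t - ln a) \<le> K0 * L" using \<omega>\<psi>a by linarith
    then have "\<omega> a / \<mu>1 * (ln t - ln a) \<le> x2" using \<mu> by (simp add: x2_def divide_right_mono)
    then have e: "exp (\<omega> a / \<mu>1 * (ln t - ln a)) \<le> exp x2" by simp
    have H0: "0 \<le> H a" using l c_bounds[OF aI] \<mu> by (simp add: H_def)
    have "N t \<le> Q * H t" unfolding N_def H_def Q_def by (rule hyperbolic_energy_equiv[OF l tI])
    also have "\<dots> \<le> Q * (exp (\<omega> a / \<mu>1 * (ln t - ln a)) * H a)"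
      unfolding H_def using Q1 that by (intro mult_left_mono energy_hyperbolic[OF u l a0]) auto
    also have "\<dots> \<le> Q * (exp x2 * (Q * N a))"
    proof (intro mult_left_mono mult_mono e)
      show "H a \<le> Q * N a" unfolding N_def H_def Q_def by (rule hyperbolic_energy_equiv[OF l aI])
    qed (use Q1 H0 in auto)
    finally show ?thesis by (simp add: power2_eq_square mult_ac)
  qed
  \<comment> \<open>If b exceeds T0, this claim is vacuous.\<close>
  have third: "N t \<le> P\<^sup>2 * exp x3 * N b" if t: "b \<le> t" "t \<le> T0" for t
  proof -
    have I: "s \<in> {0<..T0}" "\<omega> s \<le> \<omega> a" "\<psi> s \<le> \<psi> a" if "a \<le> s" "s \<le> T0" for s
      using that a0 monotone_onD[OF \<omega>_mono aI, of s] monotone_onD[OF \<psi>_mono aI, of s] by auto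
    have equiv: "liouville_energy l u u' s \<le> P * N s \<and> N s \<le> P * liouville_energy l u u' s"
      if s: "a \<le> s" "s \<le> T0" for s
    proof -
      \<comment> \<open>From time a on, |c'| is at most \<omega> a / a \<le> K0 L / a = K0 \<xi>;
        this is the origin of the comparison constant q = (K0 / (4 \<mu>1))^2.\<close>
      have "\<bar>c' s / (4 * c s)\<bar> \<le> (\<omega> a / a) / (4 * \<mu>1)"
      proof -
        have "\<bar>c' s\<bar> \<le> \<omega> s / s" by (rule c'_bound[OF I(1)[OF s]])
        also have "\<dots> \<le> \<omega> a / a" using I[OF s] a0 s \<omega>_pos[of s] by (intro frac_le) auto
        finally have "\<bar>c' s\<bar> \<le> \<omega> a / a" .
        then show ?thesis
          unfolding abs_divide using c_bounds[OF I(1)[OF s]] \<mu> by (intro frac_le) auto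
      qed
      also have "\<dots> \<le> K0 / (4 * \<mu>1) * \<xi>"
      proof -
        have "\<omega> a / a \<le> K0 * L / a" using \<omega>aL a0 by (intro divide_right_mono) auto
        also have "\<dots> = K0 * \<xi>" using L1 \<xi> by (simp add: a_def)
        finally have "\<omega> a / a / (4 * \<mu>1) \<le> K0 * \<xi> / (4 * \<mu>1)"
          using \<mu> by (intro divide_right_mono) auto
        then show ?thesis by simp
      qed
      finally have "\<bar>c' s / (4 * c s)\<bar>\<^sup>2 \<le> (K0 / (4 * \<mu>1) * \<xi>)\<^sup>2" by (intro power_mono) auto
      then have "(c' s / (4 * c s))\<^sup>2 \<le> (K0 / (4 * \<mu>1))\<^sup>2 * l"
        by (simp only: power2_abs power_mult_distrib \<xi>(2))
      from liouville_energy_equiv[OF l I(1)[OF s] this, where u = u and u' = u']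
      show ?thesis by (simp add: P_def N_def)
    qed
    have b0: "0 < b" using a0 ab by simp
    define R where "R = S * ((\<omega> a)\<^sup>2 * exp (\<psi> a))"
    have R: "\<bar>remainder s\<bar> \<le> R / s\<^sup>2" if s: "a \<le> s" "s \<le> T0" for s
    proof -
      have "(\<omega> s)\<^sup>2 * exp (\<psi> s) \<le> (\<omega> a)\<^sup>2 * exp (\<psi> a)"
        using I[OF s] \<omega>_pos[of s] by (intro mult_mono power_mono) auto
      then have "S * ((\<omega> s)\<^sup>2 * exp (\<psi> s)) / s\<^sup>2 \<le> R / s\<^sup>2"
        unfolding R_def using S by (intro divide_right_mono mult_left_mono) auto
      with remainder_bound[OF I(1)[OF s]] show ?thesis by (simp add: S_def)
    qed
    have "R / sqrt (l * \<mu>1) * (1 / b - 1 / t) \<le> x3"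
    proof -
      have R0: "0 \<le> R" using S by (simp add: R_def)
      have "R / sqrt (l * \<mu>1) * (1 / b - 1 / t) \<le> R / sqrt (l * \<mu>1) * (1 / b)"
        using t b0 R0 l \<mu> by (intro mult_left_mono) auto
      also have "\<dots> = S / sqrt \<mu>1 * ((\<omega> a)\<^sup>2 * exp (\<psi> a) / (\<xi> * b))"
        by (simp add: R_def real_sqrt_mult \<xi>_def[symmetric])
      \<comment> \<open>The point of the choice of b: the factor exp (\<psi> a) cancels.\<close>
      also have "\<xi> * b = L * exp 1 * exp (\<psi> a)" using \<xi> by (simp add: b_def a_def exp_add)
      also have "(\<omega> a)\<^sup>2 * exp (\<psi> a) / (L * exp 1 * exp (\<psi> a)) = (\<omega> a)\<^sup>2 / (L * exp 1)" by simp
      also have "S / sqrt \<mu>1 * \<dots> \<le> S / sqrt \<mu>1 * (K0\<^sup>2 * L)"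
      proof (intro mult_left_mono)
        have "(\<omega> a)\<^sup>2 / (L * exp 1) \<le> (K0 * L)\<^sup>2 / (L * 1)"
          using \<omega>aL \<omega>a L1 by (intro frac_le power_mono mult_left_mono) auto
        also have "\<dots> = K0\<^sup>2 * L" using L1 by (simp add: power2_eq_square)
        finally show "(\<omega> a)\<^sup>2 / (L * exp 1) \<le> K0\<^sup>2 * L" .
      qed (use S \<mu> in simp)
      finally show ?thesis by (simp add: x3_def)
    qed
    then have e: "exp (R / sqrt (l * \<mu>1) * (1 / b - 1 / t)) \<le> exp x3" by simp
    have bI: "a \<le> b" "b \<le> T0" using ab t by auto
    have F0: "0 \<le> liouville_energy l u u' b" 
      using l c_bounds[OF I(1)[OF bI]] \<mu> by (simp add: liouville_energy_def)
    have "N t \<le> P * liouville_energy l u u' t" using equiv[of t] t ab by auto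
    also have "\<dots> \<le> P * (exp (R / sqrt (l * \<mu>1) * (1 / b - 1 / t)) * liouville_energy l u u' b)"
      using P1 t ab R by (intro mult_left_mono energy_liouville[OF u l b0]) auto
    also have "\<dots> \<le> P * (exp x3 * (P * N b))"
      using P1 F0 equiv[OF bI] by (intro mult_left_mono mult_mono e) auto
    finally show ?thesis by (simp add: power2_eq_square mult_ac)
  qed
  have PQ: "1 \<le> P\<^sup>2" "1 \<le> Q\<^sup>2" using P1 Q1 by (simp_all add: one_le_power)
  have first': "N a \<le> exp x1 * N 0" using a0 by (intro first) auto
  have second': "N t \<le> Q\<^sup>2 * exp x2 * (exp x1 * N 0)" if "a \<le> t" "t \<le> b" "t \<le> T0" for t
    using second[OF that] mult_left_mono[OF first', of "Q\<^sup>2 * exp x2"] by auto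
  have "N t \<le> (P\<^sup>2 * exp x3) * ((Q\<^sup>2 * exp x2) * (exp x1 * N 0))"
  proof -
    \<comment> \<open>The factors of the later intervals are at least 1, so the full product also
      bounds the energy at earlier times.\<close>
    have one: "1 \<le> P\<^sup>2 * exp x3" "1 \<le> Q\<^sup>2 * exp x2"
      using PQ x mult_mono[of 1 "P\<^sup>2" 1 "exp x3"] mult_mono[of 1 "Q\<^sup>2" 1 "exp x2"] by auto
    have pos: "0 \<le> exp x1 * N 0" using N0[of 0] by simp
    then have pos2: "0 \<le> (Q\<^sup>2 * exp x2) * (exp x1 * N 0)" by simp
    have le1: "exp x1 * N 0 \<le> (Q\<^sup>2 * exp x2) * (exp x1 * N 0)"
      using mult_right_mono[OF one(2) pos] by simp
    have le2: "(Q\<^sup>2 * exp x2) * (exp x1 * N 0) \<le> (P\<^sup>2 * exp x3) * ((Q\<^sup>2 * exp x2) * (exp x1 * N 0))"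
      using mult_right_mono[OF one(1) pos2] by simp
    consider "t \<le> a" | "a \<le> t" "t \<le> b" | "b \<le> t" by linarith
    then show ?thesis
    proof cases
      case 1
      then have "N t \<le> exp x1 * N 0" using t by (intro first) auto
      with le1 le2 show ?thesis by (meson order_trans)
    next
      case 2
      then show ?thesis using second'[of t] t le2 by auto
    next
      case 3
      then have "N b \<le> (Q\<^sup>2 * exp x2) * (exp x1 * N 0)" using t ab by (intro second') auto
      then have "(P\<^sup>2 * exp x3) * N b \<le> (P\<^sup>2 * exp x3) * ((Q\<^sup>2 * exp x2) * (exp x1 * N 0))"
        by (intro mult_left_mono) auto
      then show ?thesis using third[of t] 3 t by auto
    qed
  qed
  also have "\<dots> = P\<^sup>2 * Q\<^sup>2 * exp (x1 + x2 + x3) * N 0" by (simp add: exp_add mult_ac)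
  also have "x1 + x2 + x3 = \<kappa> * ln (sqrt l)"
    by (simp add: x1_def x2_def x3_def \<kappa>_def S_def L_def \<xi>_def distrib_right)
  finally show ?thesis by (simp add: N_def)
qed

text \<open>For large l, exp (\<kappa> ln (sqrt l)) = l^(\<kappa>/2), and one further power of l
  compares the initial energy of weight l with that of weight 1. For l below the threshold
  \<open>energy_low\<close> gives a constant.\<close>

theorem polynomial_growth:
  "\<exists>M>0. \<exists>p>0. \<forall>l\<ge>0. \<forall>u u'. wave_solution c T0 l u u' \<longrightarrow>
     (\<forall>t\<in>{0..T0}. (u' t)\<^sup>2 + (u t)\<^sup>2 \<le> M * (1 + l) powr p * ((u' 0)\<^sup>2 + (u 0)\<^sup>2))"
proof -
  have "((\<lambda>x::real. ln x / x) \<longlongrightarrow> 0) at_top" by (rule ln_x_over_x_tendsto_0)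
  then have "eventually (\<lambda>x. ln x / x < T0) at_top" using T0(1) by (rule order_tendstoD)
  then obtain X where X: "\<And>x. X \<le> x \<Longrightarrow> ln x / x < T0" by (auto simp: eventually_at_top_linorder)
  \<comment> \<open>Makes sqrt l at least e and at least X, which are the two conditions of
    \<open>energy_high\<close>.\<close>
  define \<Lambda> where "\<Lambda> = (max (exp 1) X)\<^sup>2"
  have \<Lambda>: "1 \<le> ln (sqrt l) \<and> ln (sqrt l) / sqrt l < T0 \<and> 1 \<le> l" if "\<Lambda> \<le> l" for l
  proof -
    have "0 \<le> max (exp 1) X" using exp_ge_zero[of "1::real"] by (simp add: le_max_iff_disj)
    then have "max (exp 1) X = sqrt \<Lambda>" unfolding \<Lambda>_def by (rule real_sqrt_unique[symmetric, OF refl])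
    then have *: "exp 1 \<le> sqrt l" "X \<le> sqrt l" using real_sqrt_le_mono[OF that]
      by (metis max.bounded_iff)+
    have "1 \<le> sqrt l" using order_trans[OF one_le_exp_iff[THEN iffD2] *(1)] by simp
    moreover have "1 \<le> ln (sqrt l)"
      using less_le_trans[OF exp_gt_zero *(1)] *(1) by (subst ln_ge_iff)
    ultimately show ?thesis using X[of "sqrt l"] * by simp
  qed
  define P where "P = 1 + (3 + 2 * (K0 / (4 * \<mu>1))\<^sup>2) / sqrt \<mu>1 + 2 * sqrt \<mu>2"
  define Q where "Q = 1 + \<mu>2 + 1 / \<mu>1"
  define M where "M = P\<^sup>2 * Q\<^sup>2 + exp (1 + \<Lambda> * \<mu>2)"
  define p where "p = 1 + \<kappa> / 2"
  have \<kappa>: "0 < \<kappa>" using \<mu> K0_pos by (simp add: \<kappa>_def add_pos_pos)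
  have M: "0 < M" by (simp add: M_def add_nonneg_pos)
  have p: "0 < p" using \<kappa> by (simp add: p_def)
  have "(u' t)\<^sup>2 + (u t)\<^sup>2 \<le> M * (1 + l) powr p * ((u' 0)\<^sup>2 + (u 0)\<^sup>2)"
    if l: "0 \<le> l" and u: "wave_solution c T0 l u u'" and t: "t \<in> {0..T0}" for l u u' t
  proof (cases "\<Lambda> \<le> l")
    case True
    then have l1: "1 \<le> ln (sqrt l)" "ln (sqrt l) / sqrt l < T0" "1 \<le> l" "0 < l" using \<Lambda>[OF True] by auto
    have "(u' t)\<^sup>2 + (u t)\<^sup>2 \<le> (u' t)\<^sup>2 + l * (u t)\<^sup>2"
      using mult_right_mono[OF l1(3), of "(u t)\<^sup>2"] by simp
    also have "\<dots> \<le> P\<^sup>2 * Q\<^sup>2 * exp (\<kappa> * ln (sqrt l)) * ((u' 0)\<^sup>2 + l * (u 0)\<^sup>2)"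
      unfolding P_def Q_def by (rule energy_high[OF u l1(4,1,2) t])
    also have "\<dots> \<le> M * (1 + l) powr (\<kappa> / 2) * ((1 + l) * ((u' 0)\<^sup>2 + (u 0)\<^sup>2))"
    proof (intro mult_mono)
      show "P\<^sup>2 * Q\<^sup>2 \<le> M" by (simp add: M_def)
      have "exp (\<kappa> * ln (sqrt l)) = l powr (\<kappa> / 2)" using l1(4) by (simp add: powr_def ln_sqrt)
      also have "\<dots> \<le> (1 + l) powr (\<kappa> / 2)" using l \<kappa> by (intro powr_mono2) auto
      finally show "exp (\<kappa> * ln (sqrt l)) \<le> (1 + l) powr (\<kappa> / 2)" .
      have "1 * (u' 0)\<^sup>2 \<le> (1 + l) * (u' 0)\<^sup>2" "l * (u 0)\<^sup>2 \<le> (1 + l) * (u 0)\<^sup>2"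
        using l by (intro mult_right_mono; simp)+
      then show "(u' 0)\<^sup>2 + l * (u 0)\<^sup>2 \<le> (1 + l) * ((u' 0)\<^sup>2 + (u 0)\<^sup>2)" by (simp add: distrib_left)
    qed (use M l in auto)
    also have "\<dots> = M * (1 + l) powr p * ((u' 0)\<^sup>2 + (u 0)\<^sup>2)"
      using l by (simp add: p_def powr_add)
    finally show ?thesis .
  next
    case False
    have "(u' t)\<^sup>2 + (u t)\<^sup>2 \<le> exp (1 + \<Lambda> * \<mu>2) * 1 * ((u' 0)\<^sup>2 + (u 0)\<^sup>2)"
      using energy_low[OF u l _ t, of \<Lambda>] False by simp
    also have "\<dots> \<le> M * (1 + l) powr p * ((u' 0)\<^sup>2 + (u 0)\<^sup>2)"
      using l p M by (intro mult_right_mono mult_mono) (auto simp: M_def ge_one_powr_ge_zero)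
    finally show ?thesis .
  qed
  with M p show ?thesis by blast
qed

end

section \<open>Functional calculus on hyperdistributions and the scale of spaces\<close>

context nonneg_self_adjoint
begin

text \<open>The squared norm of (f - g)(A) y is an integral against a measure carried by
  [0, b].\<close>

lemma fc_cong_E:
  assumes f: "test_function f" and g: "test_function g" and y: "E b y = y"
    and eq: "\<And>l. 0 \<le> l \<Longrightarrow> l \<le> b \<Longrightarrow> f l = g l"
  shows "fc f y = fc g y"
proof -
  let ?h = "\<lambda>l. f l - g l"
  have h: "test_function ?h" by (rule test_function_diff[OF f g])
  have "(norm (fc ?h y))\<^sup>2 = (\<integral>l. ?h l * ?h l \<partial>\<mu> y)"
    by (simp add: fc_norm_square[OF h] integral_\<mu>(2)[OF test_function_mult[OF h h]])
  also have "\<dots> = 0"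
  proof (rule integral_eq_zero_AE)
    show "AE l in \<mu> y. ?h l * ?h l = 0"
      using AE_\<mu>_nonneg[of y] AE_\<mu>_le[OF y] by eventually_elim (simp add: eq)
  qed
  finally show ?thesis by (simp add: fc_diff[OF f g])
qed

text \<open>\<open>fc_E_eq_self\<close> would need room beyond n. Instead, all later cutoffs act on
  y as this one does, and they converge to the identity.\<close>

lemma fc_cutoff_eq_self:
  assumes "E (real n) y = y"
  shows "fc (cutoff (real n)) y = y"
proof (rule LIMSEQ_unique)
  have "eventually (\<lambda>k. fc (cutoff (real k)) y = fc (cutoff (real n)) y) sequentially"
    using eventually_ge_at_top[of n]
  proof eventually_elim
    case (elim k)
    then show ?case
      by (intro fc_cong_E[OF test_function_cutoff test_function_cutoff assms]) (simp add: cutoff_simps)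
  qed
  then show "(\<lambda>k. fc (cutoff (real k)) y) \<longlonglongrightarrow> fc (cutoff (real n)) y" by (rule tendsto_eventually)
qed (rule fc_cutoff_tendsto)

lemma bounded_A_on_range:
  assumes y: "E (real n) y = y"
  shows "y \<in> D" "norm (A y) \<le> (real n + 1) * norm y"
proof -
  have *: "y \<in> D \<and> A y = fc (\<lambda>l. l * cutoff (real n) l) y"
    using fc_in_D[OF test_function_cutoff, of "real n" y] fc_cutoff_eq_self[OF y] by simp
  then show "y \<in> D" by simp
  have "norm (fc (\<lambda>l. l * cutoff (real n) l) y) \<le> (real n + 1) * norm y"
  proof (rule fc_norm_le[OF test_function_mult_id[OF test_function_cutoff]])
    fix l :: real assume l: "0 \<le> l"
    show "\<bar>l * cutoff (real n) l\<bar> \<le> real n + 1"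
    proof (cases "l \<le> real n + 1")
      case True
      then have "l * cutoff (real n) l \<le> (real n + 1) * 1" using l by (intro mult_mono) (auto simp: cutoff_simps)
      then show ?thesis using l by (simp add: cutoff_simps)
    qed (simp add: cutoff_simps)
  qed
  with * show "norm (A y) \<le> (real n + 1) * norm y" by simp
qed

text \<open>The operator f(A) on hyperdistributions, for continuous f of any growth: the cutoff
  equals 1 on [0, n], which carries the spectrum of \<open>v n\<close>, and only serves to make the
  multiplier a test function.\<close>

definition act :: "(real \<Rightarrow> real) \<Rightarrow> (nat \<Rightarrow> 'h) \<Rightarrow> nat \<Rightarrow> 'h" where
  "act f v n = fc (\<lambda>l. f l * cutoff (real n) l) (v n)"

lemma hyper_E: "v \<in> hyperdistributions E \<Longrightarrow> m \<le> n \<Longrightarrow> E (real m) (v n) = v m"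
  by (simp add: hyperdistributions_def)

lemma hyper_add:
  "v \<in> hyperdistributions E \<Longrightarrow> w \<in> hyperdistributions E \<Longrightarrow> (\<lambda>n. v n + w n) \<in> hyperdistributions E"
  by (simp add: hyperdistributions_def linear_add[OF linear_E])

lemma act_hyper:
  assumes f: "continuous_on UNIV f" and v: "v \<in> hyperdistributions E"
  shows "act f v \<in> hyperdistributions E"
  unfolding hyperdistributions_def
proof (intro CollectI allI impI)
  fix m n :: nat assume mn: "m \<le> n"
  have "E (real m) (act f v n) = fc (\<lambda>l. f l * cutoff (real n) l) (v m)"
    by (simp add: act_def fc_E_commute[symmetric] test_function_mult_cutoff f hyper_E[OF v mn])
  also have "\<dots> = act f v m"
    unfolding act_def
    by (rule fc_cong_E[OF test_function_mult_cutoff test_function_mult_cutoff hyper_E[OF v order_refl]])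
      (use mn f in \<open>auto simp: cutoff_simps\<close>)
  finally show "E (real m) (act f v n) = act f v m" .
qed

lemma act_one: "v \<in> hyperdistributions E \<Longrightarrow> act (\<lambda>l. 1) v = v"
  by (rule ext) (simp add: act_def fc_cutoff_eq_self[OF hyper_E])

lemma act_zero: "act (\<lambda>l. 0) v = (\<lambda>n. 0)"
  using fc_cmult[OF test_function_cutoff, of 0] by (simp add: act_def fun_eq_iff)

lemma act_diff:
  "continuous_on UNIV f \<Longrightarrow> continuous_on UNIV g \<Longrightarrow> act (\<lambda>l. f l - g l) v n = act f v n - act g v n"
  unfolding act_def by (subst fc_diff[symmetric]) (auto simp: left_diff_distrib intro!: test_function_mult_cutoff)

lemma act_cmult: "continuous_on UNIV f \<Longrightarrow> act (\<lambda>l. r * f l) v n = r *\<^sub>R act f v n"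
  unfolding act_def mult.assoc by (rule fc_cmult[OF test_function_mult_cutoff])

lemma act_norm_le:
  assumes f: "continuous_on UNIV f" and m: "\<And>l. 0 \<le> l \<Longrightarrow> l \<le> real n + 1 \<Longrightarrow> \<bar>f l\<bar> \<le> m"
  shows "norm (act f v n) \<le> m * norm (v n)"
  unfolding act_def
proof (rule fc_norm_le[OF test_function_mult_cutoff[OF f]])
  fix l :: real assume l: "0 \<le> l"
  have "0 \<le> m" using m[of 0] by linarith
  then show "\<bar>f l * cutoff (real n) l\<bar> \<le> m"
    using m[OF l] l mult_mono[of "\<bar>f l\<bar>" m "cutoff (real n) l" 1]
    by (cases "l \<le> real n + 1") (auto simp: abs_mult cutoff_simps)
qed

lemma act_in_D:
  assumes f: "continuous_on UNIV f"
  shows "act f v n \<in> D" "A (act f v n) = act (\<lambda>l. l * f l) v n"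
  using fc_in_D[OF test_function_mult_cutoff[OF f], of "real n" "v n"] by (auto simp: act_def mult.assoc)

text \<open>Off the spectrum the weight of the scale may be zero or negative, where its powers are
  badly behaved. W is continuous, positive and almost everywhere equal to it; \<kappa> compares W
  with 1 + l, in which the growth of multipliers is measured.\<close>

lemma weight_exists:
  obtains W \<kappa> where "continuous_on UNIV W" "\<And>l. 0 < W l" "1 \<le> \<kappa>" "\<And>l. 0 \<le> l \<Longrightarrow> 1 + l \<le> \<kappa> * W l"
    "\<And>x. AE l in \<mu> x. scale_weight D A l = W l"
proof (cases "coercive_operator D A")
  case True
  then obtain \<nu> where \<nu>: "0 < \<nu>" "\<And>x. x \<in> D \<Longrightarrow> \<nu> * (norm x)\<^sup>2 \<le> inner (A x) x"
    unfolding coercive_operator_def by blast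
  show ?thesis
  \<comment> \<open>Coercivity keeps the spectrum above \<nu>, so there l and its maximum with \<nu>
    agree.\<close>
  proof (rule that[of "max \<nu>" "1 + 1 / \<nu>"])
    show "continuous_on UNIV (max \<nu>)" by (intro continuous_intros)
    show "1 + l \<le> (1 + 1 / \<nu>) * max \<nu> l" for l
    proof -
      have "1 \<le> 1 / \<nu> * max \<nu> l" using \<nu>(1) by (simp add: field_simps)
      then show ?thesis by (simp add: distrib_right)
    qed
    show "AE l in \<mu> x. scale_weight D A l = max \<nu> l" for x
    proof -
      have "AE l in \<mu> x. \<nu> \<le> l" by (rule AE_\<mu>_ge) (rule E_eq_0_of_coercive[OF \<nu>(2)])
      then show ?thesis by eventually_elim (simp add: scale_weight_def True)
    qed
  qed (use \<nu> in auto)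
next
  case False
  show ?thesis
  proof (rule that[of "\<lambda>l. 1 + max 0 l" 1])
    show "continuous_on UNIV (\<lambda>l::real. 1 + max 0 l)" by (intro continuous_intros)
    show "AE l in \<mu> x. scale_weight D A l = 1 + max 0 l" for x
      using AE_\<mu>_nonneg[of x] by eventually_elim (simp add: scale_weight_def False)
  qed (auto simp: add_pos_nonneg)
qed

end

section \<open>Norms of the scale as quadratic forms of functions of A\<close>

locale weighted_scale = nonneg_self_adjoint D A
  for D :: "'h::{real_inner, complete_space} set" and A :: "'h \<Rightarrow> 'h" +
  fixes W :: "real \<Rightarrow> real" and \<kappa> :: real
  assumes W_continuous: "continuous_on UNIV W" and W_pos: "0 < W l"
    and \<kappa>: "1 \<le> \<kappa>" and W_ge: "0 \<le> l \<Longrightarrow> 1 + l \<le> \<kappa> * W l"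
    and AE_weight: "AE l in \<mu> x. scale_weight D A l = W l"
begin

lemma continuous_W_powr: "continuous_on UNIV (\<lambda>l. W l powr r)"
  using W_pos by (intro continuous_on_powr W_continuous continuous_on_const) (simp add: less_imp_neq[symmetric])

definition wcut :: "real \<Rightarrow> nat \<Rightarrow> real \<Rightarrow> real" where
  "wcut \<gamma> n l = W l powr (2 * \<gamma>) * cutoff (real n) l"

lemma test_function_wcut: "test_function (wcut \<gamma> n)"
  unfolding wcut_def[abs_def] by (intro test_function_mult_cutoff continuous_W_powr)

lemma wcut_nonneg: "0 \<le> wcut \<gamma> n l"
  by (simp add: wcut_def cutoff_simps)

text \<open>Once the norms are quadratic forms of test functions of A, \<open>fc_mono\<close>
  reduces their comparison to inequalities pointwise in l.\<close>

lemma nn_integral_weight: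
  assumes y: "E (real n) y = y"
  shows "(\<integral>\<^sup>+ l. ennreal (scale_weight D A l powr (2 * \<gamma>)) \<partial>\<mu> y) = ennreal (inner (fc (wcut \<gamma> n) y) y)"
proof -
  have "(\<integral>\<^sup>+ l. ennreal (scale_weight D A l powr (2 * \<gamma>)) \<partial>\<mu> y) = (\<integral>\<^sup>+ l. ennreal (wcut \<gamma> n l) \<partial>\<mu> y)"
  proof (rule nn_integral_cong_AE)
    show "AE l in \<mu> y. ennreal (scale_weight D A l powr (2 * \<gamma>)) = ennreal (wcut \<gamma> n l)"
      using AE_weight[of y] AE_\<mu>_le[OF y] by eventually_elim (simp add: wcut_def cutoff_simps)
  qed
  then show ?thesis by (simp add: nn_integral_\<mu>[OF test_function_wcut wcut_nonneg])
qed

lemma scale_norm_sq_eq: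
  assumes "v \<in> hyperdistributions E"
  shows "scale_norm_sq D A E \<gamma> v = (SUP n. ennreal (inner (fc (wcut \<gamma> n) (v n)) (v n)))"
  by (simp add: scale_norm_sq_def nn_integral_weight[OF hyper_E[OF assms order_refl]])

text \<open>Parallelogram identity for the quadratic form of each truncation, without the
  nonnegative difference term.\<close>

lemma scale_norm_sq_add:
  assumes v: "v \<in> hyperdistributions E" and w: "w \<in> hyperdistributions E"
  shows "scale_norm_sq D A E \<gamma> (\<lambda>n. v n + w n) \<le> 2 * scale_norm_sq D A E \<gamma> v + 2 * scale_norm_sq D A E \<gamma> w"
  unfolding scale_norm_sq_eq[OF hyper_add[OF v w]]
proof (rule SUP_least)
  fix n
  let ?T = "fc (wcut \<gamma> n)"
  note lin = linear_add[OF linear_fc[OF test_function_wcut]] linear_diff[OF linear_fc[OF test_function_wcut]]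
  have nn: "0 \<le> inner (?T x) x" for x by (rule fc_nonneg[OF test_function_wcut wcut_nonneg])
  have "inner (?T (v n + w n)) (v n + w n) + inner (?T (v n - w n)) (v n - w n)
      = 2 * inner (?T (v n)) (v n) + 2 * inner (?T (w n)) (w n)"
    by (simp add: lin inner_simps)
  then have "inner (?T (v n + w n)) (v n + w n) \<le> 2 * inner (?T (v n)) (v n) + 2 * inner (?T (w n)) (w n)"
    using nn[of "v n - w n"] by linarith
  then have "ennreal (inner (?T (v n + w n)) (v n + w n))
      \<le> ennreal (2 * inner (?T (v n)) (v n) + 2 * inner (?T (w n)) (w n))" by (rule ennreal_leI)
  also have "\<dots> = 2 * ennreal (inner (?T (v n)) (v n)) + 2 * ennreal (inner (?T (w n)) (w n))"
    using nn by (simp add: ennreal_plus ennreal_mult)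
  also have "\<dots> \<le> 2 * scale_norm_sq D A E \<gamma> v + 2 * scale_norm_sq D A E \<gamma> w"
    unfolding scale_norm_sq_eq[OF v] scale_norm_sq_eq[OF w]
    by (intro add_mono mult_left_mono SUP_upper) auto
  finally show "ennreal (inner (?T (v n + w n)) (v n + w n))
      \<le> 2 * scale_norm_sq D A E \<gamma> v + 2 * scale_norm_sq D A E \<gamma> w" .
qed

text \<open>The growth exponent q is paid for by the gap between \<gamma> and \<beta>. The opposite
  bound \<beta> \<le> \<gamma> + r caps the power of \<kappa>, so the constant does not depend on
  \<beta>.\<close>

lemma scale_norm_sq_act_le:
  assumes f: "continuous_on UNIV f" and v: "v \<in> hyperdistributions E" and M: "0 \<le> M" and q: "0 \<le> q"
    and le: "\<And>l. 0 \<le> l \<Longrightarrow> \<bar>f l\<bar> \<le> M * (1 + l) powr q"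
    and \<gamma>: "\<gamma> + q \<le> \<beta>" "\<beta> \<le> \<gamma> + r"
  shows "scale_norm_sq D A E \<gamma> (act f v) \<le> ennreal (M\<^sup>2 * \<kappa> powr (2 * r)) * scale_norm_sq D A E \<beta> v"
  unfolding scale_norm_sq_eq[OF act_hyper[OF f v]]
proof (rule SUP_least)
  fix n
  define y where "y = v n"
  let ?f = "\<lambda>l. f l * cutoff (real n) l"
  let ?K = "M\<^sup>2 * \<kappa> powr (2 * r)"
  have tf: "test_function ?f" by (rule test_function_mult_cutoff[OF f])
  have tw: "test_function (\<lambda>l. ?f l * wcut \<gamma> n l)" by (rule test_function_mult[OF tf test_function_wcut])
  have "inner (fc (wcut \<gamma> n) (act f v n)) (act f v n) = inner (fc (\<lambda>l. ?f l * (?f l * wcut \<gamma> n l)) y) y"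
    unfolding act_def y_def[symmetric] fc_mult[OF tf tw] fc_symmetric[OF tf, symmetric]
    by (simp add: fc_mult tf test_function_wcut fc_commute fc_symmetric)
  also have "\<dots> \<le> inner (fc (\<lambda>l. ?K * wcut \<beta> n l) y) y"
  proof (rule fc_mono[OF test_function_mult[OF tf tw] test_function_cmult[OF test_function_wcut]])
    fix l :: real assume l: "0 \<le> l"
    let ?c = "cutoff (real n) l"
    have c: "0 \<le> ?c" "?c \<le> 1" by (simp_all add: cutoff_simps)
    have "(f l)\<^sup>2 \<le> M\<^sup>2 * (1 + l) powr (2 * q)"
    proof -
      have "\<bar>f l\<bar>\<^sup>2 \<le> (M * (1 + l) powr q)\<^sup>2" by (intro power_mono le l) simp
      also have "\<dots> = M\<^sup>2 * (1 + l) powr (2 * q)"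
        by (simp add: power_mult_distrib power2_eq_square powr_add[symmetric])
      finally show ?thesis by simp
    qed
    also have "\<dots> \<le> M\<^sup>2 * (\<kappa> powr (2 * r) * W l powr (2 * (\<beta> - \<gamma>)))"
    proof (intro mult_left_mono)
      have "(1 + l) powr (2 * q) \<le> (1 + l) powr (2 * (\<beta> - \<gamma>))" using l \<gamma> by (intro powr_mono) auto
      also have "\<dots> \<le> (\<kappa> * W l) powr (2 * (\<beta> - \<gamma>))" using l \<gamma> q W_ge[OF l] by (intro powr_mono2) auto
      also have "\<dots> = \<kappa> powr (2 * (\<beta> - \<gamma>)) * W l powr (2 * (\<beta> - \<gamma>))"
        using \<kappa> W_pos[of l] by (simp add: powr_mult)
      also have "\<dots> \<le> \<kappa> powr (2 * r) * W l powr (2 * (\<beta> - \<gamma>))"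
        using \<kappa> \<gamma> by (intro mult_right_mono powr_mono) auto
      finally show "(1 + l) powr (2 * q) \<le> \<kappa> powr (2 * r) * W l powr (2 * (\<beta> - \<gamma>))" .
    qed simp
    finally have "(f l)\<^sup>2 * W l powr (2 * \<gamma>) \<le> M\<^sup>2 * (\<kappa> powr (2 * r) * W l powr (2 * (\<beta> - \<gamma>))) * W l powr (2 * \<gamma>)"
      by (rule mult_right_mono) simp
    also have "\<dots> = ?K * W l powr (2 * \<beta>)"
      by (simp add: mult.assoc powr_add[symmetric] right_diff_distrib)
    finally have 1: "(f l)\<^sup>2 * W l powr (2 * \<gamma>) \<le> ?K * W l powr (2 * \<beta>)" .
    \<comment> \<open>Two cutoffs come from the two occurrences of \<open>act\<close>, the third
      from \<open>wcut\<close>; since they lie in [0, 1], one suffices as an upper bound.\<close>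
    have "?f l * (?f l * wcut \<gamma> n l) = (f l)\<^sup>2 * W l powr (2 * \<gamma>) * (?c ^ 3)"
      by (simp add: wcut_def power2_eq_square power3_eq_cube mult_ac)
    also have "\<dots> \<le> ?K * W l powr (2 * \<beta>) * ?c"
      using c power_decreasing[of 1 3 ?c] by (intro mult_mono[OF 1]) auto
    finally show "?f l * (?f l * wcut \<gamma> n l) \<le> ?K * wcut \<beta> n l" by (simp add: wcut_def mult.assoc)
  qed
  also have "\<dots> = ?K * inner (fc (wcut \<beta> n) y) y" by (simp add: fc_cmult test_function_wcut)
  finally have "ennreal (inner (fc (wcut \<gamma> n) (act f v n)) (act f v n)) \<le> ennreal (?K * inner (fc (wcut \<beta> n) y) y)"
    by (rule ennreal_leI)
  also have "\<dots> = ennreal ?K * ennreal (inner (fc (wcut \<beta> n) y) y)"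
    by (simp add: ennreal_mult' fc_nonneg test_function_wcut wcut_nonneg)
  also have "\<dots> \<le> ennreal ?K * scale_norm_sq D A E \<beta> v"
    unfolding scale_norm_sq_eq[OF v] y_def by (intro mult_left_mono SUP_upper) auto
  finally show "ennreal (inner (fc (wcut \<gamma> n) (act f v n)) (act f v n)) \<le> ennreal ?K * scale_norm_sq D A E \<beta> v" .
qed

end

section \<open>Families of multipliers and uniqueness\<close>

lemma mean_value_le:
  fixes f :: "real \<Rightarrow> real"
  assumes f: "continuous_on {0..T} f" and st: "s \<in> {0..T}" "t \<in> {0..T}"
    and der: "\<And>r. min s t < r \<Longrightarrow> r < max s t \<Longrightarrow> \<exists>d. (f has_real_derivative d) (at r) \<and> \<bar>d\<bar> \<le> B"
  shows "\<bar>f s - f t\<bar> \<le> B * \<bar>s - t\<bar>"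
proof (cases "s = t")
  case False
  define x y where "x = min s t" and "y = max s t"
  have xy: "x < y" "x \<in> {0..T}" "y \<in> {0..T}" using st False by (auto simp: x_def y_def)
  have der': "\<exists>d. (f has_real_derivative d) (at r) \<and> \<bar>d\<bar> \<le> B" if "x < r" "r < y" for r
    using der that by (simp add: x_def y_def)
  have "\<exists>l z. x < z \<and> z < y \<and> (f has_real_derivative l) (at z) \<and> f y - f x = (y - x) * l"
  proof (rule MVT[OF xy(1)])
    show "continuous_on {x..y} f" using xy by (intro continuous_on_subset[OF f]) auto
    show "f differentiable at r" if "x < r" "r < y" for r
      using der'[OF that] real_differentiable_def by blast
  qed
  then obtain l z where z: "x < z" "z < y" "(f has_real_derivative l) (at z)" "f y - f x = (y - x) * l"
    by blast
  have "\<bar>l\<bar> \<le> B" using der'[OF z(1,2)] DERIV_unique[OF z(3)] by auto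
  then have "\<bar>f y - f x\<bar> \<le> B * \<bar>y - x\<bar>"
    unfolding z(4) abs_mult by (subst mult.commute) (rule mult_right_mono, simp_all)
  then show ?thesis by (auto simp: x_def y_def min_def max_def abs_minus_commute split: if_splits)
qed simp

lemma has_vector_derivativeI:
  fixes f :: "real \<Rightarrow> 'a::real_normed_vector"
  assumes "\<And>e. 0 < e \<Longrightarrow> \<exists>d>0. \<forall>s\<in>S. \<bar>s - t\<bar> < d \<longrightarrow> norm (f s - f t - (s - t) *\<^sub>R f') \<le> e * \<bar>s - t\<bar>"
  shows "(f has_vector_derivative f') (at t within S)"
  unfolding has_vector_derivative_def has_derivative_within_alt
  using assms by (auto intro: bounded_linear_scaleR_left)

locale growing_family =
  fixes c :: "real \<Rightarrow> real" and T m R q :: real and f f' :: "real \<Rightarrow> real \<Rightarrow> real"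
  assumes c_cont: "continuous_on {0<..T} c" and c_le: "\<And>t. t \<in> {0<..T} \<Longrightarrow> \<bar>c t\<bar> \<le> m" and T_pos: "0 < T"
    and solution: "\<And>l. 0 \<le> l \<Longrightarrow> wave_solution c T l (\<lambda>t. f t l) (\<lambda>t. f' t l)"
    and cont: "\<And>t. t \<in> {0..T} \<Longrightarrow> continuous_on UNIV (f t)" "\<And>t. t \<in> {0..T} \<Longrightarrow> continuous_on UNIV (f' t)"
    and R: "0 < R" and q: "0 \<le> q"
    and growth: "\<And>t l. t \<in> {0..T} \<Longrightarrow> 0 \<le> l \<Longrightarrow> \<bar>f t l\<bar> \<le> R * (1 + l) powr q"
      "\<And>t l. t \<in> {0..T} \<Longrightarrow> 0 \<le> l \<Longrightarrow> \<bar>f' t l\<bar> \<le> R * (1 + l) powr q"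
begin

section \<open>Time regularity of the multipliers\<close>

definition rate :: real where
  "rate = R * (1 + m)"

text \<open>A common majorant of the family and its first two time derivatives; the second, - l c f,
  costs the extra power of l.\<close>

definition maj :: "real \<Rightarrow> real" where
  "maj l = rate * (1 + l) powr (q + 1)"

lemma m_nonneg: "0 \<le> m"
  using c_le[of T] T_pos by simp

lemma rate_pos: "0 < rate"
  using R m_nonneg by (simp add: rate_def)

lemma le_maj:
  assumes l: "0 \<le> l"
  shows "R * (1 + l) powr q \<le> maj l" "m * l * (R * (1 + l) powr q) \<le> maj l"
proof -
  have maj: "maj l = ((1 + m) * (1 + l)) * (R * (1 + l) powr q)"
    using l by (simp add: maj_def rate_def powr_add)
  have nn: "0 \<le> R * (1 + l) powr q" using R by simp
  have "1 * (R * (1 + l) powr q) \<le> ((1 + m) * (1 + l)) * (R * (1 + l) powr q)"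
    using l m_nonneg by (intro mult_right_mono nn) (simp add: algebra_simps)
  then show "R * (1 + l) powr q \<le> maj l" by (simp add: maj)
  show "m * l * (R * (1 + l) powr q) \<le> maj l"
    unfolding maj using l m_nonneg by (intro mult_right_mono nn mult_mono) auto
qed

lemma cont_time:
  assumes "0 \<le> l"
  shows "continuous_on {0..T} (\<lambda>t. f t l)" "continuous_on {0..T} (\<lambda>t. f' t l)"
  using wave_solution_continuous[OF solution[OF assms]] by auto

lemma bound_maj:
  assumes "t \<in> {0..T}" "0 \<le> l"
  shows "\<bar>f t l\<bar> \<le> maj l" "\<bar>f' t l\<bar> \<le> maj l"
  using growth[OF assms] le_maj(1)[OF assms(2)] by linarith+

lemma second_derivative_le:
  assumes "r \<in> {0<..T}" "0 \<le> l"
  shows "\<bar>l * c r * f r l\<bar> \<le> maj l"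
proof -
  have "\<bar>l * c r * f r l\<bar> = (\<bar>c r\<bar> * l) * \<bar>f r l\<bar>" using assms by (simp add: abs_mult)
  also have "\<dots> \<le> (m * l) * (R * (1 + l) powr q)"
    using assms c_le[OF assms(1)] m_nonneg by (intro mult_mono growth) auto
  also have "\<dots> \<le> maj l" by (rule le_maj(2)[OF assms(2)])
  finally show ?thesis .
qed

lemma lipschitz:
  assumes st: "s \<in> {0..T}" "t \<in> {0..T}" and l: "0 \<le> l"
  shows "\<bar>f s l - f t l\<bar> \<le> maj l * \<bar>s - t\<bar>" "\<bar>f' s l - f' t l\<bar> \<le> maj l * \<bar>s - t\<bar>"
proof -
  show "\<bar>f s l - f t l\<bar> \<le> maj l * \<bar>s - t\<bar>"
  proof (rule mean_value_le[OF cont_time(1)[OF l] st])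
    fix r assume "min s t < r" "r < max s t"
    then have r: "0 < r" "r < T" using st by auto
    show "\<exists>d. ((\<lambda>s. f s l) has_real_derivative d) (at r) \<and> \<bar>d\<bar> \<le> maj l"
      using wave_solution_derivative(1)[OF solution[OF l] r] bound_maj(2)[of r l] r l by auto
  qed
  show "\<bar>f' s l - f' t l\<bar> \<le> maj l * \<bar>s - t\<bar>"
  proof (rule mean_value_le[OF cont_time(2)[OF l] st])
    fix r assume "min s t < r" "r < max s t"
    then have r: "0 < r" "r < T" using st by auto
    have "\<bar>- (l * c r * f r l)\<bar> \<le> maj l" using second_derivative_le[of r l] r l by simp
    then show "\<exists>d. ((\<lambda>s. f' s l) has_real_derivative d) (at r) \<and> \<bar>d\<bar> \<le> maj l"
      using wave_solution_derivative(2)[OF solution[OF l] r] by blast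
  qed
qed

text \<open>Mean value theorem for r \<mapsto> f r l - r f' t l, whose derivative is small by the
  Lipschitz bound of f'.\<close>

lemma taylor:
  assumes st: "s \<in> {0..T}" "t \<in> {0..T}" and l: "0 \<le> l"
  shows "\<bar>f s l - f t l - (s - t) * f' t l\<bar> \<le> maj l * \<bar>s - t\<bar> * \<bar>s - t\<bar>"
proof -
  let ?h = "\<lambda>r. f r l - r * f' t l"
  have "\<bar>?h s - ?h t\<bar> \<le> maj l * \<bar>s - t\<bar> * \<bar>s - t\<bar>"
  proof (rule mean_value_le[OF _ st])
    show "continuous_on {0..T} ?h" by (intro continuous_intros cont_time l)
    fix r assume rst: "min s t < r" "r < max s t"
    then have r: "0 < r" "r < T" using st by auto
    have "(?h has_real_derivative f' r l - f' t l) (at r)"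
      using wave_solution_derivative(1)[OF solution[OF l] r] by (auto intro!: derivative_eq_intros)
    moreover have "\<bar>f' r l - f' t l\<bar> \<le> maj l * \<bar>s - t\<bar>"
    proof (rule order_trans[OF lipschitz(2)])
      have "0 \<le> maj l" using bound_maj(1)[OF st(1) l] by linarith
      then show "maj l * \<bar>r - t\<bar> \<le> maj l * \<bar>s - t\<bar>" using rst by (intro mult_left_mono) auto
    qed (use r st l in auto)
    ultimately show "\<exists>d. (?h has_real_derivative d) (at r) \<and> \<bar>d\<bar> \<le> maj l * \<bar>s - t\<bar>" by blast
  qed
  then show ?thesis by (simp add: algebra_simps)
qed

text \<open>Only continuity of c at t > 0 enters, so there is no rate in s - t. Uniformity for l in
  [0, N] is enough because a truncation sees a bounded part of the spectrum.\<close>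

lemma taylor':
  assumes t: "t \<in> {0<..T}" and e: "0 < e" and N: "0 \<le> N"
  shows "\<exists>d>0. \<forall>s\<in>{0..T}. \<bar>s - t\<bar> < d \<longrightarrow> (\<forall>l. 0 \<le> l \<longrightarrow> l \<le> N \<longrightarrow>
    \<bar>f' s l - f' t l - (s - t) * (- c t * (l * f t l))\<bar> \<le> e * \<bar>s - t\<bar>)"
proof -
  define B where "B = maj N"
  have B: "maj l \<le> B" if "0 \<le> l" "l \<le> N" for l
    unfolding B_def maj_def using that rate_pos q by (intro mult_left_mono powr_mono2) auto
  have B0: "0 \<le> B" using rate_pos by (simp add: B_def maj_def)
  \<comment> \<open>Below, \<open>e'\<close> bounds both |c r - c t| and |r - t|; the total error is
    then at most \<open>e' * (N * B * (1 + m))\<close>.\<close>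
  define e' where "e' = e / (N * B * (1 + m) + 1)"
  have pos: "0 < N * B * (1 + m) + 1" using N B0 m_nonneg by (simp add: add_nonneg_pos)
  have e': "0 < e'" using e pos by (simp add: e'_def)
  obtain d where d: "0 < d" "\<And>r. r \<in> {0<..T} \<Longrightarrow> \<bar>r - t\<bar> < d \<Longrightarrow> \<bar>c r - c t\<bar> < e'"
    using c_cont t e' unfolding continuous_on_iff dist_real_def by meson
  have "\<bar>f' s l - f' t l - (s - t) * (- c t * (l * f t l))\<bar> \<le> e * \<bar>s - t\<bar>"
    if s: "s \<in> {0..T}" "\<bar>s - t\<bar> < min d e'" and l: "0 \<le> l" "l \<le> N" for s l
  proof -
    let ?h = "\<lambda>r. f' r l - r * (- c t * (l * f t l))"
    have t0: "t \<in> {0..T}" using t by auto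
    have "\<bar>?h s - ?h t\<bar> \<le> e * \<bar>s - t\<bar>"
    proof (rule mean_value_le[OF _ s(1) t0])
      show "continuous_on {0..T} ?h" by (intro continuous_intros cont_time l)
      fix r assume rst: "min s t < r" "r < max s t"
      then have r: "0 < r" "r < T" "r \<in> {0..T}" "r \<in> {0<..T}" using s t by auto
      have rt: "\<bar>r - t\<bar> < d" "\<bar>r - t\<bar> < e'" using rst s(2) by auto
      let ?d = "- (l * c r * f r l) - - c t * (l * f t l)"
      have "(?h has_real_derivative ?d) (at r)"
        using wave_solution_derivative(2)[OF solution[OF l(1)] r(1,2)]
        by (auto intro!: derivative_eq_intros)
      moreover have "\<bar>?d\<bar> \<le> e"
      proof -
        have "?d = - (l * ((c r - c t) * f r l + c t * (f r l - f t l)))" by (simp add: algebra_simps)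
        then have "\<bar>?d\<bar> = l * \<bar>(c r - c t) * f r l + c t * (f r l - f t l)\<bar>" using l by (simp add: abs_mult)
        also have "\<dots> \<le> N * (e' * B + m * (B * e'))"
        proof (rule mult_mono[OF l(2)])
          have "\<bar>(c r - c t) * f r l\<bar> \<le> e' * B"
            unfolding abs_mult using d(2)[OF r(4) rt(1)] bound_maj(1)[OF r(3) l(1)] B[OF l] e'
            by (intro mult_mono) auto
          moreover have "\<bar>c t * (f r l - f t l)\<bar> \<le> m * (B * e')"
            unfolding abs_mult
          proof (intro mult_mono c_le t m_nonneg)
            have "\<bar>f r l - f t l\<bar> \<le> maj l * \<bar>r - t\<bar>" by (rule lipschitz(1)[OF r(3) t0 l(1)])
            also have "\<dots> \<le> B * e'" using B[OF l] B0 rt by (intro mult_mono) auto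
            finally show "\<bar>f r l - f t l\<bar> \<le> B * e'" .
          qed auto
          ultimately show "\<bar>(c r - c t) * f r l + c t * (f r l - f t l)\<bar> \<le> e' * B + m * (B * e')" by linarith
        qed (use N in auto)
        also have "\<dots> = e' * (N * B * (1 + m))" by (simp add: algebra_simps)
        also have "\<dots> \<le> e" unfolding e'_def
          by (rule less_imp_le[OF divide_add_one_mult_less[OF e]]) (use N B0 m_nonneg in simp)
        finally show ?thesis .
      qed
      ultimately show "\<exists>d. (?h has_real_derivative d) (at r) \<and> \<bar>d\<bar> \<le> e" by blast
    qed
    then show ?thesis by (simp add: algebra_simps)
  qed
  then show ?thesis using d(1) e' by (intro exI[of _ "min d e'"]) auto
qed

end

context nonneg_self_adjoint
begin

section \<open>Uniqueness of very weak solutions\<close>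

lemma hyper_diff:
  "v \<in> hyperdistributions E \<Longrightarrow> w \<in> hyperdistributions E \<Longrightarrow> (\<lambda>n. v n - w n) \<in> hyperdistributions E"
  by (simp add: hyperdistributions_def linear_diff[OF linear_E])

lemma hyper_scaleR: "v \<in> hyperdistributions E \<Longrightarrow> (\<lambda>n. r *\<^sub>R v n) \<in> hyperdistributions E"
  by (simp add: hyperdistributions_def linear_scale[OF linear_E])

text \<open>On the n-th truncation A is bounded by n + 1, so Gronwall's inequality applies to the
  sum of the squared norms of the difference and of its derivative. The constant depends on n, but
  the initial value is 0.\<close>

lemma very_weak_solution_unique:
  assumes v: "very_weak_solution A E c T u0 u1 v v'" and w: "very_weak_solution A E c T u0 u1 w w'"
    and m: "\<And>t. t \<in> {0<..T} \<Longrightarrow> \<bar>c t\<bar> \<le> m" "0 \<le> m" and t: "t \<in> {0..T}"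
  shows "v t = w t \<and> v' t = w' t"
proof -
  have "v t n = w t n \<and> v' t n = w' t n" for n
  proof -
    define z where "z s = v s n - w s n" for s
    define z' where "z' s = v' s n - w' s n" for s
    have E: "E (real n) (v s n) = v s n" "E (real n) (w s n) = w s n" if "s \<in> {0..T}" for s
      using v w that by (auto simp: very_weak_solution_def hyper_E)
    have z: "(z has_vector_derivative z' s) (at s within {0..T})" if "s \<in> {0..T}" for s
      unfolding z_def[abs_def] z'_def using v w that
      by (intro has_vector_derivative_diff) (auto simp: very_weak_solution_def)
    have Az: "norm (A (z s)) \<le> (real n + 1) * norm (z s)" "A (v s n) - A (w s n) = A (z s)" if "s \<in> {0..T}" for s
      using bounded_A_on_range[of n "z s"] bounded_A_on_range[of n "v s n"] bounded_A_on_range[of n "w s n"] E[OF that]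
      by (simp_all add: z_def A_diff linear_diff[OF linear_E])
    have z': "(z' has_vector_derivative - (c s *\<^sub>R A (z s))) (at s within {0..T})" if "s \<in> {0<..T}" for s
    proof -
      have "(z' has_vector_derivative - (c s *\<^sub>R A (v s n)) - - (c s *\<^sub>R A (w s n))) (at s within {0..T})"
        unfolding z'_def[abs_def] using v w that
        by (intro has_vector_derivative_diff) (auto simp: very_weak_solution_def)
      moreover have "- (c s *\<^sub>R A (v s n)) - - (c s *\<^sub>R A (w s n)) = - (c s *\<^sub>R (A (v s n) - A (w s n)))"
        by (simp add: scaleR_diff_right)
      ultimately show ?thesis using that Az(2)[of s] by simp
    qed
    have cz': "continuous_on {0..T} z'"
      unfolding z'_def[abs_def] using v w by (intro continuous_on_diff) (auto simp: very_weak_solution_def)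
    have cz: "continuous_on {0..T} z"
      using z by (intro continuous_on_vector_derivative) auto
    define h where "h s = inner (z s) (z s) + inner (z' s) (z' s)" for s
    let ?K = "1 + m * (real n + 1)"
    have "h t \<le> exp (?K * t - ?K * 0) * h 0"
    proof (rule gronwall[where e = h and k = "\<lambda>t. ?K * t"])
      show "0 \<le> t" using t by simp
      show "continuous_on {0..t} h" unfolding h_def[abs_def]
        using t by (intro continuous_intros continuous_on_subset[OF cz] continuous_on_subset[OF cz']) auto
      show "continuous_on {0..t} (\<lambda>t. ?K * t)" by (intro continuous_intros)
      fix s assume s: "0 < s" "s < t"
      have s': "s \<in> {0..T}" "s \<in> {0<..T}" "at s within {0..T} = at s"
        using s t at_within_Icc_at[of 0 s T] by auto
      have d: "(z has_vector_derivative z' s) (at s)" "(z' has_vector_derivative - (c s *\<^sub>R A (z s))) (at s)"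
        using z[OF s'(1)] z'[OF s'(2)] s'(3) by auto
      let ?e = "2 * inner (z s) (z' s) + 2 * inner (z' s) (- (c s *\<^sub>R A (z s)))"
      have "(h has_vector_derivative ?e) (at s)"
        using has_vector_derivative_add[OF
            bounded_bilinear.has_vector_derivative[OF bounded_bilinear_inner d(1) d(1)]
            bounded_bilinear.has_vector_derivative[OF bounded_bilinear_inner d(2) d(2)]]
        by (simp add: h_def[abs_def] inner_commute)
      then have "(h has_real_derivative ?e) (at s)" by (simp add: has_real_derivative_iff_has_vector_derivative)
      moreover have "((\<lambda>t. ?K * t) has_real_derivative ?K) (at s)" by (auto intro!: derivative_eq_intros)
      moreover have "?e \<le> ?K * h s"
      proof -
        define x y where "x = norm (z s)" and "y = norm (z' s)"
        have h: "h s = x\<^sup>2 + y\<^sup>2" by (simp add: h_def x_def y_def power2_norm_eq_inner)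
        have xy: "2 * (x * y) \<le> h s" using sum_squares_bound[of x y] by (simp add: h mult.assoc)
        have 1: "inner (z s) (z' s) \<le> x * y" unfolding x_def y_def by (rule norm_cauchy_schwarz)
        have "inner (z' s) (- (c s *\<^sub>R A (z s))) \<le> y * norm (- (c s *\<^sub>R A (z s)))"
          unfolding y_def by (rule norm_cauchy_schwarz)
        also have "\<dots> \<le> y * (m * ((real n + 1) * x))"
          using m(1)[OF s'(2)] m(2) Az(1)[OF s'(1)]
          by (intro mult_left_mono) (auto simp: x_def y_def intro!: mult_mono)
        also have "\<dots> = (m * (real n + 1)) * (x * y)" by (simp add: mult_ac)
        finally have "?e \<le> 2 * (x * y) + (m * (real n + 1)) * (2 * (x * y))" using 1 by linarith
        also have "\<dots> \<le> h s + (m * (real n + 1)) * h s"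
          using xy m(2) by (intro add_mono mult_left_mono) auto
        finally show ?thesis by (simp add: distrib_right)
      qed
      ultimately show "\<exists>e' k'. (h has_real_derivative e') (at s) \<and>
          ((\<lambda>t. ?K * t) has_real_derivative k') (at s) \<and> e' \<le> k' * h s" by blast
    qed
    moreover have "h 0 = 0" using v w by (simp add: h_def z_def z'_def very_weak_solution_def)
    ultimately have "h t \<le> 0" by simp
    then have "inner (z t) (z t) = 0 \<and> inner (z' t) (z' t) = 0"
      using inner_ge_zero[of "z t"] inner_ge_zero[of "z' t"] unfolding h_def by linarith
    then show ?thesis by (simp add: z_def z'_def)
  qed
  then show ?thesis by (simp add: fun_eq_iff)
qed

end

section \<open>Multiplier families acting on hyperdistributions\<close>

locale family_action = weighted_scale D A W \<kappa> + growing_family c T m R q f f'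
  for D :: "'h::{real_inner, complete_space} set" and A :: "'h \<Rightarrow> 'h" and W \<kappa> c T m R q f f'
begin

lemma act_derivative:
  assumes t: "t \<in> {0..T}"
  shows "((\<lambda>s. act (f s) v n) has_vector_derivative act (f' t) v n) (at t within {0..T})"
proof (rule has_vector_derivativeI)
  fix e :: real assume e: "0 < e"
  define B where "B = maj (real n + 1) * norm (v n)"
  have B: "0 \<le> B" using rate_pos by (simp add: B_def maj_def)
  have le: "norm (act (f s) v n - act (f t) v n - (s - t) *\<^sub>R act (f' t) v n) \<le> B * \<bar>s - t\<bar> * \<bar>s - t\<bar>"
    if s: "s \<in> {0..T}" for s
  proof -
    have c: "continuous_on UNIV (\<lambda>l. f s l - f t l)" "continuous_on UNIV (\<lambda>l. (s - t) * f' t l)"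
      by (intro continuous_intros cont s t)+
    have "act (f s) v n - act (f t) v n - (s - t) *\<^sub>R act (f' t) v n = act (\<lambda>l. f s l - f t l - (s - t) * f' t l) v n"
      by (simp add: act_diff[OF c] act_diff[OF cont(1)[OF s] cont(1)[OF t]] act_cmult[OF cont(2)[OF t]])
    also have "norm \<dots> \<le> (maj (real n + 1) * \<bar>s - t\<bar> * \<bar>s - t\<bar>) * norm (v n)"
    proof (rule act_norm_le[OF continuous_on_diff[OF c]])
      fix l :: real assume l: "0 \<le> l" "l \<le> real n + 1"
      have "maj l \<le> maj (real n + 1)"
        unfolding maj_def using l rate_pos q by (intro mult_left_mono powr_mono2) auto
      then have "maj l * \<bar>s - t\<bar> * \<bar>s - t\<bar> \<le> maj (real n + 1) * \<bar>s - t\<bar> * \<bar>s - t\<bar>"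
        by (intro mult_right_mono) auto
      with taylor[OF s t l(1)] show "\<bar>f s l - f t l - (s - t) * f' t l\<bar> \<le> maj (real n + 1) * \<bar>s - t\<bar> * \<bar>s - t\<bar>"
        by linarith
    qed
    finally show ?thesis by (simp add: B_def mult_ac)
  qed
  have "norm (act (f s) v n - act (f t) v n - (s - t) *\<^sub>R act (f' t) v n) \<le> e * \<bar>s - t\<bar>"
    if s: "s \<in> {0..T}" "\<bar>s - t\<bar> < e / (B + 1)" for s
  proof -
    have "B * \<bar>s - t\<bar> \<le> e / (B + 1) * B" using s(2) B by (subst mult.commute) (intro mult_right_mono, auto)
    also have "\<dots> \<le> e" by (rule less_imp_le[OF divide_add_one_mult_less[OF e B]])
    finally have "B * \<bar>s - t\<bar> * \<bar>s - t\<bar> \<le> e * \<bar>s - t\<bar>" by (intro mult_right_mono) auto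
    with le[OF s(1)] show ?thesis by linarith
  qed
  then show "\<exists>d>0. \<forall>s\<in>{0..T}. \<bar>s - t\<bar> < d \<longrightarrow>
      norm (act (f s) v n - act (f t) v n - (s - t) *\<^sub>R act (f' t) v n) \<le> e * \<bar>s - t\<bar>"
    using e B by (intro exI[of _ "e / (B + 1)"]) auto
qed

lemma act_derivative':
  assumes t: "t \<in> {0<..T}"
  shows "((\<lambda>s. act (f' s) v n) has_vector_derivative - (c t *\<^sub>R A (act (f t) v n))) (at t within {0..T})"
proof (rule has_vector_derivativeI)
  fix e :: real assume e: "0 < e"
  have t0: "t \<in> {0..T}" using t by auto
  obtain d where d: "0 < d" "\<And>s l. s \<in> {0..T} \<Longrightarrow> \<bar>s - t\<bar> < d \<Longrightarrow> 0 \<le> l \<Longrightarrow> l \<le> real n + 1 \<Longrightarrow>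
    \<bar>f' s l - f' t l - (s - t) * (- c t * (l * f t l))\<bar> \<le> e / (norm (v n) + 1) * \<bar>s - t\<bar>"
    using taylor'[OF t, of "e / (norm (v n) + 1)" "real n + 1"] e by (auto simp: add_nonneg_pos)
  have "norm (act (f' s) v n - act (f' t) v n - (s - t) *\<^sub>R (- (c t *\<^sub>R A (act (f t) v n)))) \<le> e * \<bar>s - t\<bar>"
    if s: "s \<in> {0..T}" "\<bar>s - t\<bar> < d" for s
  proof -
    have c: "continuous_on UNIV (\<lambda>l. f' s l - f' t l)" "continuous_on UNIV (\<lambda>l. l * f t l)"
      "continuous_on UNIV (\<lambda>l. - c t * (l * f t l))" "continuous_on UNIV (\<lambda>l. (s - t) * (- c t * (l * f t l)))"
      by (intro continuous_intros cont s t0)+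
    have "act (f' s) v n - act (f' t) v n - (s - t) *\<^sub>R (- (c t *\<^sub>R A (act (f t) v n)))
       = act (\<lambda>l. f' s l - f' t l - (s - t) * (- c t * (l * f t l))) v n"
      unfolding act_diff[OF c(1) c(4)] act_cmult[OF c(3)] act_cmult[OF c(2)]
        act_diff[OF cont(2)[OF s(1)] cont(2)[OF t0]] act_in_D(2)[OF cont(1)[OF t0]] by simp
    also have "norm \<dots> \<le> (e / (norm (v n) + 1) * \<bar>s - t\<bar>) * norm (v n)"
      by (rule act_norm_le[OF continuous_on_diff[OF c(1) c(4)]]) (rule d(2)[OF s])
    also have "\<dots> = (e / (norm (v n) + 1) * norm (v n)) * \<bar>s - t\<bar>" by simp
    also have "\<dots> \<le> e * \<bar>s - t\<bar>"
      by (intro mult_right_mono less_imp_le[OF divide_add_one_mult_less[OF e]]) auto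
    finally show ?thesis .
  qed
  with d(1) show "\<exists>d>0. \<forall>s\<in>{0..T}. \<bar>s - t\<bar> < d \<longrightarrow>
      norm (act (f' s) v n - act (f' t) v n - (s - t) *\<^sub>R (- (c t *\<^sub>R A (act (f t) v n)))) \<le> e * \<bar>s - t\<bar>" by blast
qed

lemma act_continuous': "continuous_on {0..T} (\<lambda>t. act (f' t) v n)"
proof -
  define B where "B = maj (real n + 1) * norm (v n)"
  have B: "0 \<le> B" using rate_pos by (simp add: B_def maj_def)
  have "B-lipschitz_on {0..T} (\<lambda>t. act (f' t) v n)"
  proof (rule lipschitz_onI[OF _ B])
    fix s t assume s: "s \<in> {0..T}" and t: "t \<in> {0..T}"
    have "act (f' s) v n - act (f' t) v n = act (\<lambda>l. f' s l - f' t l) v n"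
      by (simp add: act_diff[OF cont(2)[OF s] cont(2)[OF t]])
    also have "norm \<dots> \<le> (maj (real n + 1) * \<bar>s - t\<bar>) * norm (v n)"
    proof (rule act_norm_le[OF continuous_on_diff[OF cont(2)[OF s] cont(2)[OF t]]])
      fix l :: real assume l: "0 \<le> l" "l \<le> real n + 1"
      have "maj l \<le> maj (real n + 1)"
        unfolding maj_def using l rate_pos q by (intro mult_left_mono powr_mono2) auto
      then have "maj l * \<bar>s - t\<bar> \<le> maj (real n + 1) * \<bar>s - t\<bar>" by (intro mult_right_mono) auto
      with lipschitz(2)[OF s t l(1)] show "\<bar>f' s l - f' t l\<bar> \<le> maj (real n + 1) * \<bar>s - t\<bar>" by linarith
    qed
    finally show "dist (act (f' s) v n) (act (f' t) v n) \<le> B * dist s t"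
      by (simp add: B_def dist_norm mult_ac)
  qed
  then show ?thesis by (rule lipschitz_on_continuous_on)
qed

context
  fixes v :: "nat \<Rightarrow> 'h" and \<gamma> \<beta> r :: real
  assumes v: "v \<in> hyperdistributions E" and \<gamma>: "\<gamma> + (q + 1) \<le> \<beta>" "\<beta> \<le> \<gamma> + r"
begin

text \<open>One estimate for three uses: M = 1 for the size of the family, M = |s - t| for its
  increments and for the error of its difference quotients.\<close>

lemma scale_norm_sq_family_le:
  assumes g: "continuous_on UNIV g" and M: "0 \<le> M" and le: "\<And>l. 0 \<le> l \<Longrightarrow> \<bar>g l\<bar> \<le> M * maj l"
  shows "scale_norm_sq D A E \<gamma> (act g v) \<le> ennreal ((M * rate)\<^sup>2 * \<kappa> powr (2 * r)) * scale_norm_sq D A E \<beta> v"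
  by (rule scale_norm_sq_act_le[OF g v _ _ _ \<gamma>]) (use M rate_pos q le in \<open>auto simp: maj_def mult.assoc\<close>)

lemma scale_norm_sq_f:
  assumes t: "t \<in> {0..T}"
  shows "scale_norm_sq D A E \<gamma> (act (f t) v) \<le> ennreal (rate\<^sup>2 * \<kappa> powr (2 * r)) * scale_norm_sq D A E \<beta> v"
    and "scale_norm_sq D A E \<gamma> (act (f' t) v) \<le> ennreal (rate\<^sup>2 * \<kappa> powr (2 * r)) * scale_norm_sq D A E \<beta> v"
  using scale_norm_sq_family_le[OF cont(1)[OF t], of 1] scale_norm_sq_family_le[OF cont(2)[OF t], of 1]
    bound_maj[OF t] by simp_all

lemma scale_norm_sq_f_diff:
  assumes s: "s \<in> {0..T}" and t: "t \<in> {0..T}"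
  shows "scale_norm_sq D A E \<gamma> (\<lambda>n. act (f s) v n - act (f t) v n)
      \<le> ennreal ((\<bar>s - t\<bar> * rate)\<^sup>2 * \<kappa> powr (2 * r)) * scale_norm_sq D A E \<beta> v"
    and "scale_norm_sq D A E \<gamma> (\<lambda>n. act (f' s) v n - act (f' t) v n)
      \<le> ennreal ((\<bar>s - t\<bar> * rate)\<^sup>2 * \<kappa> powr (2 * r)) * scale_norm_sq D A E \<beta> v"
proof -
  have "(\<lambda>n. act (f s) v n - act (f t) v n) = act (\<lambda>l. f s l - f t l) v"
    "(\<lambda>n. act (f' s) v n - act (f' t) v n) = act (\<lambda>l. f' s l - f' t l) v"
    by (simp_all add: fun_eq_iff act_diff[OF cont(1)[OF s] cont(1)[OF t]] act_diff[OF cont(2)[OF s] cont(2)[OF t]])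
  then show "scale_norm_sq D A E \<gamma> (\<lambda>n. act (f s) v n - act (f t) v n)
      \<le> ennreal ((\<bar>s - t\<bar> * rate)\<^sup>2 * \<kappa> powr (2 * r)) * scale_norm_sq D A E \<beta> v"
    "scale_norm_sq D A E \<gamma> (\<lambda>n. act (f' s) v n - act (f' t) v n)
      \<le> ennreal ((\<bar>s - t\<bar> * rate)\<^sup>2 * \<kappa> powr (2 * r)) * scale_norm_sq D A E \<beta> v"
    using lipschitz[OF s t]
    by (simp_all only:)
      (rule scale_norm_sq_family_le; auto intro!: continuous_on_diff cont s t simp: mult.commute)+
qed

lemma scale_norm_sq_f_quotient:
  assumes s: "s \<in> {0..T}" and t: "t \<in> {0..T}" and st: "s \<noteq> t"
  shows "scale_norm_sq D A E \<gamma> (\<lambda>n. (1 / (s - t)) *\<^sub>R (act (f s) v n - act (f t) v n) - act (f' t) v n)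
      \<le> ennreal ((\<bar>s - t\<bar> * rate)\<^sup>2 * \<kappa> powr (2 * r)) * scale_norm_sq D A E \<beta> v"
proof -
  let ?g = "\<lambda>l. 1 / (s - t) * (f s l - f t l) - f' t l"
  have c: "continuous_on UNIV (\<lambda>l. f s l - f t l)" "continuous_on UNIV (\<lambda>l. 1 / (s - t) * (f s l - f t l))"
    by (intro continuous_on_diff continuous_on_mult_left cont s t)+
  have "(\<lambda>n. (1 / (s - t)) *\<^sub>R (act (f s) v n - act (f t) v n) - act (f' t) v n) = act ?g v"
    unfolding fun_eq_iff act_diff[OF c(2) cont(2)[OF t]] act_cmult[OF c(1)]
      act_diff[OF cont(1)[OF s] cont(1)[OF t]] by simp
  moreover have "scale_norm_sq D A E \<gamma> (act ?g v)
      \<le> ennreal ((\<bar>s - t\<bar> * rate)\<^sup>2 * \<kappa> powr (2 * r)) * scale_norm_sq D A E \<beta> v"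
  proof (rule scale_norm_sq_family_le)
    show "continuous_on UNIV ?g" by (intro continuous_on_diff c(2) cont t)
    fix l :: real assume l: "0 \<le> l"
    have "?g l = (f s l - f t l - (s - t) * f' t l) / (s - t)" using st by (simp add: field_simps)
    also have "\<bar>\<dots>\<bar> \<le> (maj l * \<bar>s - t\<bar> * \<bar>s - t\<bar>) / \<bar>s - t\<bar>"
      unfolding abs_divide by (intro divide_right_mono taylor[OF s t l]) simp
    also have "\<dots> = \<bar>s - t\<bar> * maj l" using st by simp
    finally show "\<bar>?g l\<bar> \<le> \<bar>s - t\<bar> * maj l" .
  qed simp
  ultimately show ?thesis by simp
qed

end

end

lemma tendsto_0_of_le_square:
  fixes F :: "real \<Rightarrow> ennreal"
  assumes S: "S < \<infinity>" and k: "0 \<le> k"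
    and le: "\<And>s. s \<in> I \<Longrightarrow> s \<noteq> t \<Longrightarrow> F s \<le> ennreal ((\<bar>s - t\<bar> * a)\<^sup>2 * k) * S"
  shows "(F \<longlongrightarrow> 0) (at t within I)"
proof -
  obtain S' where S': "S = ennreal S'" "0 \<le> S'" using S by (cases S) auto
  show ?thesis
  proof (rule tendsto_sandwich[where f = "\<lambda>_. 0" and h = "\<lambda>s. ennreal ((\<bar>s - t\<bar> * a)\<^sup>2 * k * S')"])
    have "((\<lambda>s. (\<bar>s - t\<bar> * a)\<^sup>2 * k * S') \<longlongrightarrow> (\<bar>t - t\<bar> * a)\<^sup>2 * k * S') (at t within I)"
      by (intro tendsto_intros)
    then have "((\<lambda>s. ennreal ((\<bar>s - t\<bar> * a)\<^sup>2 * k * S')) \<longlongrightarrow> ennreal ((\<bar>t - t\<bar> * a)\<^sup>2 * k * S')) (at t within I)"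
      by (rule tendsto_ennrealI)
    then show "((\<lambda>s. ennreal ((\<bar>s - t\<bar> * a)\<^sup>2 * k * S')) \<longlongrightarrow> 0) (at t within I)" by simp
    show "\<forall>\<^sub>F s in at t within I. F s \<le> ennreal ((\<bar>s - t\<bar> * a)\<^sup>2 * k * S')"
      unfolding eventually_at_filter
    proof (intro always_eventually allI impI)
      fix s assume "s \<noteq> t" "s \<in> I"
      from le[OF this(2,1)] show "F s \<le> ennreal ((\<bar>s - t\<bar> * a)\<^sup>2 * k * S')"
        using k S' by (simp add: ennreal_mult)
    qed
  qed auto
qed

section \<open>Well-posedness\<close>

text \<open>The scalar solutions a and b have initial data (1, 0) and (0, 1); acting as multipliers
  they propagate \<open>u0\<close> and \<open>u1\<close>.\<close>

locale fundamental_system =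
  a: family_action D A W \<kappa> c T m R q a a' + b: family_action D A W \<kappa> c T m R q b b'
  for D :: "'h::{real_inner, complete_space} set" and A :: "'h \<Rightarrow> 'h" and W \<kappa> c T m R q a a' b b' +
  assumes initial: "a 0 l = 1" "a' 0 l = 0" "b 0 l = 0" "b' 0 l = 1"
begin

abbreviation "act \<equiv> a.act"
abbreviation "E \<equiv> a.E"
abbreviation "K \<equiv> a.rate\<^sup>2 * \<kappa> powr (2 * (q + 2))"

context
  fixes u0 u1 :: "nat \<Rightarrow> 'h" and \<gamma> \<beta> :: real
  assumes u0: "u0 \<in> scale_space D A E (\<beta> + 1 / 2)" and u1: "u1 \<in> scale_space D A E \<beta>"
begin

definition u :: "real \<Rightarrow> nat \<Rightarrow> 'h" where
  "u t n = act (a t) u0 n + act (b t) u1 n"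

definition u' :: "real \<Rightarrow> nat \<Rightarrow> 'h" where
  "u' t n = act (a' t) u0 n + act (b' t) u1 n"

definition data :: ennreal where
  "data = scale_norm_sq D A E \<beta> u1 + scale_norm_sq D A E (\<beta> + 1 / 2) u0"

lemma hyper: "u0 \<in> hyperdistributions E" "u1 \<in> hyperdistributions E"
  using u0 u1 by (auto simp: scale_space_def)

lemma data_finite: "data < \<infinity>"
  using u0 u1 by (simp add: scale_space_def data_def less_top)

lemma hyper_u:
  assumes "t \<in> {0..T}"
  shows "u t \<in> hyperdistributions E" "u' t \<in> hyperdistributions E"
  unfolding u_def[abs_def] u'_def[abs_def]
  by (intro a.hyper_add a.act_hyper a.cont b.cont assms hyper)+

lemma u_solution: "very_weak_solution A E c T u0 u1 u u'"
  unfolding very_weak_solution_def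
proof (intro conjI allI ballI)
  fix n t
  show "t \<in> {0..T} \<Longrightarrow> u t \<in> hyperdistributions E" "t \<in> {0..T} \<Longrightarrow> u' t \<in> hyperdistributions E"
    by (rule hyper_u, assumption)+
  show "t \<in> {0..T} \<Longrightarrow> ((\<lambda>s. u s n) has_vector_derivative u' t n) (at t within {0..T})"
    unfolding u_def u'_def by (intro has_vector_derivative_add a.act_derivative b.act_derivative)
  show "continuous_on {0..T} (\<lambda>t. u' t n)"
    unfolding u'_def by (intro continuous_on_add a.act_continuous' b.act_continuous')
  assume t: "t \<in> {0<..T}"
  then have t0: "t \<in> {0..T}" by auto
  have "((\<lambda>s. u' s n) has_vector_derivative - (c t *\<^sub>R A (act (a t) u0 n)) + - (c t *\<^sub>R A (act (b t) u1 n)))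
      (at t within {0..T})"
    unfolding u'_def by (intro has_vector_derivative_add a.act_derivative' b.act_derivative' t)
  moreover have "A (u t n) = A (act (a t) u0 n) + A (act (b t) u1 n)"
    unfolding u_def by (intro a.A_add a.act_in_D(1) a.cont b.cont t0)
  ultimately show "((\<lambda>s. u' s n) has_vector_derivative - (c t *\<^sub>R A (u t n))) (at t within {0..T})"
    by (simp add: scaleR_add_right)
next
  have "a 0 = (\<lambda>l. 1)" "a' 0 = (\<lambda>l. 0)" "b 0 = (\<lambda>l. 0)" "b' 0 = (\<lambda>l. 1)" by (simp_all add: fun_eq_iff initial)
  then show "u 0 = u0" "u' 0 = u1"
    unfolding u_def[abs_def] u'_def[abs_def] by (simp_all add: a.act_one a.act_zero hyper)
qed

lemma combine:
  assumes v: "v \<in> hyperdistributions E" and w: "w \<in> hyperdistributions E" and k: "0 \<le> k"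
    and le: "scale_norm_sq D A E \<gamma> v \<le> ennreal k * scale_norm_sq D A E (\<beta> + 1 / 2) u0"
      "scale_norm_sq D A E \<gamma> w \<le> ennreal k * scale_norm_sq D A E \<beta> u1"
  shows "scale_norm_sq D A E \<gamma> (\<lambda>n. v n + w n) \<le> ennreal (2 * k) * data"
proof -
  have "scale_norm_sq D A E \<gamma> (\<lambda>n. v n + w n) \<le> 2 * scale_norm_sq D A E \<gamma> v + 2 * scale_norm_sq D A E \<gamma> w"
    by (rule a.scale_norm_sq_add[OF v w])
  also have "\<dots> \<le> 2 * (ennreal k * scale_norm_sq D A E (\<beta> + 1 / 2) u0) + 2 * (ennreal k * scale_norm_sq D A E \<beta> u1)"
    by (intro add_mono mult_left_mono le) auto
  also have "\<dots> = ennreal (2 * k) * data"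
    using k by (simp add: data_def ennreal_mult distrib_left mult.assoc add.commute)
  finally show ?thesis .
qed

context
  assumes \<gamma>: "\<gamma> + (q + 1) \<le> \<beta>" "\<beta> + 1 / 2 \<le> \<gamma> + (q + 2)"
begin

text \<open>\<open>u0\<close> and \<open>u1\<close> live half a step apart in the scale. For both,
  the gap to \<gamma> must lie between q + 1, for growth and time regularity, and q + 2, for
  uniformity of the constant.\<close>

lemma \<gamma>': "\<gamma> + (q + 1) \<le> \<beta> + 1 / 2" "\<beta> \<le> \<gamma> + (q + 2)"
  using \<gamma> by linarith+

lemma u_bound:
  assumes t: "t \<in> {0..T}"
  shows "scale_norm_sq D A E \<gamma> (u t) \<le> ennreal (2 * K) * data" "scale_norm_sq D A E \<gamma> (u' t) \<le> ennreal (2 * K) * data"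
  unfolding u_def[abs_def] u'_def[abs_def]
  by (intro combine a.act_hyper hyper a.cont b.cont t a.scale_norm_sq_f[OF hyper(1) \<gamma>'(1) \<gamma>(2)]
      b.scale_norm_sq_f[OF hyper(2) \<gamma>(1) \<gamma>'(2)]; simp)+

lemma u_in_scale_space:
  assumes t: "t \<in> {0..T}"
  shows "u t \<in> scale_space D A E \<gamma>" "u' t \<in> scale_space D A E \<gamma>"
proof -
  have "ennreal (2 * K) * data < \<infinity>" using data_finite by (simp add: ennreal_mult_less_top)
  with u_bound[OF t] show "u t \<in> scale_space D A E \<gamma>" "u' t \<in> scale_space D A E \<gamma>"
    by (auto simp: scale_space_def hyper_u[OF t] elim: le_less_trans)
qed

lemma
  assumes s: "s \<in> {0..T}" and t: "t \<in> {0..T}"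
  shows u_diff: "scale_norm_sq D A E \<gamma> (\<lambda>n. u s n - u t n)
      \<le> ennreal (2 * ((\<bar>s - t\<bar> * a.rate)\<^sup>2 * \<kappa> powr (2 * (q + 2)))) * data"
    and u'_diff: "scale_norm_sq D A E \<gamma> (\<lambda>n. u' s n - u' t n)
      \<le> ennreal (2 * ((\<bar>s - t\<bar> * a.rate)\<^sup>2 * \<kappa> powr (2 * (q + 2)))) * data"
    and u_quotient: "s \<noteq> t \<Longrightarrow> scale_norm_sq D A E \<gamma> (\<lambda>n. (1 / (s - t)) *\<^sub>R (u s n - u t n) - u' t n)
      \<le> ennreal (2 * ((\<bar>s - t\<bar> * a.rate)\<^sup>2 * \<kappa> powr (2 * (q + 2)))) * data"
proof -
  note ha = a.hyper_diff[OF a.act_hyper[OF a.cont(1)[OF s] hyper(1)] a.act_hyper[OF a.cont(1)[OF t] hyper(1)]]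
    and hb = a.hyper_diff[OF a.act_hyper[OF b.cont(1)[OF s] hyper(2)] a.act_hyper[OF b.cont(1)[OF t] hyper(2)]]
    and ha' = a.hyper_diff[OF a.act_hyper[OF a.cont(2)[OF s] hyper(1)] a.act_hyper[OF a.cont(2)[OF t] hyper(1)]]
    and hb' = a.hyper_diff[OF a.act_hyper[OF b.cont(2)[OF s] hyper(2)] a.act_hyper[OF b.cont(2)[OF t] hyper(2)]]
  have "(\<lambda>n. u s n - u t n) = (\<lambda>n. (act (a s) u0 n - act (a t) u0 n) + (act (b s) u1 n - act (b t) u1 n))"
    by (simp add: u_def fun_eq_iff)
  then show "scale_norm_sq D A E \<gamma> (\<lambda>n. u s n - u t n)
      \<le> ennreal (2 * ((\<bar>s - t\<bar> * a.rate)\<^sup>2 * \<kappa> powr (2 * (q + 2)))) * data"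
    using combine[OF ha hb _ a.scale_norm_sq_f_diff(1)[OF hyper(1) \<gamma>'(1) \<gamma>(2) s t]
        b.scale_norm_sq_f_diff(1)[OF hyper(2) \<gamma>(1) \<gamma>'(2) s t]] by simp
  have "(\<lambda>n. u' s n - u' t n) = (\<lambda>n. (act (a' s) u0 n - act (a' t) u0 n) + (act (b' s) u1 n - act (b' t) u1 n))"
    by (simp add: u'_def fun_eq_iff)
  then show "scale_norm_sq D A E \<gamma> (\<lambda>n. u' s n - u' t n)
      \<le> ennreal (2 * ((\<bar>s - t\<bar> * a.rate)\<^sup>2 * \<kappa> powr (2 * (q + 2)))) * data"
    using combine[OF ha' hb' _ a.scale_norm_sq_f_diff(2)[OF hyper(1) \<gamma>'(1) \<gamma>(2) s t]
        b.scale_norm_sq_f_diff(2)[OF hyper(2) \<gamma>(1) \<gamma>'(2) s t]] by simp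
  assume st: "s \<noteq> t"
  have "(\<lambda>n. (1 / (s - t)) *\<^sub>R (u s n - u t n) - u' t n)
      = (\<lambda>n. ((1 / (s - t)) *\<^sub>R (act (a s) u0 n - act (a t) u0 n) - act (a' t) u0 n)
        + ((1 / (s - t)) *\<^sub>R (act (b s) u1 n - act (b t) u1 n) - act (b' t) u1 n))"
    by (simp add: u_def u'_def fun_eq_iff scaleR_add_right scaleR_diff_right)
  then show "scale_norm_sq D A E \<gamma> (\<lambda>n. (1 / (s - t)) *\<^sub>R (u s n - u t n) - u' t n)
      \<le> ennreal (2 * ((\<bar>s - t\<bar> * a.rate)\<^sup>2 * \<kappa> powr (2 * (q + 2)))) * data"
    using combine[OF a.hyper_diff[OF a.hyper_scaleR[OF ha] a.act_hyper[OF a.cont(2)[OF t] hyper(1)]]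
        a.hyper_diff[OF a.hyper_scaleR[OF hb] a.act_hyper[OF b.cont(2)[OF t] hyper(2)]] _
        a.scale_norm_sq_f_quotient[OF hyper(1) \<gamma>'(1) \<gamma>(2) s t st]
        b.scale_norm_sq_f_quotient[OF hyper(2) \<gamma>(1) \<gamma>'(2) s t st]] by simp
qed

lemma tendsto_0_of_rate:
  assumes "\<And>s. s \<in> {0..T} \<Longrightarrow> s \<noteq> t \<Longrightarrow>
    F s \<le> ennreal (2 * ((\<bar>s - t\<bar> * a.rate)\<^sup>2 * \<kappa> powr (2 * (q + 2)))) * data"
  shows "(F \<longlongrightarrow> 0) (at t within {0..T})"
  by (rule tendsto_0_of_le_square[OF data_finite, of "2 * \<kappa> powr (2 * (q + 2))" _ _ _ a.rate])
    (use assms in \<open>simp_all add: mult_ac\<close>)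

lemma u_continuous:
  "scale_continuous_on D A E \<gamma> {0..T} u" "scale_continuous_on D A E \<gamma> {0..T} u'"
  unfolding scale_continuous_on_def
  using u_in_scale_space u_diff u'_diff by (blast intro: tendsto_0_of_rate)+

lemma u_C1: "scale_C1_on D A E \<gamma> {0..T} u u'"
  unfolding scale_C1_on_def
  using u_continuous u_quotient by (blast intro: tendsto_0_of_rate)

end

end

theorem well_posed: "well_posed_with_finite_derivative_loss D A c T"
  unfolding well_posed_with_finite_derivative_loss_def
proof (intro exI conjI allI ballI)
  show "spectral_resolution D A E" by (rule a.spectral_resolution_E)
  \<comment> \<open>The loss: q + 1 for growth and time regularity of the multipliers, and 1/2
    because u is measured half a step higher than u' while \<open>u1\<close> lies only at index
    \<beta>.\<close>
  show "0 < q + 3 / 2" using a.q by linarith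
  \<comment> \<open>Each of the two norms on the left is at most 2 K times the data.\<close>
  show "0 < 4 * K" using a.rate_pos a.\<kappa> by simp
  fix \<beta> u0 u1
  assume data: "u0 \<in> scale_space D A E (\<beta> + 1 / 2)" "u1 \<in> scale_space D A E \<beta>"
  note u = u_def[OF data]
  have \<gamma>1: "\<beta> - (q + 3 / 2) + (q + 1) \<le> \<beta>" "\<beta> + 1 / 2 \<le> \<beta> - (q + 3 / 2) + (q + 2)" by simp_all
  have \<gamma>2: "\<beta> - (q + 3 / 2) + 1 / 2 + (q + 1) \<le> \<beta>" "\<beta> + 1 / 2 \<le> \<beta> - (q + 3 / 2) + 1 / 2 + (q + 2)" by simp_all
  let ?u = "u u0 u1" and ?u' = "u' u0 u1"
  show "very_weak_solution A E c T u0 u1 ?u ?u'" by (rule u_solution[OF data])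
  show "scale_continuous_on D A E (\<beta> - (q + 3 / 2) + 1 / 2) {0..T} ?u" by (rule u_continuous(1)[OF data \<gamma>2])
  show "scale_C1_on D A E (\<beta> - (q + 3 / 2)) {0..T} ?u ?u'" by (rule u_C1[OF data \<gamma>1])
  show "very_weak_solution A E c T u0 u1 v v' \<longrightarrow> (\<forall>t\<in>{0..T}. v t = ?u t \<and> v' t = ?u' t)" for v v'
    using a.very_weak_solution_unique[OF _ u_solution[OF data] a.c_le a.m_nonneg] by blast
  fix t assume t: "t \<in> {0..T}"
  have "scale_norm_sq D A E (\<beta> - (q + 3 / 2)) (?u' t) + scale_norm_sq D A E (\<beta> - (q + 3 / 2) + 1 / 2) (?u t)
      \<le> ennreal (2 * K) * data u0 u1 \<beta> + ennreal (2 * K) * data u0 u1 \<beta>"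
    by (rule add_mono[OF u_bound(2)[OF data \<gamma>1 t] u_bound(1)[OF data \<gamma>2 t]])
  also have "\<dots> = ennreal (4 * K) * data u0 u1 \<beta>"
    by (simp add: distrib_right[symmetric] ennreal_plus[symmetric] del: ennreal_plus)
  finally show "scale_norm_sq D A E (\<beta> - (q + 3 / 2)) (?u' t) + scale_norm_sq D A E (\<beta> - (q + 3 / 2) + 1 / 2) (?u t)
      \<le> ennreal (4 * K) * (scale_norm_sq D A E \<beta> u1 + scale_norm_sq D A E (\<beta> + 1 / 2) u0)"
    by (simp add: data_def[OF data])
qed

end

section \<open>From the hypotheses on A and c to the fundamental system\<close>

theorem theorem2p1:
  fixes D :: "'h::{real_inner, complete_space} set" and A :: "'h \<Rightarrow> 'h"
    and T0 K0 \<mu>1 \<mu>2 :: real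
    and \<omega> \<psi> c c' c'' :: "real \<Rightarrow> real"
  assumes "self_adjoint D A" and "nonnegative_operator D A"
    and "0 < T0" and "T0 < 1"
    and "\<forall>t\<in>{0<..T0}. \<omega> t > 0" and "antimono_on {0<..T0} \<omega>"
    and "\<forall>t\<in>{0<..T0}. \<psi> t > 0" and "antimono_on {0<..T0} \<psi>"
    and "\<forall>t\<in>{0<..T0}. \<omega> t * (1 + \<psi> t) \<le> K0 * \<bar>ln t\<bar>"
    and "\<forall>t\<in>{0<..T0}. (c has_real_derivative c' t) (at t within {0<..T0})"
    and "\<forall>t\<in>{0<..T0}. (c' has_real_derivative c'' t) (at t within {0<..T0})"
    and "continuous_on {0<..T0} c''"
    and "0 < \<mu>1" and "0 < \<mu>2" and "\<forall>t\<in>{0<..<T0}. \<mu>1 \<le> c t \<and> c t \<le> \<mu>2"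
    and "\<forall>t\<in>{0<..T0}. \<bar>c' t\<bar> \<le> \<omega> t / t"
    and "\<forall>t\<in>{0<..T0}. \<bar>c'' t\<bar> \<le> (\<omega> t)\<^sup>2 / t\<^sup>2 * exp (\<psi> t)"
  shows "well_posed_with_finite_derivative_loss D A c T0"
proof -
  interpret osc: oscillating_coefficient T0 K0 \<mu>1 \<mu>2 \<omega> \<psi> c c' c''
    by unfold_locales (use assms in auto)
  interpret op: nonneg_self_adjoint D A
    by unfold_locales (use assms in auto)
  text \<open>The hypotheses say nothing about the value of \<open>c\<close> at \<open>0\<close>.\<close>
  define c0 where "c0 t = (if t \<le> 0 then 0 else c t)" for t
  interpret bc: bounded_coefficient c0 T0 \<mu>2
  proof
    show "continuous_on {0<..T0} c0"
      by (rule continuous_on_cong[THEN iffD1, OF refl _ osc.c_continuous]) (simp add: c0_def)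
    show "\<bar>c0 t\<bar> \<le> \<mu>2" if "t \<in> {0..T0}" for t
      using osc.c_bounds[of t] that osc.\<mu> by (auto simp: c0_def)
  qed (use osc.T0 in auto)
  have sol: "wave_solution c T0 l (bc.sol p q l) (bc.dsol p q l)" for p q l
    unfolding wave_solution_def
  proof (intro conjI ballI)
    fix t assume "t \<in> {0<..T0}"
    then show "(bc.dsol p q l has_real_derivative - (l * c t * bc.sol p q l t)) (at t within {0..T0})"
      using bc.dsol_derivative[of t p q l] by (simp add: c0_def)
  qed (rule bc.sol_derivative bc.dsol_continuous, assumption?)+
  obtain M p where Mp: "0 < M" "0 < p" and growth: "\<And>l u u' t. 0 \<le> l \<Longrightarrow> wave_solution c T0 l u u' \<Longrightarrow> t \<in> {0..T0} \<Longrightarrow>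
      (u' t)\<^sup>2 + (u t)\<^sup>2 \<le> M * (1 + l) powr p * ((u' 0)\<^sup>2 + (u 0)\<^sup>2)"
    using osc.polynomial_growth by blast
  \<comment> \<open>Normalising x^2 + y^2 = 1 makes the initial energy 1 and covers both fundamental
    solutions; square roots of the energy bound give the constants sqrt M and p / 2.\<close>
  have fam: "growing_family c T0 \<mu>2 (sqrt M) (p / 2) (\<lambda>t l. bc.sol x y l t) (\<lambda>t l. bc.dsol x y l t)"
    if xy: "x\<^sup>2 + y\<^sup>2 = 1" for x y
  proof
    have "y\<^sup>2 + x\<^sup>2 = 1" using xy by simp
    have sq: "\<bar>z\<bar> \<le> sqrt M * (1 + l) powr (p / 2)" if "z\<^sup>2 \<le> M * (1 + l) powr p" "0 \<le> l" for z l :: real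
    proof -
      have "\<bar>z\<bar> \<le> sqrt (M * (1 + l) powr p)" using that(1) by (rule real_le_rsqrt[OF _, of "\<bar>z\<bar>", simplified])
      also have "\<dots> = sqrt M * (1 + l) powr (p / 2)" 
        using that(2) by (simp add: real_sqrt_mult powr_half_sqrt[symmetric] powr_powr)
      finally show ?thesis .
    qed
    fix t l :: real assume t: "t \<in> {0..T0}" "0 \<le> l"
    have "(bc.dsol x y l t)\<^sup>2 + (bc.sol x y l t)\<^sup>2 \<le> M * (1 + l) powr p"
      using growth[OF t(2) sol t(1), of x y] by (simp add: bc.sol_initial \<open>y\<^sup>2 + x\<^sup>2 = 1\<close>)
    then show "\<bar>bc.sol x y l t\<bar> \<le> sqrt M * (1 + l) powr (p / 2)" "\<bar>bc.dsol x y l t\<bar> \<le> sqrt M * (1 + l) powr (p / 2)"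
      using sum_power2_ge_zero[of "bc.dsol x y l t" "bc.sol x y l t"] zero_le_power2[of "bc.dsol x y l t"] zero_le_power2[of "bc.sol x y l t"]
      by (intro sq t(2); linarith)+
  next
    show "\<bar>c t\<bar> \<le> \<mu>2" if "t \<in> {0<..T0}" for t using osc.c_bounds[OF that] osc.\<mu> by auto
  qed (use osc.T0 osc.c_continuous Mp sol bc.sol_continuous_parameter in auto)
  obtain W \<kappa> where W: "continuous_on UNIV W" "\<And>l. 0 < W l" "1 \<le> \<kappa>" "\<And>l. 0 \<le> l \<Longrightarrow> 1 + l \<le> \<kappa> * W l"
    "\<And>x. AE l in spectral_measure op.E x. scale_weight D A l = W l"
    using op.weight_exists by blast
  interpret fundamental_system D A W \<kappa> c T0 \<mu>2 "sqrt M" "p / 2"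
    "\<lambda>t l. bc.sol 1 0 l t" "\<lambda>t l. bc.dsol 1 0 l t" "\<lambda>t l. bc.sol 0 1 l t" "\<lambda>t l. bc.dsol 0 1 l t"
  proof (intro fundamental_system.intro family_action.intro fundamental_system_axioms.intro fam)
    show "weighted_scale D A W \<kappa>" by unfold_locales (use W in auto)
    then show "weighted_scale D A W \<kappa>" .
  qed (simp_all add: bc.sol_initial)
  show ?thesis by (rule well_posed)
qed

end
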